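(* Let $d\ge1$, $s\in\mathbb R$, $1\le p,q\le\infty$ and $\frac1p+\frac1{p'}=\frac1q+\frac1{q'}=1$. Let $B^s_{p,q}(H)$ be the Besov spaces associated with the harmonic oscillator $H=-\Delta+|x|^2$ on $\mathbb R^d$. (i) Assume that $q<\infty$ and $f\in B^s_{p,q}(H)$. Then $$\lim_{t\to0}\|e^{-tH}f-f\|_{B^s_{p,q}(H)}=0.$$ (ii) Assume that $1<p\le\infty$, $q=\infty$ and $f\in B^s_{p,\infty}(H)$. Then $e^{-tH}f$ converges to $f$ in the dual weak sense as $t\to0$, namely, $$\lim_{t\to0}\sum_{j\in\mathbb Z}\int_{\mathbb R^d}\Big\{\phi_j(\sqrt H)\big(e^{-tH}f-f\big)\Big\}\,\overline{\phi_j(\sqrt H)g}\,dx=0$$ for any $g\in B^{-s}_{p',1}(H)$.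
   Context: $H=-\Delta+|x|^2$ is the self-adjoint operator on $L^2(\mathbb R^d)$ with domain $\{f\in L^2: \Delta f,\ |x|^2f\in L^2\}$. Its spectrum consists of the eigenvalues $2n+d$, $n=0,1,2,\dots$, with Hermite functions as eigenfunctions. Functions of $H$ are defined on $L^2$ by the spectral theorem; $\phi_j(\sqrt H)$ and $e^{-tH}$ ($t\ge0$) are extended to $\mathcal S'(\mathbb R^d)$ by duality (they map $\mathcal S(\mathbb R^d)$ to itself). The limits $t\to0$ are taken over $t>0$. Fix a non-negative $\phi_0\in C_0^\infty(\mathbb R)$ with $\operatorname{supp}\phi_0\subset[2^{-1},2]$ and $\sum_{j\in\mathbb Z}\phi_0(2^{-j}\lambda)=1$ for all $\lambda>0$, and put $\phi_j(\lambda)=\phi_0(2^{-j}\lambda)$ for $j\in\mathbb Z$. One has $\phi_j(\sqrt H)=0$ for $j<-1$. For $s\in\mathbb R$ and $1\le p,q\le\infty$, $$\|f\|_{B^s_{p,q}(H)}=\Big\|\big\{2^{sj}\|\phi_j(\sqrt H)f\|_{L^p(\mathbb R^d)}\big\}_{j=-1}^\infty\Big\|_{\ell^q},\qquad B^s_{p,q}(H)=\{f\in\mathcal S'(\mathbb R^d):\|f\|_{B^s_{p,q}(H)}<\infty\}.$$ *)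

theory Defs
  imports "HOL-Analysis.Analysis" "HOL-Probability.Essential_Supremum"
begin

text \<open>
  The space $R^d$ is an arbitrary type of class \<open>euclidean_space\<close>, with $d$ = \<open>DIM('a)\<close>. Elements of
  $L^p$ are Borel functions for \<^term>\<open>lborel\<close>, and identities in $L^p$ hold almost everywhere.
  Operators on $L^2$ are relations \<open>T f g\<close>, read as: $f$ is in the domain of $T$ and $Tf = g$.
\<close>

subsection \<open>Lebesgue and sequence norms\<close>

definition ennpowr :: "ennreal \<Rightarrow> real \<Rightarrow> ennreal" where
  "ennpowr x r = (if x = \<infinity> then \<infinity> else ennreal (enn2real x powr r))"

text \<open>
  With \<open>M = lborel\<close> this is the $L^p$ norm of a function with modulus \<open>u\<close>; with a counting measure
  it is the $l^p$ norm of a sequence of numbers in $[0,\infty]$. Meant for $1 \le p \le \infty$.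
\<close>
definition lebesgue_norm :: "'b measure \<Rightarrow> ennreal \<Rightarrow> ('b \<Rightarrow> ennreal) \<Rightarrow> ennreal" where
  "lebesgue_norm M p u =
     (if p = \<infinity> then esssup M u
      else ennpowr (\<integral>\<^sup>+ x. ennpowr (u x) (enn2real p) \<partial>M) (1 / enn2real p))"

definition Lp_norm :: "ennreal \<Rightarrow> ('a::euclidean_space \<Rightarrow> complex) \<Rightarrow> ennreal" where
  "Lp_norm p f = lebesgue_norm lborel p (\<lambda>x. ennreal (norm (f x)))"

definition Lp_space :: "ennreal \<Rightarrow> ('a::euclidean_space \<Rightarrow> complex) set" where
  "Lp_space p = {f \<in> borel_measurable lborel. Lp_norm p f < \<infinity>}"

definition L2_inner :: "('a::euclidean_space \<Rightarrow> complex) \<Rightarrow> ('a \<Rightarrow> complex) \<Rightarrow> complex" where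
  "L2_inner f g = (\<integral>x. f x * cnj (g x) \<partial>lborel)"

subsection \<open>Schwartz functions and tempered distributions\<close>

primrec iter_partial ::
  "'a::euclidean_space list \<Rightarrow> ('a \<Rightarrow> 'b::real_normed_vector) \<Rightarrow> 'a \<Rightarrow> 'b" where
  "iter_partial [] f = f"
| "iter_partial (v # vs) f = (\<lambda>x. frechet_derivative (iter_partial vs f) (at x) v)"

definition smooth :: "('a::euclidean_space \<Rightarrow> 'b::real_normed_vector) \<Rightarrow> bool" where
  "smooth f \<longleftrightarrow> (\<forall>vs. set vs \<subseteq> Basis \<longrightarrow> iter_partial vs f differentiable_on UNIV)"

definition schwartz_space :: "('a::euclidean_space \<Rightarrow> complex) set" where
  "schwartz_space = {f. smooth f \<and>
     (\<forall>N vs. set vs \<subseteq> Basis \<longrightarrow> bdd_above (range (\<lambda>x. (1 + norm x) ^ N * norm (iter_partial vs f x))))}"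

definition schwartz_norm :: "nat \<Rightarrow> ('a::euclidean_space \<Rightarrow> complex) \<Rightarrow> real" where
  "schwartz_norm N f =
     (\<Sum>vs | set vs \<subseteq> Basis \<and> length vs \<le> N. SUP x. (1 + norm x) ^ N * norm (iter_partial vs f x))"

definition laplacian :: "('a::euclidean_space \<Rightarrow> complex) \<Rightarrow> 'a \<Rightarrow> complex" where
  "laplacian f x = (\<Sum>b\<in>Basis. iter_partial [b, b] f x)"

text \<open>
  Distributions pair bilinearly with Schwartz functions. Only the values of a functional on the
  Schwartz space matter; those elsewhere are junk.
\<close>
type_synonym 'a functional = "('a \<Rightarrow> complex) \<Rightarrow> complex"

definition tempered :: "'a::euclidean_space functional set" where
  "tempered = {u.
     (\<forall>a b. \<forall>f\<in>schwartz_space. \<forall>g\<in>schwartz_space. u (\<lambda>x. a * f x + b * g x) = a * u f + b * u g) \<and>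
     (\<exists>C N. \<forall>f\<in>schwartz_space. norm (u f) \<le> C * schwartz_norm N f)}"

definition represents :: "('a::euclidean_space \<Rightarrow> complex) \<Rightarrow> 'a functional \<Rightarrow> bool" where
  "represents f u \<longleftrightarrow> f \<in> borel_measurable lborel \<and>
     (\<forall>g\<in>schwartz_space. integrable lborel (\<lambda>x. f x * g x) \<and> u g = (\<integral>x. f x * g x \<partial>lborel))"

text \<open>The function (unique almost everywhere) of a distribution that is a function.\<close>
definition function_of :: "'a::euclidean_space functional \<Rightarrow> 'a \<Rightarrow> complex" where
  "function_of u = (SOME f. represents f u)"

text \<open>The infimum is over a single value, or is \<open>Inf {} = \<infinity>\<close> when \<open>u\<close> is not in $L^p$.\<close>
definition dist_Lp_norm :: "ennreal \<Rightarrow> 'a::euclidean_space functional \<Rightarrow> ennreal" where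
  "dist_Lp_norm p u = Inf {Lp_norm p f | f. f \<in> Lp_space p \<and> represents f u}"

subsection \<open>The harmonic oscillator and its functional calculus\<close>

text \<open>
  The function \<open>l\<close> below is the distributional Laplacian of \<open>f\<close>, so that the domain is
  $\{f \in L^2 : \Delta f, |x|^2 f \in L^2\}$.
\<close>
definition harmonic_oscillator ::
  "('a::euclidean_space \<Rightarrow> complex) \<Rightarrow> ('a \<Rightarrow> complex) \<Rightarrow> bool" where
  "harmonic_oscillator f g \<longleftrightarrow>
     f \<in> Lp_space 2 \<and> g \<in> Lp_space 2 \<and> (\<lambda>x. of_real ((norm x)\<^sup>2) * f x) \<in> Lp_space 2 \<and>
     (\<exists>l\<in>Lp_space 2. represents l (\<lambda>\<psi>. \<integral>x. f x * laplacian \<psi> x \<partial>lborel) \<and>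
        (AE x in lborel. g x = - l x + of_real ((norm x)\<^sup>2) * f x))"

definition eigenspace :: "real \<Rightarrow> ('a::euclidean_space \<Rightarrow> complex) set" where
  "eigenspace \<mu> = {h. harmonic_oscillator h (\<lambda>x. of_real \<mu> * h x)}"

definition eigenvalues :: "'a::euclidean_space itself \<Rightarrow> real set" where
  "eigenvalues _ = {\<mu>. \<exists>h::'a \<Rightarrow> complex. h \<in> eigenspace \<mu> \<and> \<not> (AE x in lborel. h x = 0)}"

text \<open>The orthogonal projection of $L^2$ onto the eigenspace, determined almost everywhere.\<close>
definition eigenprojection ::
  "real \<Rightarrow> ('a::euclidean_space \<Rightarrow> complex) \<Rightarrow> 'a \<Rightarrow> complex" where
  "eigenprojection \<mu> f =
     (SOME p. p \<in> eigenspace \<mu> \<and> (\<forall>h\<in>eigenspace \<mu>. L2_inner (\<lambda>x. f x - p x) h = 0))"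

text \<open>
  $F(H)f = g$ in $L^2$. The spectrum of $H$ is discrete, so its spectral resolution is
  $E(B) = \sum_{\mu \in B} P_\mu$ with $\mu$ ranging over the eigenvalues and $P_\mu$ the
  eigenprojections, and $F(H) = \int F\,dE = \sum_\mu F(\mu) P_\mu$, strongly on the maximal domain.
\<close>
definition func_calc ::
  "(real \<Rightarrow> real) \<Rightarrow> ('a::euclidean_space \<Rightarrow> complex) \<Rightarrow> ('a \<Rightarrow> complex) \<Rightarrow> bool" where
  "func_calc F f g \<longleftrightarrow> f \<in> Lp_space 2 \<and> g \<in> Lp_space 2 \<and>
     ((\<lambda>A. Lp_norm 2 (\<lambda>x. g x - (\<Sum>\<mu>\<in>A. of_real (F \<mu>) * eigenprojection \<mu> f x))) \<longlongrightarrow> 0)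
       (finite_subsets_at_top (eigenvalues TYPE('a)))"

text \<open>For \<open>F(H)\<close> mapping the Schwartz space to itself: the Schwartz representative of \<open>F(H) \<psi>\<close>.\<close>
definition func_calc_schwartz ::
  "(real \<Rightarrow> real) \<Rightarrow> ('a::euclidean_space \<Rightarrow> complex) \<Rightarrow> 'a \<Rightarrow> complex" where
  "func_calc_schwartz F \<psi> = (THE g. g \<in> schwartz_space \<and> func_calc F \<psi> g)"

text \<open>
  The extension by duality. As $F$ is real and $H$ commutes with complex conjugation, $F(H)$ is its
  own transpose for the bilinear pairing, so this extends \<open>func_calc\<close>.
\<close>
definition func_calc_dist ::
  "(real \<Rightarrow> real) \<Rightarrow> 'a::euclidean_space functional \<Rightarrow> 'a functional" where
  "func_calc_dist F u = (\<lambda>\<psi>. u (func_calc_schwartz F \<psi>))"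

definition heat :: "real \<Rightarrow> 'a::euclidean_space functional \<Rightarrow> 'a functional" where
  "heat t = func_calc_dist (\<lambda>\<mu>. exp (- t * \<mu>))"

definition heat_diff :: "real \<Rightarrow> 'a::euclidean_space functional \<Rightarrow> 'a functional" where
  "heat_diff t u = (\<lambda>\<psi>. heat t u \<psi> - u \<psi>)"

subsection \<open>Besov spaces\<close>

definition dyadic_partition :: "(real \<Rightarrow> real) \<Rightarrow> bool" where
  "dyadic_partition \<phi>\<^sub>0 \<longleftrightarrow> smooth \<phi>\<^sub>0 \<and> (\<forall>x. 0 \<le> \<phi>\<^sub>0 x) \<and>
     closure {x. \<phi>\<^sub>0 x \<noteq> 0} \<subseteq> {1/2..2} \<and>
     (\<forall>x>0. ((\<lambda>j::int. \<phi>\<^sub>0 (2 powr (- of_int j) * x)) has_sum 1) UNIV)"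

text \<open>The operator $\phi_j(\sqrt H)$.\<close>
definition block ::
  "(real \<Rightarrow> real) \<Rightarrow> int \<Rightarrow> 'a::euclidean_space functional \<Rightarrow> 'a functional" where
  "block \<phi>\<^sub>0 j = func_calc_dist (\<lambda>\<mu>. \<phi>\<^sub>0 (2 powr (- of_int j) * sqrt \<mu>))"

definition besov_norm ::
  "(real \<Rightarrow> real) \<Rightarrow> real \<Rightarrow> ennreal \<Rightarrow> ennreal \<Rightarrow> 'a::euclidean_space functional \<Rightarrow> ennreal" where
  "besov_norm \<phi>\<^sub>0 s p q u =
     lebesgue_norm (count_space {-1..}) q
       (\<lambda>j. ennreal (2 powr (s * of_int j)) * dist_Lp_norm p (block \<phi>\<^sub>0 j u))"

definition besov_space ::
  "(real \<Rightarrow> real) \<Rightarrow> real \<Rightarrow> ennreal \<Rightarrow> ennreal \<Rightarrow> 'a::euclidean_space functional set" where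
  "besov_space \<phi>\<^sub>0 s p q = {u \<in> tempered. besov_norm \<phi>\<^sub>0 s p q u < \<infinity>}"

definition pairing_integrand ::
  "(real \<Rightarrow> real) \<Rightarrow> int \<Rightarrow> 'a::euclidean_space functional \<Rightarrow> 'a functional \<Rightarrow> 'a \<Rightarrow> complex" where
  "pairing_integrand \<phi>\<^sub>0 j u v x = function_of (block \<phi>\<^sub>0 j u) x * cnj (function_of (block \<phi>\<^sub>0 j v) x)"

definition besov_pairing ::
  "(real \<Rightarrow> real) \<Rightarrow> 'a::euclidean_space functional \<Rightarrow> 'a functional \<Rightarrow> complex" where
  "besov_pairing \<phi>\<^sub>0 u v = (\<Sum>\<^sub>\<infinity>j\<in>(UNIV::int set). \<integral>x. pairing_integrand \<phi>\<^sub>0 j u v x \<partial>lborel)"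

text \<open>
  The expression \<open>besov_pairing\<close> is meaningful: all the distributions in it are functions, and the
  integrals and the series converge. Without this, the totalized integral and sum could be 0.
\<close>
definition besov_pairing_defined ::
  "(real \<Rightarrow> real) \<Rightarrow> 'a::euclidean_space functional \<Rightarrow> 'a functional \<Rightarrow> bool" where
  "besov_pairing_defined \<phi>\<^sub>0 u v \<longleftrightarrow>
     (\<forall>j. (\<exists>f. represents f (block \<phi>\<^sub>0 j u)) \<and> (\<exists>g. represents g (block \<phi>\<^sub>0 j v)) \<and>
          integrable lborel (pairing_integrand \<phi>\<^sub>0 j u v)) \<and>
     (\<lambda>j. \<integral>x. pairing_integrand \<phi>\<^sub>0 j u v x \<partial>lborel) summable_on UNIV"

end

theory Submission
  imports Defs "HOL-Probability.Levy"
begin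

text \<open>
  A block \<open>\<phi>\<^sub>j(\<surd>H) f\<close> of a tempered distribution is a finite sum of Hermite functions, because every
  eigenfunction of \<open>H\<close> in $L^2$ is such a sum: it is orthogonal to the Hermite functions of all other
  energies, and a function orthogonal to all Hermite functions vanishes, since exponentially
  decaying measures are determined by their moments. Hence
  $\|(e^{-tH} - 1) \phi_j(\sqrt H) f\|_p \to 0$ for each fixed $j$. By Mehler's formula $e^{-tH}$ is a
  convolution with a Gaussian probability density between multiplications by functions bounded
  by 1, so it is a contraction on every $L^p$; the blocks of $e^{-tH} f - f$ are thus dominated by
  those of $f$, uniformly in $t$, and both claims follow by dominated convergence in $j$, the
  second one after Hoelder's inequality.
\<close>

subsection \<open>Moments and completeness\<close>

text \<open>The functional calculus is built from eigenprojections that are arbitrary choices, and a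
  distribution that is a function is only known to pair with Schwartz functions. Hermite
  coefficients are the common currency: in them every operator that occurs acts on finitely many
  numbers, and no infinite expansion is ever summed. For the semigroup this rests on the order of
  the operators. By duality the cutoff reaches the test function before the heat operator does, so
  the latter meets a finite sum. Two estimates of a block of \<open>heat_diff t u\<close> complement
  each other. The first is of order \<open>t\<close>, but its constant depends on the block and on
  its coefficients and is useless for summing over \<open>j\<close>. The second is 4 times the norm
  of the block of \<open>u\<close>, uniform in \<open>j\<close> and \<open>t\<close> but not small.
  Smallness term by term comes from the first, the majorant from the second. The uniform bound needs
  a kernel with an \<open>L^1\<close> bound, and the factored form of Mehler's kernel shows one at
  sight. That the kernel belongs to the semigroup is checked on Hermite functions only, which is all
  that finite sums require.\<close>

lemma poly_le_exp:
  fixes p :: "real poly"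
  shows "\<exists>C k. 0 \<le> C \<and> 0 \<le> k \<and> (\<forall>t. \<bar>poly p t\<bar> \<le> C * exp (k * \<bar>t\<bar>))"
proof (induction p)
  case 0
  show ?case by (intro exI[of _ 0]) auto
next
  case (pCons a p)
  then obtain C k where C: "0 \<le> C" "0 \<le> k" "\<And>t. \<bar>poly p t\<bar> \<le> C * exp (k * \<bar>t\<bar>)" by blast
  \<comment> \<open>Each degree costs one unit of rate, because
    \<open>|t| <= exp |t|\<close>.\<close>
  have "\<bar>poly (pCons a p) t\<bar> \<le> (\<bar>a\<bar> + C) * exp ((k + 1) * \<bar>t\<bar>)" for t
  proof -
    have 1: "\<bar>a\<bar> * 1 \<le> \<bar>a\<bar> * exp ((k + 1) * \<bar>t\<bar>)"
      using C by (intro mult_left_mono) auto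
    have "\<bar>t\<bar> \<le> exp \<bar>t\<bar>"
      using exp_ge_add_one_self[of "\<bar>t\<bar>"] by linarith
    then have 2: "\<bar>t\<bar> * \<bar>poly p t\<bar> \<le> exp \<bar>t\<bar> * (C * exp (k * \<bar>t\<bar>))"
      using C by (intro mult_mono) auto
    have "\<bar>poly (pCons a p) t\<bar> \<le> \<bar>a\<bar> + \<bar>t\<bar> * \<bar>poly p t\<bar>"
      by (simp add: abs_mult[symmetric] abs_triangle_ineq)
    then show ?thesis
      using 1 2 by (simp add: algebra_simps exp_add)
  qed
  then show ?case using C by (intro exI[of _ "\<bar>a\<bar> + C"] exI[of _ "k + 1"]) auto
qed

lemma integrable_mult_of_le:
  fixes f g h :: "'b \<Rightarrow> real"
  assumes "integrable M h" "f \<in> borel_measurable M" "\<And>x. \<bar>f x\<bar> \<le> C * \<bar>h x\<bar>"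
  shows "integrable M f"
  by (rule Bochner_Integration.integrable_bound[where f="\<lambda>x. C * h x"])
     (use assms order_trans[OF assms(3) mult_right_mono[OF abs_ge_self[of C]]] in \<open>auto simp: abs_mult\<close>)

text \<open>Exponential moments allow the series of \<open>iexp\<close> to be integrated term by
  term: every partial sum, times \<open>f\<close>, is dominated by \<open>|f| exp (|t| |X|)\<close>,
  and each term is a moment.\<close>

lemma char_eq_0_of_moments:
  fixes f X :: "'b \<Rightarrow> real"
  assumes [measurable]: "X \<in> borel_measurable M" "f \<in> borel_measurable M"
    and ex: "\<And>c. integrable M (\<lambda>x. f x * exp (c * \<bar>X x\<bar>))"
    and mom: "\<And>n. (\<integral>x. f x * X x ^ n \<partial>M) = 0"
  shows "(\<integral>x. of_real (f x) * iexp (t * X x) \<partial>M) = 0"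
proof -
  define s where "s n x = of_real (f x) * (\<Sum>k<n. (\<i> * of_real (t * X x)) ^ k /\<^sub>R fact k)" for n x
  have le: "norm (\<Sum>k<n. (\<i> * of_real (t * y)) ^ k /\<^sub>R fact k) \<le> exp (\<bar>t\<bar> * \<bar>y\<bar>)" for n and y :: real
  proof -
    have "norm (\<Sum>k<n. (\<i> * of_real (t * y)) ^ k /\<^sub>R fact k) \<le> (\<Sum>k<n. (\<bar>t\<bar> * \<bar>y\<bar>) ^ k /\<^sub>R fact k)"
      by (rule order_trans[OF norm_sum]) (simp add: norm_power norm_mult abs_mult)
    also have "\<dots> \<le> exp (\<bar>t\<bar> * \<bar>y\<bar>)"
      unfolding exp_def by (intro sum_le_suminf summable_exp_generic) auto
    finally show ?thesis .
  qed
  \<comment> \<open>The constant \<open>fact k\<close> comes from keeping only the term of degree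
    \<open>k\<close> in the series of \<open>exp |X|\<close>.\<close>
  have im: "integrable M (\<lambda>x. f x * X x ^ k)" for k
  proof (rule integrable_mult_of_le[OF ex[of 1], where C="fact k"])
    fix x
    have "\<bar>X x\<bar> ^ k /\<^sub>R fact k \<le> exp \<bar>X x\<bar>"
      unfolding exp_def
      using sum_le_suminf[OF summable_exp_generic[of "\<bar>X x\<bar>"], of "{k}"] by simp
    then have "\<bar>X x\<bar> ^ k \<le> fact k * exp \<bar>X x\<bar>"
      by (simp add: field_simps)
    then show "\<bar>f x * X x ^ k\<bar> \<le> fact k * \<bar>f x * exp (1 * \<bar>X x\<bar>)\<bar>"
      using mult_left_mono[of "\<bar>X x\<bar> ^ k" "fact k * exp \<bar>X x\<bar>" "\<bar>f x\<bar>"]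
      by (simp add: abs_mult power_abs algebra_simps)
  qed measurable
  have s0: "(\<integral>x. s n x \<partial>M) = 0" for n
  proof -
    have "s n = (\<lambda>x. \<Sum>k<n. ((\<i> * of_real t) ^ k /\<^sub>R fact k) * of_real (f x * X x ^ k))"
      by (auto simp: s_def sum_distrib_left power_mult_distrib scaleR_conv_of_real mult_ac intro!: ext sum.cong)
    then show ?thesis
      using im mom by (simp add: Bochner_Integration.integral_sum integral_mult_right_zero del: of_real_mult of_real_power)
  qed
  have "(\<lambda>n. \<integral>x. s n x \<partial>M) \<longlonglongrightarrow> (\<integral>x. of_real (f x) * iexp (t * X x) \<partial>M)"
  proof (rule integral_dominated_convergence[where w="\<lambda>x. \<bar>f x * exp (\<bar>t\<bar> * \<bar>X x\<bar>)\<bar>"])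
    show "integrable M (\<lambda>x. \<bar>f x * exp (\<bar>t\<bar> * \<bar>X x\<bar>)\<bar>)"
      using ex[of "\<bar>t\<bar>"] by simp
    show "AE x in M. (\<lambda>n. s n x) \<longlonglongrightarrow> of_real (f x) * iexp (t * X x)"
      unfolding s_def
      using exp_converges by (intro always_eventually allI tendsto_intros) (auto simp: sums_def)
    show "AE x in M. norm (s n x) \<le> \<bar>f x * exp (\<bar>t\<bar> * \<bar>X x\<bar>)\<bar>" for n
      using le by (auto simp: s_def norm_mult abs_mult intro!: mult_left_mono)
  qed (auto simp: s_def)
  then show ?thesis by (simp add: s0 LIMSEQ_const_iff)
qed

text \<open>The positive and the negative part of \<open>f\<close> have the same mass by the zeroth
  moment. Divided by it, they give two laws of \<open>X\<close> that are probability measures with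
  the same characteristic function, and Levy's uniqueness theorem applies.\<close>

lemma integral_indicator_eq_0_of_moments:
  fixes f X :: "'b \<Rightarrow> real"
  assumes [measurable]: "X \<in> borel_measurable M" "f \<in> borel_measurable M" "B \<in> sets borel"
    and ex: "\<And>c. integrable M (\<lambda>x. f x * exp (c * \<bar>X x\<bar>))"
    and mom: "\<And>n. (\<integral>x. f x * X x ^ n \<partial>M) = 0"
  shows "(\<integral>x. f x * indicator B (X x) \<partial>M) = 0"
proof -
  have f: "integrable M f" using ex[of 0] by simp
  \<comment> \<open>\<open>g 1\<close> is the positive and \<open>g (-1)\<close> the negative part
    of \<open>f\<close>.\<close>
  define g where "g \<sigma> x = max 0 (\<sigma> * f x)" for \<sigma> x
  have g[measurable]: "g \<sigma> \<in> borel_measurable M" and g0: "0 \<le> g \<sigma> x" for \<sigma> x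
    unfolding g_def by auto
  have gi: "integrable M (g \<sigma>)" for \<sigma>
    unfolding g_def using f by auto
  have fg: "f x = g 1 x - g (-1) x" for x by (auto simp: g_def)
  define c where "c = (\<integral>x. g 1 x \<partial>M)"
  have c: "(\<integral>x. g (-1) x \<partial>M) = c"
    using mom[of 0] gi by (simp add: fg c_def)
  show ?thesis
  proof (cases "c = 0")
    \<comment> \<open>Without mass there is nothing to normalize, but then both parts vanish almost
      everywhere.\<close>
    case True
    then have "AE x in M. g \<sigma> x = 0" if "\<sigma> = 1 \<or> \<sigma> = -1" for \<sigma>
      using c c_def gi[of \<sigma>] g0 that by (subst integral_nonneg_eq_0_iff_AE[symmetric]) auto
    from this[of 1] this[of "-1"] have "AE x in M. g 1 x = 0" "AE x in M. g (-1) x = 0"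
      by auto
    then have "AE x in M. f x * indicator B (X x) = 0"
      by eventually_elim (simp add: fg)
    then show ?thesis by (simp add: integral_eq_zero_AE)
  next
    case False
    then have c0: "0 < c" using g0 unfolding c_def by (simp add: order.not_eq_order_implies_strict)
    have ci: "(\<integral>x. g \<sigma> x \<partial>M) = c" if "\<sigma> = 1 \<or> \<sigma> = -1" for \<sigma>
      using that c c_def by auto
    define N where "N \<sigma> = distr (density M (\<lambda>x. ennreal (g \<sigma> x / c))) borel X" for \<sigma>
    have rd: "real_distribution (N \<sigma>)" if "\<sigma> = 1 \<or> \<sigma> = -1" for \<sigma>
    proof -
      have "emeasure (density M (\<lambda>x. ennreal (g \<sigma> x / c))) (space M) = (\<integral>\<^sup>+x. ennreal (g \<sigma> x / c) \<partial>M)"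
        by (simp add: emeasure_density cong: nn_integral_cong)
      also have "\<dots> = 1"
        using c0 g0 gi[of \<sigma>] ci[OF that] by (subst nn_integral_eq_integral) auto
      finally have "prob_space (density M (\<lambda>x. ennreal (g \<sigma> x / c)))"
        by (intro prob_spaceI) simp
      then show ?thesis unfolding N_def
        by (intro prob_space.real_distribution_distr) auto
    qed
    have ch: "char (N \<sigma>) t = (\<integral>x. of_real (g \<sigma> x) * iexp (t * X x) \<partial>M) / c" for \<sigma> t
      unfolding char_def N_def using c0 g0
      by (subst integral_distr; (subst integral_density)?)
         (auto simp: scaleR_conv_of_real)
    have gint: "integrable M (\<lambda>x. of_real (g \<sigma> x) * iexp (t * X x))" for \<sigma> t
      by (rule Bochner_Integration.integrable_bound[OF gi[of \<sigma>]]) (auto simp: norm_mult)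
    have "char (N 1) = char (N (-1))"
    proof
      fix t
      have "(\<integral>x. of_real (g 1 x) * iexp (t * X x) \<partial>M) - (\<integral>x. of_real (g (-1) x) * iexp (t * X x) \<partial>M)
         = (\<integral>x. of_real (f x) * iexp (t * X x) \<partial>M)"
        by (subst Bochner_Integration.integral_diff[OF gint gint, symmetric]) (simp add: fg algebra_simps)
      also have "\<dots> = 0" by (rule char_eq_0_of_moments) (use ex mom in auto)
      finally show "char (N 1) t = char (N (-1)) t" by (simp add: ch)
    qed
    then have "N 1 = N (-1)" using rd by (intro Levy_uniqueness) auto
    moreover have "(\<integral>x. g \<sigma> x * indicator B (X x) \<partial>M) = c * (\<integral>x. indicator B x \<partial>N \<sigma>)" for \<sigma>
      unfolding N_def using c0 g0
      by (subst integral_distr; (subst integral_density)?) auto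
    moreover have "integrable M (\<lambda>x. g \<sigma> x * indicator B (X x))" for \<sigma>
      by (rule Bochner_Integration.integrable_bound[OF gi[of \<sigma>]]) (auto split: split_indicator)
    ultimately show ?thesis by (simp add: fg left_diff_distrib)
  qed
qed

text \<open>One polynomial in each degree spans all polynomials, hence all powers.
  \<open>P 0\<close> must be required to be nonzero because the zero polynomial also has degree
  0.\<close>

lemma integral_indicator_eq_0_of_poly_moments:
  fixes f X :: "'b \<Rightarrow> real" and P :: "nat \<Rightarrow> real poly"
  assumes [measurable]: "X \<in> borel_measurable M" "f \<in> borel_measurable M" "B \<in> sets borel"
    and ex: "\<And>c. integrable M (\<lambda>x. f x * exp (c * \<bar>X x\<bar>))"
    and P: "\<And>n. degree (P n) = n" "P 0 \<noteq> 0"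
    and mom: "\<And>n. (\<integral>x. f x * poly (P n) (X x) \<partial>M) = 0"
  shows "(\<integral>x. f x * indicator B (X x) \<partial>M) = 0"
proof -
  have ip: "integrable M (\<lambda>x. f x * poly q (X x))" for q
  proof -
    obtain C k where C: "0 \<le> C" "\<And>t. \<bar>poly q t\<bar> \<le> C * exp (k * \<bar>t\<bar>)"
      using poly_le_exp[of q] by blast
    have [measurable]: "(\<lambda>x. poly q (X x)) \<in> borel_measurable M"
      by (rule measurable_compose[of X _ borel]) (auto intro!: borel_measurable_continuous_onI continuous_intros)
    show ?thesis
    proof (rule integrable_mult_of_le[OF ex[of k], where C=C])
      show "\<bar>f x * poly q (X x)\<bar> \<le> C * \<bar>f x * exp (k * \<bar>X x\<bar>)\<bar>" for x
        using mult_left_mono[OF C(2)[of "X x"] abs_ge_zero[of "f x"]]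
        by (simp add: abs_mult algebra_simps)
    qed measurable
  qed
  have "(\<integral>x. f x * poly q (X x) \<partial>M) = 0" if "degree q < n" for q n
    using that
  proof (induction n arbitrary: q)
    case (Suc n)
    have lc: "coeff (P n) n \<noteq> 0"
      using P by (metis leading_coeff_0_iff degree_0)
    \<comment> \<open>Subtracting this multiple of \<open>P n\<close> cancels the coefficient of
      degree \<open>n\<close>, which lowers the degree or leaves 0.\<close>
    define a where "a = coeff q n / coeff (P n) n"
    define r where "r = q - smult a (P n)"
    have "degree r \<le> n" unfolding r_def
      using Suc.prems P(1)[of n] by (intro degree_diff_le) (auto intro: degree_smult_le[THEN order_trans])
    moreover have "coeff r n = 0" using lc by (simp add: r_def a_def)
    ultimately have "degree r < n \<or> r = 0"
      by (metis eq_zero_or_degree_less)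
    then have "(\<integral>x. f x * poly r (X x) \<partial>M) = 0" using Suc.IH by auto
    moreover have "f x * poly q (X x) = f x * poly r (X x) + a * (f x * poly (P n) (X x))" for x
      by (simp add: r_def algebra_simps)
    ultimately show ?case using ip mom by simp
  qed simp
  from this[of "monom 1 n" "Suc n" for n] have "(\<integral>x. f x * X x ^ n \<partial>M) = 0" for n
    by (simp add: poly_monom degree_monom_eq)
  then show ?thesis using ex by (intro integral_indicator_eq_0_of_moments) auto
qed


section \<open>From one variable to several\<close>

lemma AE_eq_0_of_box_integrals:
  fixes m :: "'a::euclidean_space \<Rightarrow> real"
  assumes m: "integrable lborel m"
    and box: "\<And>l u. (LBINT x. m x * indicator (box l u) x) = 0"
  shows "AE x in lborel. m x = 0"
proof -
  have [measurable]: "m \<in> borel_measurable borel" using m by auto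
  \<comment> \<open>Again a splitting by sign, since \<open>m\<close> itself is no density. The two
    resulting measures are finite on boxes and agree on them, and boxes are stable under
    intersection.\<close>
  define g where "g \<sigma> x = max 0 (\<sigma> * m x)" for \<sigma> x
  have g[measurable]: "g \<sigma> \<in> borel_measurable borel" and g0: "0 \<le> g \<sigma> x" for \<sigma> x
    unfolding g_def by auto
  have gi: "integrable lborel (g \<sigma>)" for \<sigma>
    unfolding g_def using m by auto
  have gib: "integrable lborel (\<lambda>x. g \<sigma> x * indicator (box l u) x)" for \<sigma> l u
    by (rule Bochner_Integration.integrable_bound[OF gi[of \<sigma>]]) (auto split: split_indicator)
  have mg: "m x = g 1 x - g (-1) x" for x by (auto simp: g_def)
  define D where "D \<sigma> = density lborel (\<lambda>x. ennreal (g \<sigma> x))" for \<sigma>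
  have D: "emeasure (D \<sigma>) (box l u) = ennreal (LBINT x. g \<sigma> x * indicator (box l u) x)" for \<sigma> l u
  proof -
    have "emeasure (D \<sigma>) (box l u) = (\<integral>\<^sup>+x. ennreal (g \<sigma> x * indicator (box l u) x) \<partial>lborel)"
      unfolding D_def by (auto simp: emeasure_density intro!: nn_integral_cong split: split_indicator)
    also have "\<dots> = ennreal (LBINT x. g \<sigma> x * indicator (box l u) x)"
      using g0 by (intro nn_integral_eq_integral gib) auto
    finally show ?thesis .
  qed
  have "D 1 = D (-1)"
  proof (rule measure_eqI_generator_eq)
    let ?E = "range (\<lambda>(a, b). box a b :: 'a set)"
    show "Int_stable ?E"
      by (auto simp: Int_stable_def box_Int_box)
    show "?E \<subseteq> Pow UNIV" "sets (D 1) = sigma_sets UNIV ?E" "sets (D (-1)) = sigma_sets UNIV ?E"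
      by (auto simp: D_def borel_eq_box)
    let ?A = "\<lambda>n::nat. box (- (real n *\<^sub>R One)) (real n *\<^sub>R One) :: 'a set"
    show "range ?A \<subseteq> ?E" "(\<Union>i. ?A i) = UNIV"
      unfolding UN_box_eq_UNIV by auto
    show "emeasure (D 1) (?A i) \<noteq> \<infinity>" for i by (simp add: D)
    show "emeasure (D 1) X = emeasure (D (-1)) X" if "X \<in> ?E" for X
    proof -
      from that obtain l u where X: "X = box l u" by auto
      have "(LBINT x. g 1 x * indicator (box l u) x) - (LBINT x. g (-1) x * indicator (box l u) x) = 0"
        using box[of l u] gib by (simp add: mg left_diff_distrib)
      then show ?thesis by (simp add: X D)
    qed
  qed
  then have "AE x in lborel. ennreal (g 1 x) = ennreal (g (-1) x)"
    unfolding D_def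
    by (rule sigma_finite_measure.density_unique[OF sigma_finite_lborel, rotated 2]) measurable
  then show ?thesis
    by eventually_elim (simp add: mg g0)
qed

text \<open>The coordinates are treated one at a time: with the factors of all other coordinates
  absorbed into the weight, the one-variable lemma replaces the polynomial in
  \<open>x \<bullet> b\<close> by an indicator. In the end the indicators make up a box.\<close>

lemma AE_eq_0_of_poly_moments:
  fixes m :: "'a::euclidean_space \<Rightarrow> real" and P :: "nat \<Rightarrow> real poly"
  assumes [measurable]: "m \<in> borel_measurable borel"
    and ex: "\<And>c. integrable lborel (\<lambda>x. m x * exp (c * (\<Sum>b\<in>Basis. \<bar>x \<bullet> b\<bar>)))"
    and P: "\<And>n. degree (P n) = n" "P 0 \<noteq> 0"
    and mom: "\<And>\<alpha>. (LBINT x. m x * (\<Prod>b\<in>Basis. poly (P (\<alpha> b)) (x \<bullet> b))) = 0"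
  shows "AE x in lborel. m x = 0"
proof -
  have [measurable]: "(\<lambda>x::'a. poly q (x \<bullet> b)) \<in> borel_measurable borel" for q b
    by (intro borel_measurable_continuous_onI continuous_intros)
  define w where "w A B \<alpha> x = m x * (\<Prod>b\<in>A. indicator (B b) (x \<bullet> b)) * (\<Prod>b\<in>Basis - A. poly (P (\<alpha> b)) (x \<bullet> b))"
    for A B \<alpha> and x :: 'a
  have key: "(LBINT x. w A B \<alpha> x) = 0"
    if "A \<subseteq> Basis" "\<And>b. b \<in> Basis \<Longrightarrow> B b \<in> sets borel" for A :: "'a set" and B \<alpha>
  proof -
    have "finite A" using finite_subset[OF that(1) finite_Basis] .
    then show ?thesis using that
    \<comment> \<open>\<open>\<alpha>\<close> must stay free: treating coordinate \<open>b\<close>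
      uses the hypothesis for every degree at \<open>b\<close>.\<close>
    proof (induction A arbitrary: \<alpha> rule: finite_induct)
      case empty
      then show ?case using mom by (simp add: w_def)
    next
      case (insert b A)
      then have b: "b \<in> Basis" "b \<notin> A" "A \<subseteq> Basis" "finite A" by auto
      have B[measurable]: "B a \<in> sets borel" if "a \<in> insert b A" for a using that insert.prems by auto
      define f where "f x = m x * (\<Prod>b\<in>A. indicator (B b) (x \<bullet> b)) * (\<Prod>a\<in>Basis - insert b A. poly (P (\<alpha> a)) (x \<bullet> a))" for x
      have fm[measurable]: "f \<in> borel_measurable borel"
        unfolding f_def using B by measurable
      \<comment> \<open>The polynomials not yet replaced grow at most exponentially, and the
        exponential moments of \<open>m\<close> absorb them.\<close>
      have "\<exists>C k. 0 \<le> C \<and> 0 \<le> k \<and> (\<forall>x. \<bar>\<Prod>a\<in>J. poly (P (\<alpha> a)) (x \<bullet> a)\<bar> \<le> C * exp (k * (\<Sum>a\<in>Basis. \<bar>x \<bullet> a\<bar>)))"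
        if "finite J" "J \<subseteq> Basis" for J :: "'a set"
        using that
      proof (induction J rule: finite_induct)
        case empty
        show ?case by (intro exI[of _ 1] exI[of _ 0]) auto
      next
        case (insert a J)
        obtain C k where C: "0 \<le> C" "0 \<le> k"
          "\<And>x. \<bar>\<Prod>a\<in>J. poly (P (\<alpha> a)) (x \<bullet> a)\<bar> \<le> C * exp (k * (\<Sum>a\<in>Basis. \<bar>x \<bullet> a\<bar>))"
          using insert by auto
        obtain C' k' where C': "0 \<le> C'" "0 \<le> k'" "\<And>t. \<bar>poly (P (\<alpha> a)) t\<bar> \<le> C' * exp (k' * \<bar>t\<bar>)"
          using poly_le_exp by blast
        have "\<bar>\<Prod>a\<in>insert a J. poly (P (\<alpha> a)) (x \<bullet> a)\<bar> \<le> (C' * C) * exp ((k' + k) * (\<Sum>a\<in>Basis. \<bar>x \<bullet> a\<bar>))" for x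
        proof -
          have "\<bar>x \<bullet> a\<bar> \<le> (\<Sum>a\<in>Basis. \<bar>x \<bullet> a\<bar>)"
            using insert.prems by (intro member_le_sum) auto
          then have "C' * exp (k' * \<bar>x \<bullet> a\<bar>) \<le> C' * exp (k' * (\<Sum>a\<in>Basis. \<bar>x \<bullet> a\<bar>))"
            using C' by (intro mult_left_mono) (auto intro: mult_left_mono)
          from mult_mono[OF order_trans[OF C'(3) this] C(3)[of x]] C C' insert.hyps
          show ?thesis by (simp add: abs_mult algebra_simps exp_add)
        qed
        then show ?case using C C' by (intro exI[of _ "C' * C"] exI[of _ "k' + k"]) auto
      qed
      from this[of "Basis - insert b A"] obtain C k where C: "0 \<le> C" "0 \<le> k"
        "\<And>x. \<bar>\<Prod>a\<in>Basis - insert b A. poly (P (\<alpha> a)) (x \<bullet> a)\<bar> \<le> C * exp (k * (\<Sum>a\<in>Basis. \<bar>x \<bullet> a\<bar>))"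
        by auto
      have "(LBINT x. f x * indicator (B b) (x \<bullet> b)) = 0"
      proof (rule integral_indicator_eq_0_of_poly_moments[OF _ _ _ _ P])
        fix c
        \<comment> \<open>The rate \<open>\<bar>c\<bar> + k\<close> pays at once for the exponential
          in one coordinate and for the other polynomials.\<close>
        show "integrable lborel (\<lambda>x. f x * exp (c * \<bar>x \<bullet> b\<bar>))"
        proof (rule integrable_mult_of_le[OF ex[of "\<bar>c\<bar> + k"], where C=C])
          fix x :: 'a
          let ?S = "\<Sum>a\<in>Basis. \<bar>x \<bullet> a\<bar>"
          have "\<bar>x \<bullet> b\<bar> \<le> ?S"
            using b by (intro member_le_sum) auto
          then have "c * \<bar>x \<bullet> b\<bar> \<le> \<bar>c\<bar> * ?S"
            by (intro mult_mono) auto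
          then have e: "exp (c * \<bar>x \<bullet> b\<bar>) \<le> exp (\<bar>c\<bar> * ?S)" by simp
          have i: "\<bar>\<Prod>b\<in>A. indicator (B b) (x \<bullet> b) :: real\<bar> \<le> 1"
            by (auto simp: abs_prod intro!: prod_le_1)
          have "\<bar>f x * exp (c * \<bar>x \<bullet> b\<bar>)\<bar> \<le> (\<bar>m x\<bar> * 1 * (C * exp (k * ?S))) * exp (\<bar>c\<bar> * ?S)"
            unfolding f_def abs_mult abs_exp_cancel
            by (rule mult_mono[OF mult_mono[OF mult_left_mono[OF i] C(3)] e]) (use C in simp_all)
          then show "\<bar>f x * exp (c * \<bar>x \<bullet> b\<bar>)\<bar> \<le> C * \<bar>m x * exp ((\<bar>c\<bar> + k) * ?S)\<bar>"
            by (simp add: abs_mult algebra_simps exp_add)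
        qed measurable
        fix n
        have "f x * poly (P n) (x \<bullet> b) = w A B (\<alpha>(b := n)) x" for x
        proof -
          let ?h = "\<lambda>a. poly (P ((\<alpha>(b := n)) a)) (x \<bullet> a)"
          have "Basis - A = insert b (Basis - insert b A)" using b by auto
          then have "prod ?h (Basis - A) = prod ?h (insert b (Basis - insert b A))"
            by (rule arg_cong)
          also have "\<dots> = ?h b * prod ?h (Basis - insert b A)"
            by (rule prod.insert) auto
          also have "prod ?h (Basis - insert b A) = (\<Prod>a\<in>Basis - insert b A. poly (P (\<alpha> a)) (x \<bullet> a))"
            by (intro prod.cong) auto
          finally show ?thesis by (simp add: f_def w_def)
        qed
        then show "(LBINT x. f x * poly (P n) (x \<bullet> b)) = 0"
          using insert.IH[OF b(3)] insert.prems by simp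
      qed (use B in auto)
      moreover have "f x * indicator (B b) (x \<bullet> b) = w (insert b A) B \<alpha> x" for x
        using b by (simp add: f_def w_def)
      ultimately show ?case by simp
    qed
  qed
  show ?thesis
  proof (rule AE_eq_0_of_box_integrals)
    show "integrable lborel m" using ex[of 0] by simp
    fix l u :: 'a
    have "indicator (box l u) x = (\<Prod>b\<in>Basis. indicator {l \<bullet> b<..<u \<bullet> b} (x \<bullet> b) :: real)" for x :: 'a
      by (auto simp: box_def indicator_def prod_zero_iff)
    then show "(LBINT x. m x * indicator (box l u) x) = 0"
      using key[of Basis "\<lambda>b. {l \<bullet> b<..<u \<bullet> b}"] by (simp add: w_def)
  qed
qed

subsection \<open>Rapidly decreasing functions\<close>

lemma norm_power2_eq_sum: "(norm (x::'a::euclidean_space))\<^sup>2 = (\<Sum>b\<in>Basis. (x \<bullet> b)\<^sup>2)"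
  by (simp only: power2_norm_eq_inner euclidean_inner[of x x]) (simp add: power2_eq_square)

text \<open>Every coordinate satisfies \<open>1 + (x \<bullet> b)^2 <= (1 + norm x)^2\<close>.
  Multiplied over the coordinates, this gives the exponent \<open>2 * DIM('a)\<close> and a product
  of integrable functions of one variable as majorant.\<close>

lemma integrable_inverse_one_plus_norm_power:
  "integrable lborel (\<lambda>x::'a::euclidean_space. inverse ((1 + norm x) ^ (2 * DIM('a))))"
proof (rule integrableI_bounded)
  let ?f = "\<lambda>t::real. inverse (1 + t\<^sup>2)"
  have fin: "(\<integral>\<^sup>+t. ennreal (?f t) \<partial>lborel) < \<infinity>"
    using integrable_inverse_1_plus_square
    by (simp add: set_integrable_def integrable_iff_bounded)
  have le: "inverse ((1 + norm x) ^ (2 * DIM('a))) \<le> (\<Prod>b\<in>Basis. ?f (x \<bullet> b))" for x :: 'a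
  proof -
    have "1 + (x \<bullet> b)\<^sup>2 \<le> (1 + norm x)\<^sup>2" if "b \<in> Basis" for b
    proof -
      have "(x \<bullet> b)\<^sup>2 \<le> (norm x)\<^sup>2"
        using Basis_le_norm[OF that, of x] by (metis abs_ge_zero abs_le_square_iff abs_norm_cancel)
      then show ?thesis using norm_ge_zero[of x] unfolding power2_sum one_power2 by linarith
    qed
    then have "(\<Prod>b\<in>Basis. 1 + (x \<bullet> b)\<^sup>2) \<le> (\<Prod>b\<in>(Basis::'a set). (1 + norm x)\<^sup>2)"
      by (intro prod_mono) auto
    also have "\<dots> = (1 + norm x) ^ (2 * DIM('a))"
      by (simp add: power_mult)
    finally have "inverse ((1 + norm x) ^ (2 * DIM('a))) \<le> inverse (\<Prod>b\<in>Basis. 1 + (x \<bullet> b)\<^sup>2)"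
      by (intro le_imp_inverse_le prod_pos) (auto intro: add_pos_nonneg)
    then show ?thesis by (simp add: prod_inversef[symmetric] o_def)
  qed
  have "(\<integral>\<^sup>+x. ennreal (norm (inverse ((1 + norm x) ^ (2 * DIM('a))))) \<partial>(lborel::'a measure))
      \<le> (\<integral>\<^sup>+x. (\<Prod>b\<in>Basis. ennreal (?f (x \<bullet> b))) \<partial>(lborel::'a measure))"
    using le by (intro nn_integral_mono) (auto simp: prod_ennreal intro!: ennreal_leI)
  also have "\<dots> = (\<Prod>b\<in>(Basis::'a set). (\<integral>\<^sup>+t. ennreal (?f t) \<partial>lborel))"
    by (rule nn_integral_lborel_prod) auto
  also have "\<dots> < \<infinity>"
    using fin by (simp add: power_less_top_ennreal)
  finally show "(\<integral>\<^sup>+x. ennreal (norm (inverse ((1 + norm x) ^ (2 * DIM('a))))) \<partial>(lborel::'a measure)) < \<infinity>" .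
qed simp

text \<open>Schwartz decay without smoothness: it survives norms, powers of norms and bounded
  measurable factors, all of which can leave the Schwartz space.\<close>

definition rapidly_decreasing :: "('a::euclidean_space \<Rightarrow> 'b::real_normed_vector) \<Rightarrow> bool" where
  "rapidly_decreasing f \<longleftrightarrow> f \<in> borel_measurable borel \<and> (\<forall>N. \<exists>C. \<forall>x. (1 + norm x) ^ N * norm (f x) \<le> C)"

lemma rapidly_decreasing_measurable[measurable_dest]:
  "rapidly_decreasing f \<Longrightarrow> f \<in> borel_measurable borel"
  by (simp add: rapidly_decreasing_def)

lemma rapidly_decreasingE:
  assumes "rapidly_decreasing f"
  obtains C where "0 \<le> C" "\<And>x. norm (f x) \<le> C * inverse ((1 + norm x) ^ N)"
proof -
  obtain C where C: "\<And>x. (1 + norm x) ^ N * norm (f x) \<le> C"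
    using assms by (auto simp: rapidly_decreasing_def)
  have p: "0 < (1 + norm x) ^ N" for x :: 'a
    by (intro zero_less_power) (simp add: add_pos_nonneg)
  have "0 \<le> C" using order_trans[OF _ C[of 0]] by simp
  moreover have "norm (f x) \<le> C * inverse ((1 + norm x) ^ N)" for x
    using C[of x] p[of x] by (simp add: field_simps)
  ultimately show ?thesis using that by blast
qed

lemma rapidly_decreasing_bounded:
  assumes "rapidly_decreasing f"
  obtains C where "0 \<le> C" "\<And>x. norm (f x) \<le> C"
  using rapidly_decreasingE[OF assms, of 0] by auto

text \<open>\<open>k = 0\<close> is plain domination, \<open>k = 2\<close> covers multiplication by
  \<open>|x|^2\<close>.\<close>

lemma rapidly_decreasing_mult_poly_bound:
  fixes f :: "'a::euclidean_space \<Rightarrow> 'b::real_normed_vector" and g :: "'a \<Rightarrow> 'c::real_normed_vector"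
  assumes f: "rapidly_decreasing f" and [measurable]: "g \<in> borel_measurable borel"
    and le: "\<And>x. norm (g x) \<le> C * (1 + norm x) ^ k * norm (f x)"
  shows "rapidly_decreasing g"
  unfolding rapidly_decreasing_def
proof (intro conjI allI)
  fix N
  obtain D where D: "\<And>x. (1 + norm x) ^ (N + k) * norm (f x) \<le> D"
    using f unfolding rapidly_decreasing_def by meson
  have "(1 + norm x) ^ N * norm (g x) \<le> \<bar>C\<bar> * D" for x
  proof -
    have "(1 + norm x) ^ N * norm (g x) \<le> (1 + norm x) ^ N * (C * (1 + norm x) ^ k * norm (f x))"
      by (intro mult_left_mono le) auto
    also have "\<dots> = C * ((1 + norm x) ^ (N + k) * norm (f x))"
      by (simp add: power_add)
    also have "\<dots> \<le> \<bar>C\<bar> * ((1 + norm x) ^ (N + k) * norm (f x))"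
      by (intro mult_right_mono) auto
    also have "\<dots> \<le> \<bar>C\<bar> * D"
      by (intro mult_left_mono D) auto
    finally show ?thesis .
  qed
  then show "\<exists>C. \<forall>x. (1 + norm x) ^ N * norm (g x) \<le> C" by blast
qed fact

lemma rapidly_decreasing_add:
  fixes f g :: "'a::euclidean_space \<Rightarrow> 'b::{real_normed_vector, second_countable_topology}"
  assumes f: "rapidly_decreasing f" and g: "rapidly_decreasing g"
  shows "rapidly_decreasing (\<lambda>x. f x + g x)"
  unfolding rapidly_decreasing_def
proof (intro conjI allI)
  show "(\<lambda>x. f x + g x) \<in> borel_measurable borel"
    using assms by (auto simp: rapidly_decreasing_def)
  fix N
  obtain C D where *: "\<And>x. (1 + norm x) ^ N * norm (f x) \<le> C" "\<And>x. (1 + norm x) ^ N * norm (g x) \<le> D"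
    using f g unfolding rapidly_decreasing_def by meson
  have "(1 + norm x) ^ N * norm (f x + g x) \<le> C + D" for x
  proof -
    have "(1 + norm x) ^ N * norm (f x + g x) \<le> (1 + norm x) ^ N * (norm (f x) + norm (g x))"
      by (intro mult_left_mono norm_triangle_ineq) auto
    then show ?thesis using *[of x] by (simp add: distrib_left)
  qed
  then show "\<exists>C. \<forall>x. (1 + norm x) ^ N * norm (f x + g x) \<le> C" by blast
qed

lemma rapidly_decreasing_mult_bounded:
  fixes f g :: "'a::euclidean_space \<Rightarrow> 'b::{real_normed_field, second_countable_topology}"
  assumes f: "rapidly_decreasing f" and g: "g \<in> borel_measurable borel" "\<And>x. norm (g x) \<le> C"
  shows "rapidly_decreasing (\<lambda>x. g x * f x)"
  using assms
  by (intro rapidly_decreasing_mult_poly_bound[OF f, of _ C 0])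
     (auto simp: norm_mult rapidly_decreasing_def intro!: mult_right_mono)

lemma rapidly_decreasing_mult:
  fixes f g :: "'a::euclidean_space \<Rightarrow> 'b::{real_normed_field, second_countable_topology}"
  assumes f: "rapidly_decreasing f" and g: "rapidly_decreasing g"
  shows "rapidly_decreasing (\<lambda>x. f x * g x)"
proof -
  obtain C where "0 \<le> C" "\<And>x. norm (f x) \<le> C" using rapidly_decreasing_bounded[OF f] by blast
  then show ?thesis using assms
    by (intro rapidly_decreasing_mult_bounded[OF g]) (auto simp: rapidly_decreasing_def)
qed

lemma rapidly_decreasing_integrable:
  fixes f :: "'a::euclidean_space \<Rightarrow> 'b::{banach, second_countable_topology}"
  assumes f: "rapidly_decreasing f"
  shows "integrable lborel f"
proof -
  obtain C where C: "0 \<le> C" "\<And>x. norm (f x) \<le> C * inverse ((1 + norm x) ^ (2 * DIM('a)))"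
    using rapidly_decreasingE[OF f, where N="2 * DIM('a)"] by blast
  show ?thesis
    by (rule Bochner_Integration.integrable_bound[where f="\<lambda>x. C * inverse ((1 + norm x) ^ (2 * DIM('a)))"])
       (use C f integrable_inverse_one_plus_norm_power in \<open>auto simp: rapidly_decreasing_def\<close>)
qed

lemma exp_neg_norm_rapidly_decreasing:
  assumes "0 < c"
  shows "rapidly_decreasing (\<lambda>x::'a::euclidean_space. exp (- c * (norm x)\<^sup>2))"
  unfolding rapidly_decreasing_def
proof (intro conjI allI)
  fix N :: nat
  \<comment> \<open>The bound is the exponential of the maximum of \<open>N r - c r^2\<close> over
    \<open>r\<close>, found by completing the square.\<close>
  have "(1 + norm x) ^ N * norm (exp (- c * (norm x)\<^sup>2)) \<le> exp ((real N)\<^sup>2 / (4 * c))" for x :: 'a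
  proof -
    have "(1 + norm x) ^ N \<le> exp (norm x) ^ N"
      using exp_ge_add_one_self[of "norm x"] by (intro power_mono) auto
    then have "(1 + norm x) ^ N * norm (exp (- c * (norm x)\<^sup>2)) \<le> exp (real N * norm x) * exp (- c * (norm x)\<^sup>2)"
      by (simp add: exp_of_nat_mult)
    also have "\<dots> = exp (real N * norm x - c * (norm x)\<^sup>2)"
      by (simp add: exp_add[symmetric])
    also have "\<dots> \<le> exp ((real N)\<^sup>2 / (4 * c))"
    proof -
      have "0 \<le> (real N - 2 * c * norm x)\<^sup>2" by simp
      then have "4 * c * (real N * norm x - c * (norm x)\<^sup>2) \<le> (real N)\<^sup>2"
        by (simp add: power2_eq_square algebra_simps)
      then show ?thesis using assms by (simp add: pos_le_divide_eq mult.commute)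
    qed
    finally show ?thesis .
  qed
  then show "\<exists>C. \<forall>x::'a. (1 + norm x) ^ N * norm (exp (- c * (norm x)\<^sup>2)) \<le> C" by blast
qed simp

subsection \<open>Integration by parts\<close>

text \<open>No condition on \<open>f\<close>: if it is not measurable, neither is its translate, and
  both integrals have the default value 0.\<close>

lemma lborel_integral_translate:
  fixes f :: "'a::euclidean_space \<Rightarrow> 'b::{banach, second_countable_topology}"
  shows "(LBINT x. f (x + c)) = (LBINT x. f x)"
proof (cases "f \<in> borel_measurable borel")
  case True
  have "(LBINT x. f x) = (\<integral>x. f x \<partial>distr lborel borel ((+) c))"
    by (simp add: lborel_distr_plus)
  also have "\<dots> = (LBINT x. f (c + x))"
    using True by (intro integral_distr) auto
  finally show ?thesis by (simp add: add.commute)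
next
  case False
  have "(\<lambda>x. f (x + c)) \<notin> borel_measurable borel"
  proof
    assume "(\<lambda>x. f (x + c)) \<in> borel_measurable borel"
    then have "(\<lambda>x. f ((x - c) + c)) \<in> borel_measurable borel"
      by (rule measurable_compose[rotated]) measurable
    then show False using False by simp
  qed
  then have "\<not> integrable lborel f" "\<not> integrable lborel (\<lambda>x. f (x + c))"
    using False borel_measurable_integrable[of lborel f] borel_measurable_integrable[of lborel "\<lambda>x. f (x + c)"]
    by auto
  then show ?thesis by (simp add: not_integrable_integral_eq)
qed

lemma lborel_integrable_translate:
  fixes f :: "'a::euclidean_space \<Rightarrow> 'b::{banach, second_countable_topology}"
  assumes "integrable lborel f"
  shows "integrable lborel (\<lambda>x. f (x + c))"
proof -
  have "integrable (distr lborel borel ((+) c)) f"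
    using assms by (simp add: lborel_distr_plus)
  then have "integrable lborel (\<lambda>x. f (c + x))"
    using assms by (subst (asm) integrable_distr_eq) auto
  then show ?thesis by (simp add: add.commute)
qed

text \<open>Integrability takes the place of decay at infinity. The integral of
  \<open>F (x + b) - F x\<close> is 0 by translation invariance. By the fundamental theorem and
  Fubini it is also the mean, over \<open>t\<close> between 0 and 1, of the integrals of
  \<open>F' (x + t b) b\<close>, which all coincide.\<close>

lemma integral_directional_derivative_eq_0:
  fixes F :: "'a::euclidean_space \<Rightarrow> 'b::euclidean_space"
  assumes D: "\<And>x. (F has_derivative F' x) (at x)"
    and F: "integrable lborel F" and F': "integrable lborel (\<lambda>x. F' x b)"
    and cont: "continuous_on UNIV (\<lambda>x. F' x b)"
  shows "(LBINT x. F' x b) = 0"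
proof -
  let ?G = "\<lambda>(x, t). indicator {0..1::real} t *\<^sub>R F' (x + t *\<^sub>R b) b"
  have [measurable]: "(\<lambda>x. F' x b) \<in> borel_measurable borel"
    using cont by (rule borel_measurable_continuous_onI)
  have ftc: "(LBINT t. indicator {0..1::real} t *\<^sub>R F' (x + t *\<^sub>R b) b) = F (x + b) - F x" for x
  proof -
    have "((\<lambda>t. F (x + t *\<^sub>R b)) has_vector_derivative F' (x + t *\<^sub>R b) b) (at t within {0..1})" for t
    proof -
      have "((\<lambda>t. F (x + t *\<^sub>R b)) has_derivative (\<lambda>s. F' (x + t *\<^sub>R b) (s *\<^sub>R b))) (at t)"
        by (rule has_derivative_compose[OF _ D]) (auto intro!: derivative_eq_intros)
      moreover have "F' (x + t *\<^sub>R b) (s *\<^sub>R b) = s *\<^sub>R F' (x + t *\<^sub>R b) b" for s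
        using has_derivative_linear[OF D] by (rule linear_scale)
      ultimately show ?thesis
        by (auto simp: has_vector_derivative_def intro: has_derivative_at_withinI)
    qed
    moreover have "continuous_on {0..1} (\<lambda>t. F' (x + t *\<^sub>R b) b)"
      by (rule continuous_on_compose2[OF cont]) (auto intro!: continuous_intros)
    ultimately show ?thesis
      using integral_FTC_Icc[of 0 1 "\<lambda>t. F (x + t *\<^sub>R b)" "\<lambda>t. F' (x + t *\<^sub>R b) b"]
      by (simp add: mult.commute)
  qed
  \<comment> \<open>With \<open>t\<close> outside, translation makes the inner integral of the norm
    independent of \<open>t\<close>.\<close>
  have G: "integrable (lborel \<Otimes>\<^sub>M lborel) ?G"
  proof (subst lborel_pair.integrable_product_swap_iff[symmetric], rule lborel_pair.Fubini_integrable)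
    show "integrable lborel (\<lambda>t. \<integral>x. norm ((\<lambda>(x, y). ?G (y, x)) (t, x)) \<partial>lborel)"
    proof -
      have "(LBINT x. norm ((\<lambda>(x, y). ?G (y, x)) (t, x))) = indicator {0..1} t * (LBINT x. norm (F' x b))" for t
        using lborel_integral_translate[of "\<lambda>x. norm (F' x b)"] by simp
      then show ?thesis by (simp only:) (intro integrable_mult_left, simp)
    qed
    show "AE t in lborel. integrable lborel (\<lambda>x. (\<lambda>(x, y). ?G (y, x)) (t, x))"
      using lborel_integrable_translate[OF F'] by simp
  qed measurable
  have "0 = (LBINT x. F (x + b) - F x)"
    using F lborel_integrable_translate[OF F] by (simp add: lborel_integral_translate)
  also have "\<dots> = (LBINT x. (LBINT t. ?G (x, t)))"
    by (simp add: ftc)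
  also have "\<dots> = (LBINT t. (LBINT x. ?G (x, t)))"
    using lborel_pair.Fubini_integral[of "\<lambda>x t. ?G (x, t)"] G by (simp add: case_prod_beta)
  also have "\<dots> = (LBINT t. indicator {0..1::real} t *\<^sub>R (LBINT x. F' x b))"
    using lborel_integral_translate[of "\<lambda>x. F' x b"] by simp
  also have "\<dots> = (LBINT x. F' x b)"
    by simp
  finally show ?thesis by simp
qed

lemma integral_by_parts_euclidean:
  fixes f g :: "'a::euclidean_space \<Rightarrow> 'b::{euclidean_space, real_normed_field}"
  assumes f: "\<And>x. (f has_derivative f' x) (at x)" "continuous_on UNIV (\<lambda>x. f' x b)"
    and g: "\<And>x. (g has_derivative g' x) (at x)" "continuous_on UNIV (\<lambda>x. g' x b)"
    and i: "integrable lborel (\<lambda>x. f x * g x)" "integrable lborel (\<lambda>x. f x * g' x b)"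
      "integrable lborel (\<lambda>x. f' x b * g x)"
  shows "(LBINT x. f x * g' x b) = - (LBINT x. f' x b * g x)"
proof -
  have c: "continuous_on UNIV f" "continuous_on UNIV g"
    using f(1) g(1) by (auto intro!: continuous_at_imp_continuous_on has_derivative_continuous)
  have "(LBINT x. (\<lambda>v. f x * g' x v + f' x v * g x) b) = 0"
    by (rule integral_directional_derivative_eq_0[of "\<lambda>x. f x * g x"])
       (use f g i c in \<open>auto intro!: has_derivative_mult continuous_intros\<close>)
  then show ?thesis using i by (simp add: eq_neg_iff_add_eq_0)
qed

subsection \<open>Schwartz functions\<close>

lemma iter_partial_append: "iter_partial (vs @ ws) f = iter_partial vs (iter_partial ws f)"
  by (induction vs) auto

lemma schwartz_iter_partial:
  assumes "f \<in> schwartz_space" "set vs \<subseteq> Basis"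
  shows "iter_partial vs f \<in> schwartz_space"
  using assms unfolding schwartz_space_def smooth_def
  by (auto simp: iter_partial_append[symmetric])

lemma schwartz_differentiable:
  assumes "f \<in> schwartz_space"
  shows "(f has_derivative frechet_derivative f (at x)) (at x)"
proof -
  have "iter_partial [] f differentiable_on UNIV"
    using assms unfolding schwartz_space_def smooth_def by (metis (mono_tags, lifting) empty_set empty_subsetI mem_Collect_eq)
  then show ?thesis
    by (simp add: differentiable_on_def frechet_derivative_works)
qed

lemma schwartz_continuous: "f \<in> schwartz_space \<Longrightarrow> continuous_on UNIV f"
  by (intro continuous_at_imp_continuous_on ballI has_derivative_continuous[OF schwartz_differentiable])

lemma schwartz_rapidly_decreasing:
  assumes "f \<in> schwartz_space"
  shows "rapidly_decreasing f"
proof -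
  have "\<forall>N vs. set vs \<subseteq> Basis \<longrightarrow> bdd_above (range (\<lambda>x. (1 + norm x) ^ N * norm (iter_partial vs f x)))"
    using assms by (simp add: schwartz_space_def)
  from this[rule_format, of "[]"] have "\<exists>C. \<forall>x. (1 + norm x) ^ N * norm (f x) \<le> C" for N
    by (auto simp: bdd_above_def)
  then show ?thesis
    using schwartz_continuous[OF assms]
    by (auto simp: rapidly_decreasing_def borel_measurable_continuous_onI)
qed

text \<open>Avoids formulas for higher derivatives: in a set closed under partial derivatives, decay
  and differentiability of the members already cover all iterated derivatives.\<close>

lemma schwartz_space_of_derivative_closed:
  fixes D :: "('a::euclidean_space \<Rightarrow> complex) set"
  assumes rd: "\<And>f. f \<in> D \<Longrightarrow> rapidly_decreasing f"
    and diff: "\<And>f x. f \<in> D \<Longrightarrow> f differentiable (at x)"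
    and D: "\<And>f b. f \<in> D \<Longrightarrow> b \<in> Basis \<Longrightarrow> (\<lambda>x. frechet_derivative f (at x) b) \<in> D"
  shows "D \<subseteq> schwartz_space"
proof
  fix f assume f: "f \<in> D"
  have it: "iter_partial vs f \<in> D" if "set vs \<subseteq> Basis" for vs
    using that f D by (induction vs) auto
  have "bdd_above (range (\<lambda>x. (1 + norm x) ^ N * norm (iter_partial vs f x)))" if "set vs \<subseteq> Basis" for N vs
  proof -
    have "\<exists>C. \<forall>x. (1 + norm x) ^ N * norm (iter_partial vs f x) \<le> C"
      using rd[OF it[OF that]] by (simp add: rapidly_decreasing_def)
    then show ?thesis by (auto simp: bdd_above_def)
  qed
  moreover have "iter_partial vs f differentiable_on UNIV" if "set vs \<subseteq> Basis" for vs
    using diff[OF it[OF that]] by (simp add: differentiable_on_def)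
  ultimately show "f \<in> schwartz_space" by (simp add: schwartz_space_def smooth_def)
qed

lemma schwartz_integral_by_parts:
  assumes f: "f \<in> schwartz_space" and g: "g \<in> schwartz_space" and b: "b \<in> Basis"
  shows "(LBINT x. f x * iter_partial [b] g x) = - (LBINT x. iter_partial [b] f x * g x)"
proof -
  have f': "iter_partial [b] f \<in> schwartz_space" and g': "iter_partial [b] g \<in> schwartz_space"
    using f g b by (auto intro!: schwartz_iter_partial simp del: iter_partial.simps)
  have i: "integrable lborel (\<lambda>x. u x * v x)" if "u \<in> schwartz_space" "v \<in> schwartz_space" for u v :: "'a \<Rightarrow> complex"
    using that by (intro rapidly_decreasing_integrable rapidly_decreasing_mult schwartz_rapidly_decreasing)
  have "(LBINT x. f x * frechet_derivative g (at x) b) = - (LBINT x. frechet_derivative f (at x) b * g x)"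
    by (rule integral_by_parts_euclidean[OF schwartz_differentiable[OF f] _ schwartz_differentiable[OF g]])
       (use i[OF f g] i[OF f g'] i[OF f' g] schwartz_continuous[OF f'] schwartz_continuous[OF g'] in auto)
  then show ?thesis by simp
qed

lemma schwartz_partial_symmetric:
  assumes "f \<in> schwartz_space" "g \<in> schwartz_space" "b \<in> Basis"
  shows "(LBINT x. f x * iter_partial [b, b] g x) = (LBINT x. iter_partial [b, b] f x * g x)"
proof -
  have "iter_partial [b] f \<in> schwartz_space" "iter_partial [b] g \<in> schwartz_space"
    using assms by (auto intro!: schwartz_iter_partial simp del: iter_partial.simps)
  then show ?thesis
    using schwartz_integral_by_parts[of f "iter_partial [b] g" b] schwartz_integral_by_parts[of "iter_partial [b] f" g b] assms
    by simp
qed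

subsection \<open>Hermite functions\<close>

text \<open>The physicists' Hermite polynomials, with leading coefficient \<open>2 ^ n\<close>; the
  recurrence is what one more differentiation does to the Rodrigues formula.\<close>

primrec hermite_poly :: "nat \<Rightarrow> real poly" where
  "hermite_poly 0 = 1"
| "hermite_poly (Suc n) = [:0, 2:] * hermite_poly n - pderiv (hermite_poly n)"

lemma degree_hermite_poly: "degree (hermite_poly n) = n"
proof (induction n)
  case (Suc n)
  have "hermite_poly n \<noteq> 0" using Suc by (cases n) auto
  then have "degree ([:0, 2:] * hermite_poly n) = Suc n"
    using Suc by (simp add: degree_mult_eq)
  moreover have "degree (pderiv (hermite_poly n)) < Suc n"
    using Suc by (simp add: degree_pderiv)
  ultimately show ?case
    by (metis degree_add_eq_left degree_minus diff_conv_add_uminus hermite_poly.simps(2))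
qed simp

text \<open>At \<open>n = 0\<close> the truncated \<open>n - 1\<close> is harmless because its
  factor is 0. The later recurrences rely on the same convention.\<close>

lemma pderiv_hermite_poly: "pderiv (hermite_poly n) = smult (2 * real n) (hermite_poly (n - 1))"
proof (induction n)
  case (Suc n)
  show ?case
  proof (cases n)
    case 0
    then show ?thesis by (simp add: pderiv_pCons pderiv_diff pderiv_mult)
  next
    case (Suc m)
    have IH: "pderiv (hermite_poly n) = smult (2 * real n) (hermite_poly m)"
      using Suc.IH Suc by simp
    have "pderiv (hermite_poly (Suc n)) = smult 2 (hermite_poly n) + [:0, 2:] * pderiv (hermite_poly n) - pderiv (pderiv (hermite_poly n))"
      by (simp add: pderiv_diff pderiv_mult pderiv_pCons pderiv_smult)
    also have "\<dots> = smult 2 (hermite_poly n) + smult (2 * real n) (hermite_poly (Suc m))"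
      unfolding IH by (simp add: pderiv_smult smult_diff_right mult.commute)
    finally show ?thesis using Suc by (simp add: smult_add_left[symmetric])
  qed
qed simp

definition hermite1 :: "nat \<Rightarrow> real \<Rightarrow> real" where
  "hermite1 n t = poly (hermite_poly n) t * exp (- t\<^sup>2 / 2)"

text \<open>The defining recurrence with the derivative evaluated:
  \<open>2 t H_n = H_(n+1) + 2 n H_(n-1)\<close>.\<close>

lemma mult_hermite1: "t * hermite1 n t = hermite1 (Suc n) t / 2 + real n * hermite1 (n - 1) t"
  by (simp add: hermite1_def pderiv_hermite_poly algebra_simps diff_divide_distrib)

lemma hermite1_has_derivative:
  "(hermite1 n has_real_derivative real n * hermite1 (n - 1) t - hermite1 (Suc n) t / 2) (at t)"
proof -
  have "(hermite1 n has_real_derivative poly (pderiv (hermite_poly n)) t * exp (- t\<^sup>2 / 2)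
      + poly (hermite_poly n) t * (exp (- t\<^sup>2 / 2) * (- t))) (at t)"
    unfolding hermite1_def
    by (auto intro!: derivative_eq_intros poly_DERIV simp: algebra_simps)
  moreover have "poly (pderiv (hermite_poly n)) t * exp (- t\<^sup>2 / 2) + poly (hermite_poly n) t * (exp (- t\<^sup>2 / 2) * (- t))
      = real n * hermite1 (n - 1) t - hermite1 (Suc n) t / 2"
    by (simp add: hermite1_def pderiv_hermite_poly algebra_simps diff_divide_distrib)
  ultimately show ?thesis by simp
qed

lemma hermite1_le: "\<exists>C\<ge>0. \<forall>t. \<bar>hermite1 n t\<bar> \<le> C * exp (- t\<^sup>2 / 4)"
proof -
  obtain C k where C: "0 \<le> C" "0 \<le> k" "\<And>t. \<bar>poly (hermite_poly n) t\<bar> \<le> C * exp (k * \<bar>t\<bar>)"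
    using poly_le_exp by blast
  have "\<bar>hermite1 n t\<bar> \<le> C * exp (k\<^sup>2) * exp (- t\<^sup>2 / 4)" for t
  proof -
    \<comment> \<open>This square trades half of the Gaussian exponent for the growth
      \<open>exp (k |t|)\<close>.\<close>
    have "0 \<le> (\<bar>t\<bar> / 2 - k)\<^sup>2" by simp
    then have "k * \<bar>t\<bar> - t\<^sup>2 / 2 \<le> k\<^sup>2 - t\<^sup>2 / 4"
      by (simp add: power2_diff power_divide mult.commute[of k])
    then have "exp (k * \<bar>t\<bar>) * exp (- t\<^sup>2 / 2) \<le> exp (k\<^sup>2) * exp (- t\<^sup>2 / 4)"
      by (simp add: exp_add[symmetric])
    then have "C * (exp (k * \<bar>t\<bar>) * exp (- t\<^sup>2 / 2)) \<le> C * (exp (k\<^sup>2) * exp (- t\<^sup>2 / 4))"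
      using C by (intro mult_left_mono)
    moreover have "\<bar>hermite1 n t\<bar> \<le> C * (exp (k * \<bar>t\<bar>) * exp (- t\<^sup>2 / 2))"
      unfolding hermite1_def abs_mult using C(3)[of t] by simp
    ultimately show ?thesis by simp
  qed
  then show ?thesis using C by (intro exI[of _ "C * exp (k\<^sup>2)"]) auto
qed

text \<open>Only the values of the multi-index \<open>\<alpha>\<close> on \<^const>\<open>Basis\<close> matter.\<close>
definition hermite :: "('a::euclidean_space \<Rightarrow> nat) \<Rightarrow> 'a \<Rightarrow> real" where
  "hermite \<alpha> x = (\<Prod>b\<in>Basis. hermite1 (\<alpha> b) (x \<bullet> b))"

lemma hermite_upd:
  assumes "b \<in> Basis"
  shows "hermite (\<alpha>(b := n)) x = hermite1 n (x \<bullet> b) * (\<Prod>a\<in>Basis - {b}. hermite1 (\<alpha> a) (x \<bullet> a))"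
proof -
  have "(\<Prod>a\<in>Basis - {b}. hermite1 ((\<alpha>(b := n)) a) (x \<bullet> a)) = (\<Prod>a\<in>Basis - {b}. hermite1 (\<alpha> a) (x \<bullet> a))"
    by (intro prod.cong) auto
  then show ?thesis
    unfolding hermite_def using assms by (subst prod.remove[OF finite_Basis assms]) simp
qed

lemma mult_hermite:
  assumes "b \<in> Basis"
  shows "(x \<bullet> b) * hermite (\<alpha>(b := n)) x = hermite (\<alpha>(b := Suc n)) x / 2 + real n * hermite (\<alpha>(b := n - 1)) x"
  unfolding hermite_upd[OF assms] mult.assoc[symmetric] mult_hermite1
  by (simp add: algebra_simps)

text \<open>A lowering term minus a raising term, so that differentiation does not leave the span of
  the Hermite functions.\<close>

definition hermite_partial :: "'a::euclidean_space \<Rightarrow> ('a \<Rightarrow> nat) \<Rightarrow> 'a \<Rightarrow> real" where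
  "hermite_partial b \<alpha> x = real (\<alpha> b) * hermite (\<alpha>(b := \<alpha> b - 1)) x - hermite (\<alpha>(b := Suc (\<alpha> b))) x / 2"

lemma hermite_has_derivative:
  "(hermite \<alpha> has_derivative (\<lambda>v. \<Sum>b\<in>Basis. (v \<bullet> b) * hermite_partial b \<alpha> x)) (at x)"
proof -
  have "((\<lambda>x. hermite1 (\<alpha> b) (x \<bullet> b)) has_derivative
      (\<lambda>v. (v \<bullet> b) * (real (\<alpha> b) * hermite1 (\<alpha> b - 1) (x \<bullet> b) - hermite1 (Suc (\<alpha> b)) (x \<bullet> b) / 2))) (at x)" for b
  proof -
    have "((\<lambda>x::'a. x \<bullet> b) has_derivative (\<lambda>v. v \<bullet> b)) (at x)"
      by (rule has_derivative_inner_left) simp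
    from has_derivative_compose[OF this hermite1_has_derivative[of "\<alpha> b" "x \<bullet> b", unfolded has_field_derivative_def]]
    show ?thesis by (simp add: mult.commute)
  qed
  then have "(hermite \<alpha> has_derivative (\<lambda>v. \<Sum>b\<in>Basis. (v \<bullet> b) * (real (\<alpha> b) * hermite1 (\<alpha> b - 1) (x \<bullet> b) - hermite1 (Suc (\<alpha> b)) (x \<bullet> b) / 2)
      * (\<Prod>a\<in>Basis - {b}. hermite1 (\<alpha> a) (x \<bullet> a)))) (at x)"
    unfolding hermite_def by (intro has_derivative_prod)
  moreover have "(\<Sum>b\<in>Basis. (v \<bullet> b) * (real (\<alpha> b) * hermite1 (\<alpha> b - 1) (x \<bullet> b) - hermite1 (Suc (\<alpha> b)) (x \<bullet> b) / 2)
      * (\<Prod>a\<in>Basis - {b}. hermite1 (\<alpha> a) (x \<bullet> a))) = (\<Sum>b\<in>Basis. (v \<bullet> b) * hermite_partial b \<alpha> x)" for v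
    by (intro sum.cong refl) (simp add: hermite_partial_def hermite_upd algebra_simps)
  ultimately show ?thesis by simp
qed

lemma continuous_on_hermite[continuous_intros]: "continuous_on A (hermite \<alpha>)"
  by (intro continuous_at_imp_continuous_on ballI has_derivative_continuous[OF hermite_has_derivative])

lemma borel_measurable_hermite[measurable]: "hermite \<alpha> \<in> borel_measurable borel"
  by (intro borel_measurable_continuous_onI continuous_intros)

lemma hermite_le: "\<exists>C\<ge>0. \<forall>x. \<bar>hermite \<alpha> x\<bar> \<le> C * exp (- (norm x)\<^sup>2 / 4)"
proof -
  have "\<forall>b. \<exists>C. 0 \<le> C \<and> (\<forall>t. \<bar>hermite1 (\<alpha> b) t\<bar> \<le> C * exp (- t\<^sup>2 / 4))"
    using hermite1_le by blast
  then obtain C where C: "\<And>b. 0 \<le> C b" "\<And>b t. \<bar>hermite1 (\<alpha> b) t\<bar> \<le> C b * exp (- t\<^sup>2 / 4)"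
    by metis
  have "\<bar>hermite \<alpha> x\<bar> \<le> (\<Prod>b\<in>Basis. C b) * exp (- (norm x)\<^sup>2 / 4)" for x
  proof -
    have "\<bar>hermite \<alpha> x\<bar> \<le> (\<Prod>b\<in>Basis. C b * exp (- (x \<bullet> b)\<^sup>2 / 4))"
      unfolding hermite_def abs_prod by (intro prod_mono) (use C in auto)
    also have "\<dots> = (\<Prod>b\<in>Basis. C b) * exp (\<Sum>b\<in>Basis. - (x \<bullet> b)\<^sup>2 / 4)"
      by (simp add: prod.distrib exp_sum)
    also have "(\<Sum>b\<in>Basis. - (x \<bullet> b)\<^sup>2 / 4) = - (norm x)\<^sup>2 / 4"
      unfolding norm_power2_eq_sum by (simp add: sum_negf sum_divide_distrib)
    finally show ?thesis .
  qed
  then show ?thesis using C by (intro exI[of _ "\<Prod>b\<in>Basis. C b"]) (auto intro!: prod_nonneg)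
qed

lemma hermite_rapidly_decreasing: "rapidly_decreasing (hermite \<alpha>)"
proof -
  obtain C where "0 \<le> C" "\<And>x. \<bar>hermite \<alpha> x\<bar> \<le> C * exp (- (norm x)\<^sup>2 / 4)"
    using hermite_le by blast
  moreover have "rapidly_decreasing (\<lambda>x::'a. exp (- (norm x)\<^sup>2 / 4))"
    using exp_neg_norm_rapidly_decreasing[of "1/4", where 'a='a] by simp
  ultimately show ?thesis
    by (elim rapidly_decreasing_mult_poly_bound[where C=C and k=0]) simp_all
qed

text \<open>Closure rules instead of coefficients: stability under differentiation is then an
  induction.\<close>

inductive_set hermite_span :: "('a::euclidean_space \<Rightarrow> complex) set" where
  hermite: "(\<lambda>x. of_real (hermite \<alpha> x)) \<in> hermite_span"
| scale: "f \<in> hermite_span \<Longrightarrow> (\<lambda>x. c * f x) \<in> hermite_span"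
| add: "f \<in> hermite_span \<Longrightarrow> g \<in> hermite_span \<Longrightarrow> (\<lambda>x. f x + g x) \<in> hermite_span"

lemma hermite_span_0: "(\<lambda>x. 0) \<in> hermite_span"
  using hermite_span.scale[OF hermite_span.hermite, of 0] by simp

lemma hermite_span_sum:
  "(\<And>i. i \<in> I \<Longrightarrow> f i \<in> hermite_span) \<Longrightarrow> (\<lambda>x. \<Sum>i\<in>I. f i x) \<in> hermite_span"
  by (induction I rule: infinite_finite_induct) (auto intro: hermite_span_0 hermite_span.add)

lemma hermite_sum_in_span: "(\<lambda>x. \<Sum>\<alpha>\<in>I. c \<alpha> * of_real (hermite \<alpha> x)) \<in> hermite_span"
  by (intro hermite_span_sum hermite_span.intros)

lemma of_real_hermite_has_derivative:
  "((\<lambda>x. complex_of_real (hermite \<alpha> x)) has_derivative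
     (\<lambda>v. of_real (\<Sum>b\<in>Basis. (v \<bullet> b) * hermite_partial b \<alpha> x))) (at x)"
  by (intro has_derivative_of_real hermite_has_derivative)

lemma sum_inner_Basis_mult:
  fixes F :: "'a::euclidean_space \<Rightarrow> real"
  assumes "b \<in> Basis"
  shows "(\<Sum>a\<in>Basis. (b \<bullet> a) * F a) = F b"
proof -
  have "(\<Sum>a\<in>Basis. (b \<bullet> a) * F a) = (\<Sum>a\<in>Basis. if b = a then F a else 0)"
    using assms by (intro sum.cong refl) (auto simp: inner_Basis)
  then show ?thesis using assms by simp
qed

lemma partial_of_real_hermite:
  assumes "b \<in> Basis"
  shows "iter_partial [b] (\<lambda>x. of_real (hermite \<alpha> x)) = (\<lambda>x. complex_of_real (hermite_partial b \<alpha> x))"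
  unfolding iter_partial.simps frechet_derivative_at[OF of_real_hermite_has_derivative, symmetric]
    sum_inner_Basis_mult[OF assms] ..

lemma hermite_span_derivative:
  assumes "f \<in> hermite_span"
  shows "(\<forall>x. f differentiable (at x)) \<and> (\<forall>b\<in>Basis. (\<lambda>x. frechet_derivative f (at x) b) \<in> hermite_span)"
  using assms
proof induction
  case (hermite \<alpha>)
  have "(\<lambda>x. complex_of_real (hermite_partial b \<alpha> x)) \<in> hermite_span" for b
  proof -
    have "(\<lambda>x. of_nat (\<alpha> b) * of_real (hermite (\<alpha>(b := \<alpha> b - 1)) x)
        + (- 1 / 2) * complex_of_real (hermite (\<alpha>(b := Suc (\<alpha> b))) x)) \<in> hermite_span"
      by (intro hermite_span.intros)
    then show ?thesis by (simp add: hermite_partial_def)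
  qed
  then show ?case
    using partial_of_real_hermite[of _ \<alpha>] differentiableI[OF of_real_hermite_has_derivative[of \<alpha>]] by simp
next
  case (scale f c)
  have d: "(f has_derivative frechet_derivative f (at x)) (at x)" for x
    using scale by (simp add: frechet_derivative_works)
  have d': "((\<lambda>x. c * f x) has_derivative (\<lambda>v. c * frechet_derivative f (at x) v)) (at x)" for x
    by (intro has_derivative_mult_right d)
  show ?case
    using scale d' frechet_derivative_at[OF d', symmetric]
    by (auto intro!: hermite_span.scale simp: differentiableI)
next
  case (add f g)
  have d: "(f has_derivative frechet_derivative f (at x)) (at x)" "(g has_derivative frechet_derivative g (at x)) (at x)" for x
    using add by (auto simp: frechet_derivative_works)
  have d': "((\<lambda>x. f x + g x) has_derivative (\<lambda>v. frechet_derivative f (at x) v + frechet_derivative g (at x) v)) (at x)" for x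
    by (intro has_derivative_add d)
  show ?case
    using add d' frechet_derivative_at[OF d', symmetric]
    by (auto intro!: hermite_span.add simp: differentiableI)
qed

lemma hermite_span_rapidly_decreasing: "f \<in> hermite_span \<Longrightarrow> rapidly_decreasing f"
proof (induction rule: hermite_span.induct)
  case (hermite \<alpha>)
  show ?case
    by (rule rapidly_decreasing_mult_poly_bound[OF hermite_rapidly_decreasing[of \<alpha>], of _ 1 0]) auto
next
  case (scale f c)
  then show ?case
    by (intro rapidly_decreasing_mult_poly_bound[OF scale.IH, of _ "norm c" 0])
       (auto simp: norm_mult rapidly_decreasing_def)
qed (auto intro: rapidly_decreasing_add)

lemma hermite_span_schwartz: "hermite_span \<subseteq> schwartz_space"
  by (rule schwartz_space_of_derivative_closed)
     (use hermite_span_derivative hermite_span_rapidly_decreasing in auto)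

text \<open>Products of Hermite functions decay like \<open>exp (- |x|\<^sup>2)\<close>, faster than the Hermite functions
  themselves, which leaves room for the moment argument when only integrability against Schwartz
  functions is known.\<close>
inductive_set hermite_product_span :: "('a::euclidean_space \<Rightarrow> complex) set" where
  mult: "f \<in> hermite_span \<Longrightarrow> g \<in> hermite_span \<Longrightarrow> (\<lambda>x. f x * g x) \<in> hermite_product_span"
| add: "f \<in> hermite_product_span \<Longrightarrow> g \<in> hermite_product_span \<Longrightarrow> (\<lambda>x. f x + g x) \<in> hermite_product_span"

text \<open>The Leibniz rule makes two products out of one; closure under sums is what keeps the
  derivatives inside.\<close>

lemma hermite_product_span_schwartz: "hermite_product_span \<subseteq> schwartz_space"
proof (rule schwartz_space_of_derivative_closed)
  fix f :: "'a \<Rightarrow> complex" assume "f \<in> hermite_product_span"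
  then have "rapidly_decreasing f \<and> (\<forall>x. f differentiable (at x))
      \<and> (\<forall>b\<in>Basis. (\<lambda>x. frechet_derivative f (at x) b) \<in> hermite_product_span)"
  proof induction
    case (mult f g)
    have d: "(f has_derivative frechet_derivative f (at x)) (at x)" "(g has_derivative frechet_derivative g (at x)) (at x)" for x
      using mult hermite_span_derivative by (auto simp: frechet_derivative_works)
    have d': "((\<lambda>x. f x * g x) has_derivative (\<lambda>v. f x * frechet_derivative g (at x) v + frechet_derivative f (at x) v * g x)) (at x)" for x
      by (intro has_derivative_mult d)
    show ?case
      using mult hermite_span_derivative frechet_derivative_at[OF d', symmetric]
      by (auto intro!: hermite_product_span.intros rapidly_decreasing_mult
            simp: differentiableI[OF d'] hermite_span_rapidly_decreasing)
  next
    case (add f g)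
    have d: "(f has_derivative frechet_derivative f (at x)) (at x)" "(g has_derivative frechet_derivative g (at x)) (at x)" for x
      using add by (auto simp: frechet_derivative_works)
    have d': "((\<lambda>x. f x + g x) has_derivative (\<lambda>v. frechet_derivative f (at x) v + frechet_derivative g (at x) v)) (at x)" for x
      by (intro has_derivative_add d)
    show ?case
      using add frechet_derivative_at[OF d', symmetric]
      by (auto intro!: hermite_product_span.add rapidly_decreasing_add simp: differentiableI[OF d'])
  qed
  then show "rapidly_decreasing f" "f differentiable (at x)"
    "b \<in> Basis \<Longrightarrow> (\<lambda>x. frechet_derivative f (at x) b) \<in> hermite_product_span" for x b
    by auto
qed

text \<open>Hermite's equation in one coordinate. The second derivative and the multiplication by
  \<open>(x \<bullet> b)^2\<close> are both expanded by the ladder relations; their terms two levels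
  up and two levels down agree, and the diagonal terms differ by \<open>2 n + 1\<close>.\<close>

lemma partial2_hermite:
  assumes b: "b \<in> Basis"
  shows "iter_partial [b, b] (\<lambda>x. complex_of_real (hermite \<alpha> x)) x
    = of_real (((x \<bullet> b)\<^sup>2 - (2 * real (\<alpha> b) + 1)) * hermite \<alpha> x)"
proof -
  let ?n = "\<alpha> b"
  define H where "H n = hermite (\<alpha>(b := n)) x" for n
  have m: "(x \<bullet> b) * H n = H (Suc n) / 2 + real n * H (n - 1)" for n
    using mult_hermite[OF b] by (simp add: H_def)
  let ?h = "\<lambda>\<beta> x. complex_of_real (hermite \<beta> x)"
  let ?p = "\<lambda>x. complex_of_real (hermite_partial b \<alpha> x)"
  have p: "?p = (\<lambda>x. of_nat ?n * ?h (\<alpha>(b := ?n - 1)) x + (- 1 / 2) * ?h (\<alpha>(b := Suc ?n)) x)"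
    by (simp add: hermite_partial_def)
  have "(?p has_derivative (\<lambda>v. of_nat ?n * of_real (\<Sum>a\<in>Basis. (v \<bullet> a) * hermite_partial a (\<alpha>(b := ?n - 1)) x)
      + (- 1 / 2) * of_real (\<Sum>a\<in>Basis. (v \<bullet> a) * hermite_partial a (\<alpha>(b := Suc ?n)) x))) (at x)"
    unfolding p by (intro has_derivative_add has_derivative_mult_right of_real_hermite_has_derivative)
  from frechet_derivative_at[OF this, symmetric]
  have "iter_partial [b, b] (?h \<alpha>) x = of_nat ?n * of_real (\<Sum>a\<in>Basis. (b \<bullet> a) * hermite_partial a (\<alpha>(b := ?n - 1)) x)
      + (- 1 / 2) * of_real (\<Sum>a\<in>Basis. (b \<bullet> a) * hermite_partial a (\<alpha>(b := Suc ?n)) x)"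
    using partial_of_real_hermite[OF b, of \<alpha>] by simp
  also have "\<dots> = of_nat ?n * of_real (hermite_partial b (\<alpha>(b := ?n - 1)) x)
      + (- 1 / 2) * of_real (hermite_partial b (\<alpha>(b := Suc ?n)) x)"
    unfolding sum_inner_Basis_mult[OF b] ..
  also have "\<dots> = of_real (real ?n * (real (?n - 1) * H (?n - 2) - H (Suc (?n - 1)) / 2)
      - (real (Suc ?n) * H ?n - H (Suc (Suc ?n)) / 2) / 2)"
    by (simp add: hermite_partial_def H_def numeral_2_eq_2)
  also have "real ?n * (real (?n - 1) * H (?n - 2) - H (Suc (?n - 1)) / 2)
      - (real (Suc ?n) * H ?n - H (Suc (Suc ?n)) / 2) / 2 = ((x \<bullet> b)\<^sup>2 - (2 * real ?n + 1)) * H ?n"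
  proof -
    have "(x \<bullet> b)\<^sup>2 * H ?n = (x \<bullet> b) * (H (Suc ?n) / 2 + real ?n * H (?n - 1))"
      by (simp only: m[symmetric] power2_eq_square mult.assoc)
    also have "\<dots> = ((x \<bullet> b) * H (Suc ?n)) / 2 + real ?n * ((x \<bullet> b) * H (?n - 1))"
      by (simp add: algebra_simps)
    also have "\<dots> = (H (Suc (Suc ?n)) / 2 + real (Suc ?n) * H ?n) / 2
        + real ?n * (H (Suc (?n - 1)) / 2 + real (?n - 1) * H (?n - 1 - 1))"
      unfolding m by simp
    finally show ?thesis
      by (cases ?n) (simp_all add: field_simps numeral_2_eq_2)
  qed
  finally show ?thesis by (simp add: H_def)
qed

subsection \<open>Square integrable functions\<close>

lemma ennpowr_ennreal: "0 \<le> a \<Longrightarrow> ennpowr (ennreal a) r = ennreal (a powr r)"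
  by (simp add: ennpowr_def)

lemma ennpowr_eq_0_iff: "ennpowr x r = 0 \<longleftrightarrow> x = 0"
  by (cases x) (auto simp: ennpowr_def ennreal_eq_0_iff)

lemma ennpowr_less_top_iff: "ennpowr x r < top \<longleftrightarrow> x < top"
  by (cases x) (auto simp: ennpowr_def)

lemma Lp_norm_eq_nn_integral:
  "p \<noteq> \<infinity> \<Longrightarrow> Lp_norm p f = ennpowr (\<integral>\<^sup>+x. ennreal (norm (f x) powr enn2real p) \<partial>lborel) (1 / enn2real p)"
  by (simp add: Lp_norm_def lebesgue_norm_def ennpowr_ennreal)

lemma Lp_norm_cong_AE:
  assumes [measurable]: "f \<in> borel_measurable borel" "g \<in> borel_measurable borel"
    and eq: "AE x in lborel. f x = g x"
  shows "Lp_norm p f = Lp_norm p g"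
proof (cases "p = \<infinity>")
  case True
  have "esssup lborel (\<lambda>x. ennreal (norm (f x))) = esssup lborel (\<lambda>x. ennreal (norm (g x)))"
    by (rule esssup_AE_cong) (use eq in auto)
  then show ?thesis using True by (simp add: Lp_norm_def lebesgue_norm_def)
next
  case False
  have "(\<integral>\<^sup>+x. ennreal (norm (f x) powr enn2real p) \<partial>lborel) = (\<integral>\<^sup>+x. ennreal (norm (g x) powr enn2real p) \<partial>lborel)"
    by (rule nn_integral_cong_AE) (use eq in auto)
  then show ?thesis using False by (simp add: Lp_norm_eq_nn_integral)
qed

lemma two_ennreal: "(2::ennreal) \<noteq> \<infinity>" "enn2real 2 = 2"
  by (auto simp: ennreal_numeral[symmetric] simp del: ennreal_numeral)

lemma L2_norm_eq: "Lp_norm 2 f = ennpowr (\<integral>\<^sup>+x. ennreal ((norm (f x))\<^sup>2) \<partial>lborel) (1 / 2)"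
  by (simp add: Lp_norm_eq_nn_integral two_ennreal powr_numeral)

lemma L2_iff: "f \<in> Lp_space 2 \<longleftrightarrow> f \<in> borel_measurable borel \<and> integrable lborel (\<lambda>x. (norm (f x))\<^sup>2)"
  by (auto simp: Lp_space_def L2_norm_eq ennpowr_less_top_iff integrable_iff_bounded)

lemma L2_norm_eq_0_iff:
  assumes "f \<in> borel_measurable borel"
  shows "Lp_norm 2 f = 0 \<longleftrightarrow> (AE x in lborel. f x = 0)"
  using assms by (simp add: L2_norm_eq ennpowr_eq_0_iff nn_integral_0_iff_AE)

lemma L2_measurable[measurable_dest]: "f \<in> Lp_space 2 \<Longrightarrow> f \<in> borel_measurable borel"
  by (simp add: L2_iff)

lemma L2_mult_integrable:
  assumes f: "f \<in> Lp_space 2" and g: "g \<in> Lp_space 2"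
  shows "integrable lborel (\<lambda>x. f x * g x)"
proof (rule Bochner_Integration.integrable_bound)
  show "integrable lborel (\<lambda>x. (norm (f x))\<^sup>2 + (norm (g x))\<^sup>2)"
    using f g by (simp add: L2_iff)
  have "norm (f x) * norm (g x) \<le> (norm (f x))\<^sup>2 + (norm (g x))\<^sup>2" for x
    using sum_squares_bound[of "norm (f x)" "norm (g x)"] mult_nonneg_nonneg[OF norm_ge_zero norm_ge_zero, of "f x" "g x"]
    by (simp only: mult.assoc)
  then show "AE x in lborel. norm (f x * g x) \<le> norm ((norm (f x))\<^sup>2 + (norm (g x))\<^sup>2)"
    by (simp add: norm_mult)
qed (use f g in \<open>auto simp: L2_iff\<close>)

lemma borel_measurable_cnj[measurable (raw)]:
  "f \<in> borel_measurable M \<Longrightarrow> (\<lambda>x. cnj (f x)) \<in> borel_measurable M"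
  by (rule measurable_compose[of f M borel]) (auto intro!: borel_measurable_continuous_onI continuous_intros)

lemma L2_add:
  assumes f: "f \<in> Lp_space 2" and g: "g \<in> Lp_space 2"
  shows "(\<lambda>x. f x + g x) \<in> Lp_space 2"
  unfolding L2_iff
proof (intro conjI, use f g in measurable, rule Bochner_Integration.integrable_bound)
  show "integrable lborel (\<lambda>x. 2 * ((norm (f x))\<^sup>2 + (norm (g x))\<^sup>2))"
    using f g by (simp add: L2_iff)
  have "(norm (f x + g x))\<^sup>2 \<le> 2 * ((norm (f x))\<^sup>2 + (norm (g x))\<^sup>2)" for x
  proof -
    have "(norm (f x + g x))\<^sup>2 \<le> (norm (f x) + norm (g x))\<^sup>2"
      by (intro power_mono norm_triangle_ineq) auto
    then show ?thesis
      using sum_squares_bound[of "norm (f x)" "norm (g x)"] by (simp add: power2_sum)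
  qed
  then show "AE x in lborel. norm ((norm (f x + g x))\<^sup>2) \<le> norm (2 * ((norm (f x))\<^sup>2 + (norm (g x))\<^sup>2))"
    by simp
qed (use f g in measurable)

lemma L2_scale: "f \<in> Lp_space 2 \<Longrightarrow> (\<lambda>x. c * f x) \<in> Lp_space 2"
  by (auto simp: L2_iff norm_mult power_mult_distrib)

lemma L2_diff: "f \<in> Lp_space 2 \<Longrightarrow> g \<in> Lp_space 2 \<Longrightarrow> (\<lambda>x. f x - g x) \<in> Lp_space 2"
  using L2_add[OF _ L2_scale[of g "-1"]] by simp

lemma rapidly_decreasing_L2: "rapidly_decreasing f \<Longrightarrow> f \<in> Lp_space 2"
  unfolding L2_iff using rapidly_decreasing_integrable[OF rapidly_decreasing_mult[of "\<lambda>x. norm (f x)" "\<lambda>x. norm (f x)"]]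
  by (auto simp: rapidly_decreasing_def power2_eq_square)

lemma schwartz_L2: "f \<in> schwartz_space \<Longrightarrow> f \<in> Lp_space 2"
  by (intro rapidly_decreasing_L2 schwartz_rapidly_decreasing)

text \<open>The set of disagreement is open and null. This upgrades uniqueness in \<open>L^2\<close>
  to the uniqueness as a function that the \<open>THE\<close> in \<open>func_calc_schwartz\<close>
  demands.\<close>

lemma AE_eq_continuous:
  fixes f g :: "'a::euclidean_space \<Rightarrow> 'b::real_normed_vector"
  assumes "continuous_on UNIV f" "continuous_on UNIV g" "AE x in lborel. f x = g x"
  shows "f = g"
proof -
  have "open {x. f x \<noteq> g x}"
    by (rule open_Collect_neq) (use assms in auto)
  moreover have "negligible {x. f x \<noteq> g x}"
  proof -
    have "AE x in lebesgue. f x = g x" using assms(3) by (rule AE_completion)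
    then show ?thesis
      by (simp add: negligible_iff_null_sets AE_iff_null_sets eventually_ae_filter)
        (metis (mono_tags, lifting) null_sets_completion_subset)
  qed
  ultimately have "{x. f x \<noteq> g x} = {}"
    using open_not_negligible by blast
  then show ?thesis by auto
qed

subsection \<open>Orthogonality and completeness of the Hermite functions\<close>

text \<open>\<open>hermite\<close> and \<open>energy\<close> see only the values on
  \<open>Basis\<close>. With 0 elsewhere, each Hermite function has one index and each bound on the
  energy leaves finitely many.\<close>

definition multi_indices :: "('a::euclidean_space \<Rightarrow> nat) set" where
  "multi_indices = {\<alpha>. \<forall>b. b \<notin> Basis \<longrightarrow> \<alpha> b = 0}"

definition energy :: "('a::euclidean_space \<Rightarrow> nat) \<Rightarrow> real" where
  "energy \<alpha> = real (2 * (\<Sum>b\<in>Basis. \<alpha> b) + DIM('a))"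

abbreviation chermite :: "('a::euclidean_space \<Rightarrow> nat) \<Rightarrow> 'a \<Rightarrow> complex" where
  "chermite \<alpha> \<equiv> (\<lambda>x. complex_of_real (hermite \<alpha> x))"

lemma chermite_schwartz: "chermite \<alpha> \<in> schwartz_space"
  using hermite_span_schwartz hermite_span.hermite by blast

lemma energy_ge_1: "1 \<le> energy (\<alpha> :: 'a::euclidean_space \<Rightarrow> nat)"
proof -
  have "1 \<le> 2 * (\<Sum>b\<in>Basis. \<alpha> b) + DIM('a)" using DIM_positive[where 'a='a] by linarith
  then show ?thesis unfolding energy_def by (metis of_nat_1 of_nat_le_iff)
qed

lemma finite_energy_le: "finite {\<alpha> :: 'a::euclidean_space \<Rightarrow> nat. \<alpha> \<in> multi_indices \<and> energy \<alpha> \<le> R}"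
proof (rule finite_subset)
  let ?n = "nat \<lceil>R\<rceil>"
  show "{\<alpha> :: 'a \<Rightarrow> nat. \<alpha> \<in> multi_indices \<and> energy \<alpha> \<le> R}
      \<subseteq> {\<alpha>. \<forall>b. (b \<in> Basis \<longrightarrow> \<alpha> b \<in> {..?n}) \<and> (b \<notin> Basis \<longrightarrow> \<alpha> b = 0)}"
  proof clarify
    fix \<alpha> :: "'a \<Rightarrow> nat" and b :: 'a
    assume a: "\<alpha> \<in> multi_indices" "energy \<alpha> \<le> R"
    have "\<alpha> b \<le> ?n" if "b \<in> Basis"
    proof -
      have "\<alpha> b \<le> (\<Sum>b\<in>Basis. \<alpha> b)" using that by (intro member_le_sum) auto
      then have "real (\<alpha> b) \<le> energy \<alpha>" by (simp add: energy_def flip: of_nat_sum)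
      then have "real (\<alpha> b) \<le> R" using a by linarith
      then show ?thesis by linarith
    qed
    then show "(b \<in> Basis \<longrightarrow> \<alpha> b \<in> {..?n}) \<and> (b \<notin> Basis \<longrightarrow> \<alpha> b = 0)"
      using a by (auto simp: multi_indices_def)
  qed
  show "finite {\<alpha>. \<forall>b::'a. (b \<in> Basis \<longrightarrow> \<alpha> b \<in> {..?n}) \<and> (b \<notin> Basis \<longrightarrow> \<alpha> b = 0)}"
    by (rule finite_set_of_finite_funs) auto
qed

lemma laplacian_hermite:
  fixes \<alpha> :: "'a::euclidean_space \<Rightarrow> nat"
  shows "laplacian (chermite \<alpha>) x = of_real (((norm x)\<^sup>2 - energy \<alpha>) * hermite \<alpha> x)"
proof -
  have "laplacian (chermite \<alpha>) x = of_real (\<Sum>b\<in>Basis. ((x \<bullet> b)\<^sup>2 - (2 * real (\<alpha> b) + 1)) * hermite \<alpha> x)"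
    unfolding laplacian_def by (simp only: of_real_sum partial2_hermite cong: sum.cong)
  also have "(\<Sum>b\<in>Basis. ((x \<bullet> b)\<^sup>2 - (2 * real (\<alpha> b) + 1)) * hermite \<alpha> x) = ((norm x)\<^sup>2 - energy \<alpha>) * hermite \<alpha> x"
    unfolding sum_distrib_right[symmetric] norm_power2_eq_sum energy_def
    by (simp add: sum_subtractf sum.distrib sum_distrib_left algebra_simps)
  finally show ?thesis .
qed

lemma schwartz_mult_integrable:
  "f \<in> schwartz_space \<Longrightarrow> g \<in> schwartz_space \<Longrightarrow> integrable lborel (\<lambda>x. f x * g x)"
  by (intro L2_mult_integrable schwartz_L2)

lemma schwartz_laplacian_integrable:
  assumes "f \<in> schwartz_space" "g \<in> schwartz_space" "b \<in> Basis"
  shows "integrable lborel (\<lambda>x. f x * iter_partial [b, b] g x)"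
  using assms by (intro schwartz_mult_integrable schwartz_iter_partial) auto

lemma hermite_laplacian:
  assumes "\<psi> \<in> schwartz_space"
  shows "(LBINT x. chermite \<alpha> x * laplacian \<psi> x) = (LBINT x. of_real (((norm x)\<^sup>2 - energy \<alpha>) * hermite \<alpha> x) * \<psi> x)"
proof -
  have i: "integrable lborel (\<lambda>x. iter_partial [b, b] (chermite \<alpha>) x * \<psi> x)" if "b \<in> Basis" for b
    using schwartz_laplacian_integrable[OF assms chermite_schwartz that, of \<alpha>] by (simp add: mult.commute)
  have "(LBINT x. chermite \<alpha> x * laplacian \<psi> x) = (\<Sum>b\<in>Basis. \<integral>x. chermite \<alpha> x * iter_partial [b, b] \<psi> x \<partial>lborel)"
    unfolding laplacian_def sum_distrib_left
    by (intro Bochner_Integration.integral_sum schwartz_laplacian_integrable chermite_schwartz assms)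
  also have "\<dots> = (\<Sum>b\<in>Basis. \<integral>x. iter_partial [b, b] (chermite \<alpha>) x * \<psi> x \<partial>lborel)"
    by (intro sum.cong refl schwartz_partial_symmetric chermite_schwartz assms)
  also have "\<dots> = (LBINT x. laplacian (chermite \<alpha>) x * \<psi> x)"
    unfolding laplacian_def sum_distrib_right
    by (intro Bochner_Integration.integral_sum[symmetric] i)
  finally show ?thesis by (simp only: laplacian_hermite)
qed

text \<open>Second derivatives in \<open>b\<close> are symmetric, and the two functions have
  different eigenvalues for the one-coordinate oscillator. Working in a single coordinate also
  separates Hermite functions of equal energy.\<close>

lemma hermite_orthogonal:
  assumes "b \<in> Basis" "\<alpha> b \<noteq> \<beta> b"
  shows "(LBINT x. hermite \<alpha> x * hermite \<beta> x) = 0"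
proof -
  have i: "integrable lborel (\<lambda>x. (x \<bullet> b)\<^sup>2 * (hermite \<alpha> x * hermite \<beta> x))"
    "integrable lborel (\<lambda>x. hermite \<alpha> x * hermite \<beta> x)"
  proof -
    have r: "rapidly_decreasing (\<lambda>x. hermite \<alpha> x * hermite \<beta> x)"
      by (intro rapidly_decreasing_mult hermite_rapidly_decreasing)
    then show "integrable lborel (\<lambda>x. hermite \<alpha> x * hermite \<beta> x)"
      by (rule rapidly_decreasing_integrable)
    have "(x \<bullet> b)\<^sup>2 \<le> (1 + norm x)\<^sup>2" for x
      using Basis_le_norm[OF assms(1), of x] by (intro power2_le_iff_abs_le[THEN iffD2]) auto
    then have "rapidly_decreasing (\<lambda>x. (x \<bullet> b)\<^sup>2 * (hermite \<alpha> x * hermite \<beta> x))"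
      by (intro rapidly_decreasing_mult_poly_bound[OF r, of _ 1 2])
         (auto simp: abs_mult intro!: mult_right_mono)
    then show "integrable lborel (\<lambda>x. (x \<bullet> b)\<^sup>2 * (hermite \<alpha> x * hermite \<beta> x))"
      by (rule rapidly_decreasing_integrable)
  qed
  have "(LBINT x. chermite \<alpha> x * iter_partial [b, b] (chermite \<beta>) x) = (LBINT x. iter_partial [b, b] (chermite \<alpha>) x * chermite \<beta> x)"
    by (intro schwartz_partial_symmetric chermite_schwartz assms)
  then have "(LBINT x. complex_of_real (hermite \<alpha> x * (((x \<bullet> b)\<^sup>2 - (2 * real (\<beta> b) + 1)) * hermite \<beta> x)))
     = (LBINT x. complex_of_real (((x \<bullet> b)\<^sup>2 - (2 * real (\<alpha> b) + 1)) * hermite \<alpha> x * hermite \<beta> x))"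
    by (simp only: partial2_hermite[OF assms(1)] of_real_mult)
  then have "(LBINT x. hermite \<alpha> x * (((x \<bullet> b)\<^sup>2 - (2 * real (\<beta> b) + 1)) * hermite \<beta> x))
     = (LBINT x. ((x \<bullet> b)\<^sup>2 - (2 * real (\<alpha> b) + 1)) * hermite \<alpha> x * hermite \<beta> x)"
    by (simp only: integral_complex_of_real of_real_eq_iff)
  moreover have "hermite \<alpha> x * (((x \<bullet> b)\<^sup>2 - (2 * real (\<beta> b) + 1)) * hermite \<beta> x)
      = (x \<bullet> b)\<^sup>2 * (hermite \<alpha> x * hermite \<beta> x) - (2 * real (\<beta> b) + 1) * (hermite \<alpha> x * hermite \<beta> x)"
    "((x \<bullet> b)\<^sup>2 - (2 * real (\<alpha> b) + 1)) * hermite \<alpha> x * hermite \<beta> x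
      = (x \<bullet> b)\<^sup>2 * (hermite \<alpha> x * hermite \<beta> x) - (2 * real (\<alpha> b) + 1) * (hermite \<alpha> x * hermite \<beta> x)" for x
    by (simp_all add: algebra_simps)
  ultimately have "(2 * real (\<beta> b) + 1) * (LBINT x. hermite \<alpha> x * hermite \<beta> x) = (2 * real (\<alpha> b) + 1) * (LBINT x. hermite \<alpha> x * hermite \<beta> x)"
    using i by simp
  then show ?thesis using assms(2) by (auto simp: mult_right_cancel)
qed

lemma hermite_orthogonal_multi_indices:
  assumes "\<alpha> \<in> multi_indices" "\<beta> \<in> multi_indices" "\<alpha> \<noteq> \<beta>"
  shows "(LBINT x. hermite \<alpha> x * hermite \<beta> x) = 0"
proof -
  obtain b where "\<alpha> b \<noteq> \<beta> b" using assms(3) by auto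
  moreover from this have "b \<in> Basis" using assms(1,2) by (metis (mono_tags, lifting) mem_Collect_eq multi_indices_def)
  ultimately show ?thesis by (rule hermite_orthogonal[rotated])
qed

definition hermite_sqnorm :: "('a::euclidean_space \<Rightarrow> nat) \<Rightarrow> real" where
  "hermite_sqnorm \<alpha> = (LBINT x. (hermite \<alpha> x)\<^sup>2)"

lemma hermite_nonzero: "\<exists>x. hermite \<alpha> x \<noteq> 0"
proof -
  have "\<exists>t. hermite1 n t \<noteq> 0" for n
  proof -
    have "hermite_poly n \<noteq> 0" using degree_hermite_poly[of n] by (cases n) auto
    then have "finite {t. poly (hermite_poly n) t = 0}" by (rule poly_roots_finite)
    then have "\<exists>t. poly (hermite_poly n) t \<noteq> 0"
      using infinite_UNIV_char_0[where 'a=real] by (metis (mono_tags, lifting) UNIV_eq_I mem_Collect_eq)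
    then show ?thesis by (simp add: hermite1_def)
  qed
  then obtain t where t: "\<And>n. hermite1 n (t n) \<noteq> 0" by metis
  have "hermite \<alpha> (\<Sum>b\<in>Basis. t (\<alpha> b) *\<^sub>R b) \<noteq> 0"
    using t by (simp add: hermite_def)
  then show ?thesis by blast
qed

lemma hermite_not_AE_0: "\<not> (AE x in lborel. hermite \<alpha> x = 0)"
proof
  assume "AE x in lborel. hermite \<alpha> x = 0"
  then have "hermite \<alpha> = (\<lambda>_. 0)"
    by (intro AE_eq_continuous continuous_on_hermite continuous_on_const)
  then show False using hermite_nonzero[of \<alpha>] by simp
qed

lemma hermite_sqnorm_pos: "0 < hermite_sqnorm \<alpha>"
proof -
  have "integrable lborel (\<lambda>x. (hermite \<alpha> x)\<^sup>2)"
    unfolding power2_eq_square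
    by (intro rapidly_decreasing_integrable rapidly_decreasing_mult hermite_rapidly_decreasing)
  then have "hermite_sqnorm \<alpha> \<noteq> 0"
    unfolding hermite_sqnorm_def using hermite_not_AE_0[of \<alpha>]
    by (subst integral_nonneg_eq_0_iff_AE) auto
  moreover have "0 \<le> hermite_sqnorm \<alpha>" by (simp add: hermite_sqnorm_def)
  ultimately show ?thesis by simp
qed

text \<open>Hermite functions are real and not normalized here: hence no conjugate, and a division
  by the squared norm.\<close>

definition hermite_coeff :: "('a::euclidean_space \<Rightarrow> nat) \<Rightarrow> ('a \<Rightarrow> complex) \<Rightarrow> complex" where
  "hermite_coeff \<alpha> f = (LBINT x. f x * chermite \<alpha> x) / of_real (hermite_sqnorm \<alpha>)"

lemma hermite_coeff_eq_0_iff: "hermite_coeff \<alpha> f = 0 \<longleftrightarrow> (LBINT x. f x * chermite \<alpha> x) = 0"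
  using hermite_sqnorm_pos[of \<alpha>] by (simp add: hermite_coeff_def)

lemma hermite_coeff_diff:
  assumes "f \<in> Lp_space 2" "g \<in> Lp_space 2"
  shows "hermite_coeff \<alpha> (\<lambda>x. f x - g x) = hermite_coeff \<alpha> f - hermite_coeff \<alpha> g"
  unfolding hermite_coeff_def diff_divide_distrib[symmetric]
  using assms L2_mult_integrable[OF _ schwartz_L2[OF chermite_schwartz[of \<alpha>]]]
  by (simp add: left_diff_distrib)

lemma hermite_coeff_sum:
  assumes "finite I" "I \<subseteq> multi_indices" "\<beta> \<in> multi_indices"
  shows "hermite_coeff \<beta> (\<lambda>x. \<Sum>\<alpha>\<in>I. c \<alpha> * chermite \<alpha> x) = (if \<beta> \<in> I then c \<beta> else 0)"
proof -
  have "(LBINT x. (\<Sum>\<alpha>\<in>I. c \<alpha> * chermite \<alpha> x) * chermite \<beta> x) = (\<Sum>\<alpha>\<in>I. c \<alpha> * (LBINT x. chermite \<alpha> x * chermite \<beta> x))"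
    unfolding sum_distrib_right mult.assoc
    by (subst Bochner_Integration.integral_sum)
       (auto intro!: schwartz_mult_integrable[OF chermite_schwartz chermite_schwartz])
  also have "\<dots> = (\<Sum>\<alpha>\<in>I. if \<alpha> = \<beta> then c \<alpha> * of_real (hermite_sqnorm \<beta>) else 0)"
  proof (intro sum.cong refl)
    fix \<alpha> assume \<alpha>: "\<alpha> \<in> I"
    have "(LBINT x. chermite \<alpha> x * chermite \<beta> x) = of_real (LBINT x. hermite \<alpha> x * hermite \<beta> x)"
      by (simp only: of_real_mult[symmetric] integral_complex_of_real)
    also have "(LBINT x. hermite \<alpha> x * hermite \<beta> x) = (if \<alpha> = \<beta> then hermite_sqnorm \<beta> else 0)"
      using hermite_orthogonal_multi_indices[of \<alpha> \<beta>] \<alpha> assms by (auto simp: hermite_sqnorm_def power2_eq_square)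
    finally show "c \<alpha> * (LBINT x. chermite \<alpha> x * chermite \<beta> x) = (if \<alpha> = \<beta> then c \<alpha> * of_real (hermite_sqnorm \<beta>) else 0)"
      by simp
  qed
  finally show ?thesis
    using assms(1) hermite_sqnorm_pos[of \<beta>] by (auto simp: hermite_coeff_def)
qed

section \<open>Completeness, and uniqueness of representing functions\<close>

lemma AE_eq_0_of_real_hermite_coeffs:
  fixes m :: "'a::euclidean_space \<Rightarrow> real"
  assumes [measurable]: "m \<in> borel_measurable borel"
    and i: "integrable lborel (\<lambda>x. m x * exp (- (norm x)\<^sup>2 / 4))"
    and o: "\<And>\<alpha>. \<alpha> \<in> multi_indices \<Longrightarrow> (LBINT x. m x * hermite \<alpha> x) = 0"
  shows "AE x in lborel. m x = 0"
proof -
  have "AE x in lborel. m x * exp (- (norm x)\<^sup>2 / 2) = 0"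
  proof (rule AE_eq_0_of_poly_moments[of _ hermite_poly])
    fix c :: real
    \<comment> \<open>Half of the Gaussian exponent absorbs the exponential in the coordinates, at
      the price of \<open>c^2\<close> per coordinate; the other half is left for hypothesis
      \<open>i\<close>.\<close>
    show "integrable lborel (\<lambda>x. m x * exp (- (norm x)\<^sup>2 / 2) * exp (c * (\<Sum>b\<in>Basis. \<bar>x \<bullet> b\<bar>)))"
    proof (rule integrable_mult_of_le[OF i, where C="exp (real DIM('a) * c\<^sup>2)"])
      fix x :: 'a
      have "c * \<bar>x \<bullet> b\<bar> \<le> c\<^sup>2 + (x \<bullet> b)\<^sup>2 / 4" for b
      proof -
        have "0 \<le> (\<bar>x \<bullet> b\<bar> / 2 - c)\<^sup>2" by simp
        then show ?thesis by (simp add: power2_diff power_divide mult.commute[of c])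
      qed
      then have "(\<Sum>b\<in>Basis. c * \<bar>x \<bullet> b\<bar>) \<le> (\<Sum>b\<in>Basis. c\<^sup>2 + (x \<bullet> b)\<^sup>2 / 4)"
        by (rule sum_mono)
      then have "c * (\<Sum>b\<in>Basis. \<bar>x \<bullet> b\<bar>) \<le> real DIM('a) * c\<^sup>2 + (norm x)\<^sup>2 / 4"
        by (simp add: sum_distrib_left sum.distrib norm_power2_eq_sum sum_divide_distrib)
      then have "exp (- (norm x)\<^sup>2 / 2 + c * (\<Sum>b\<in>Basis. \<bar>x \<bullet> b\<bar>)) \<le> exp (real DIM('a) * c\<^sup>2 + - (norm x)\<^sup>2 / 4)"
        by simp
      then have "\<bar>m x\<bar> * (exp (- (norm x)\<^sup>2 / 2) * exp (c * (\<Sum>b\<in>Basis. \<bar>x \<bullet> b\<bar>)))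
        \<le> \<bar>m x\<bar> * (exp (real DIM('a) * c\<^sup>2) * exp (- (norm x)\<^sup>2 / 4))"
        unfolding exp_add by (rule mult_left_mono) simp
      then show "\<bar>m x * exp (- (norm x)\<^sup>2 / 2) * exp (c * (\<Sum>b\<in>Basis. \<bar>x \<bullet> b\<bar>))\<bar>
         \<le> exp (real DIM('a) * c\<^sup>2) * \<bar>m x * exp (- (norm x)\<^sup>2 / 4)\<bar>"
        by (simp only: abs_mult abs_exp_cancel mult_ac)
    qed measurable
  next
    fix \<alpha> :: "'a \<Rightarrow> nat"
    \<comment> \<open>The moment lemma ranges over all functions \<open>\<alpha>\<close>, hypothesis
      \<open>o\<close> over multi-indices only.\<close>
    let ?\<beta> = "\<lambda>b. if b \<in> Basis then \<alpha> b else 0"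
    have "m x * exp (- (norm x)\<^sup>2 / 2) * (\<Prod>b\<in>Basis. poly (hermite_poly (\<alpha> b)) (x \<bullet> b)) = m x * hermite ?\<beta> x" for x
    proof -
      have "(\<Prod>b\<in>Basis. exp (- (x \<bullet> b)\<^sup>2 / 2)) = exp (- (norm x)\<^sup>2 / 2)"
        unfolding norm_power2_eq_sum by (simp add: exp_sum[symmetric] sum_negf sum_divide_distrib)
      then show ?thesis by (simp add: hermite_def hermite1_def prod.distrib)
    qed
    then show "(LBINT x. m x * exp (- (norm x)\<^sup>2 / 2) * (\<Prod>b\<in>Basis. poly (hermite_poly (\<alpha> b)) (x \<bullet> b))) = 0"
      using o[of ?\<beta>] by (simp only:) (simp add: multi_indices_def)
  qed (auto simp: degree_hermite_poly)
  then show ?thesis by simp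
qed

text \<open>Integrability is asked for instead of \<open>L^2\<close>, so that functions qualify of
  which only pairings with Schwartz functions are known.\<close>

lemma AE_eq_0_of_hermite_coeffs:
  fixes h :: "'a::euclidean_space \<Rightarrow> complex"
  assumes [measurable]: "h \<in> borel_measurable borel"
    and i: "integrable lborel (\<lambda>x. h x * of_real (exp (- (norm x)\<^sup>2 / 4)))"
    and ih: "\<And>\<alpha>. integrable lborel (\<lambda>x. h x * chermite \<alpha> x)"
    and o: "\<And>\<alpha>. \<alpha> \<in> multi_indices \<Longrightarrow> (LBINT x. h x * chermite \<alpha> x) = 0"
  shows "AE x in lborel. h x = 0"
proof -
  have "AE x in lborel. Re (h x) = 0"
  proof (rule AE_eq_0_of_real_hermite_coeffs)
    show "integrable lborel (\<lambda>x. Re (h x) * exp (- (norm x)\<^sup>2 / 4))"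
      using integrable_Re[OF i] by simp
    show "(LBINT x. Re (h x) * hermite \<alpha> x) = 0" if "\<alpha> \<in> multi_indices" for \<alpha>
      using integral_Re[OF ih[of \<alpha>]] o[OF that] by simp
  qed measurable
  moreover have "AE x in lborel. Im (h x) = 0"
  proof (rule AE_eq_0_of_real_hermite_coeffs)
    show "integrable lborel (\<lambda>x. Im (h x) * exp (- (norm x)\<^sup>2 / 4))"
      using integrable_Im[OF i] by simp
    show "(LBINT x. Im (h x) * hermite \<alpha> x) = 0" if "\<alpha> \<in> multi_indices" for \<alpha>
      using integral_Im[OF ih[of \<alpha>]] o[OF that] by simp
  qed measurable
  ultimately show ?thesis by eventually_elim (simp add: complex_eq_iff)
qed

lemma L2_AE_eq_0_of_hermite_coeffs:
  fixes h :: "'a::euclidean_space \<Rightarrow> complex"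
  assumes h: "h \<in> Lp_space 2" and o: "\<And>\<alpha>. \<alpha> \<in> multi_indices \<Longrightarrow> hermite_coeff \<alpha> h = 0"
  shows "AE x in lborel. h x = 0"
proof (rule AE_eq_0_of_hermite_coeffs)
  have "rapidly_decreasing (\<lambda>x::'a. complex_of_real (exp (- (norm x)\<^sup>2 / 4)))"
    by (rule rapidly_decreasing_mult_poly_bound[where C=1 and k=0, OF exp_neg_norm_rapidly_decreasing[of "1/4"]]) simp_all
  then show "integrable lborel (\<lambda>x. h x * of_real (exp (- (norm x)\<^sup>2 / 4)))"
    by (intro L2_mult_integrable h rapidly_decreasing_L2)
  show "integrable lborel (\<lambda>x. h x * chermite \<alpha> x)" for \<alpha>
    by (intro L2_mult_integrable h schwartz_L2 chermite_schwartz)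
qed (use h o in \<open>auto simp: hermite_coeff_eq_0_iff\<close>)

text \<open>The difference is multiplied by the ground state, which is nowhere zero and can be
  divided out again. The Hermite coefficients of the product are pairings of \<open>f - g\<close>
  with products of two Hermite functions, which are Schwartz functions.\<close>

lemma represents_unique:
  assumes f: "represents f u" and g: "represents g u"
  shows "AE x in lborel. f x = g x"
proof -
  have [measurable]: "f \<in> borel_measurable borel" "g \<in> borel_measurable borel"
    using f g by (auto simp: represents_def)
  let ?k = "\<lambda>x. (f x - g x) * chermite (\<lambda>_. 0) x"
  have d: "integrable lborel (\<lambda>x. (f x - g x) * \<psi> x)" "(LBINT x. (f x - g x) * \<psi> x) = 0"
    if "\<psi> \<in> schwartz_space" for \<psi>
    using f g that by (auto simp: represents_def left_diff_distrib)
  have "AE x in lborel. ?k x = 0"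
  proof (rule AE_eq_0_of_hermite_coeffs)
    have "integrable lborel ?k" using d(1)[OF chermite_schwartz] .
    then show "integrable lborel (\<lambda>x. ?k x * of_real (exp (- (norm x)\<^sup>2 / 4)))"
      by (rule Bochner_Integration.integrable_bound) (auto simp: norm_mult mult_left_le)
    have s: "(\<lambda>x. chermite (\<lambda>_. 0) x * chermite \<alpha> x) \<in> schwartz_space" for \<alpha>
      using hermite_product_span_schwartz by (blast intro: hermite_product_span.mult hermite_span.hermite)
    show "integrable lborel (\<lambda>x. ?k x * chermite \<alpha> x)" "(LBINT x. ?k x * chermite \<alpha> x) = 0" for \<alpha>
      using d[OF s[of \<alpha>]] by (simp_all add: mult.assoc)
  qed measurable
  moreover have "hermite (\<lambda>_. 0) x \<noteq> 0" for x :: 'a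
    by (simp add: hermite_def hermite1_def)
  ultimately show ?thesis by simp
qed

subsection \<open>Spectral resolution of the harmonic oscillator\<close>

definition hermite_level :: "real \<Rightarrow> ('a::euclidean_space \<Rightarrow> nat) set" where
  "hermite_level \<mu> = {\<alpha> \<in> multi_indices. energy \<alpha> = \<mu>}"

lemma finite_hermite_level: "finite (hermite_level \<mu>)"
  by (rule finite_subset[OF _ finite_energy_le[of \<mu>]]) (auto simp: hermite_level_def)

lemma hermite_sum_schwartz: "(\<lambda>x. \<Sum>\<alpha>\<in>I. c \<alpha> * chermite \<alpha> x) \<in> schwartz_space"
  using hermite_span_schwartz hermite_sum_in_span by blast

lemma rapidly_decreasing_norm_power2_mult:
  fixes f :: "'a::euclidean_space \<Rightarrow> complex"
  assumes "rapidly_decreasing f"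
  shows "rapidly_decreasing (\<lambda>x. of_real ((norm x)\<^sup>2) * f x)"
  using assms
  by (intro rapidly_decreasing_mult_poly_bound[OF assms, of _ 1 2])
     (auto simp: norm_mult norm_power rapidly_decreasing_def intro!: mult_right_mono power_mono)

lemma rapidly_decreasing_mult_schwartz_integrable:
  "rapidly_decreasing f \<Longrightarrow> g \<in> schwartz_space \<Longrightarrow> integrable lborel (\<lambda>x. f x * g x)"
  by (rule rapidly_decreasing_integrable[OF rapidly_decreasing_mult[OF _ schwartz_rapidly_decreasing]])

lemma L2_mult_chermite_integrable:
  "f \<in> Lp_space 2 \<Longrightarrow> integrable lborel (\<lambda>x. f x * chermite \<alpha> x)"
  by (rule L2_mult_integrable[OF _ schwartz_L2[OF chermite_schwartz]])

lemma hermite_sum_in_eigenspace: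
  fixes c :: "('a::euclidean_space \<Rightarrow> nat) \<Rightarrow> complex"
  assumes I: "I \<subseteq> hermite_level \<mu>"
  shows "(\<lambda>x. \<Sum>\<alpha>\<in>I. c \<alpha> * chermite \<alpha> x) \<in> eigenspace \<mu>"
proof -
  have fin: "finite I" using I finite_hermite_level finite_subset by blast
  define h where "h x = (\<Sum>\<alpha>\<in>I. c \<alpha> * chermite \<alpha> x)" for x
  \<comment> \<open>The distributional Laplacian that the eigenvalue equation dictates.\<close>
  define l where "l x = of_real ((norm x)\<^sup>2) * h x - of_real \<mu> * h x" for x
  have h: "h \<in> schwartz_space" unfolding h_def by (rule hermite_sum_schwartz)
  have hr: "rapidly_decreasing h" by (intro schwartz_rapidly_decreasing h)
  have nh: "rapidly_decreasing (\<lambda>x. of_real ((norm x)\<^sup>2) * h x)"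
    by (intro rapidly_decreasing_norm_power2_mult hr)
  have l: "rapidly_decreasing l"
  proof -
    have "rapidly_decreasing (\<lambda>x. of_real (- \<mu>) * h x)"
      using hr by (intro rapidly_decreasing_mult_bounded[OF hr, of _ "\<bar>\<mu>\<bar>"]) auto
    from rapidly_decreasing_add[OF nh this] show ?thesis by (simp add: l_def[abs_def])
  qed
  have "(LBINT x. h x * laplacian \<psi> x) = (LBINT x. l x * \<psi> x)" if \<psi>: "\<psi> \<in> schwartz_space" for \<psi>
  proof -
    have ih: "integrable lborel (\<lambda>x. chermite \<alpha> x * laplacian \<psi> x)" for \<alpha>
      unfolding laplacian_def sum_distrib_left
      by (intro Bochner_Integration.integrable_sum schwartz_laplacian_integrable chermite_schwartz \<psi>)
    have il: "integrable lborel (\<lambda>x. of_real (((norm x)\<^sup>2 - energy \<alpha>) * hermite \<alpha> x) * \<psi> x)" for \<alpha>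
    proof -
      have "integrable lborel (\<lambda>x. (of_real ((norm x)\<^sup>2) * chermite \<alpha> x) * \<psi> x)"
        "integrable lborel (\<lambda>x. chermite \<alpha> x * \<psi> x)"
        by (intro rapidly_decreasing_integrable rapidly_decreasing_mult rapidly_decreasing_norm_power2_mult
            schwartz_rapidly_decreasing \<psi> chermite_schwartz)+
      then have "integrable lborel (\<lambda>x. (of_real ((norm x)\<^sup>2) * chermite \<alpha> x) * \<psi> x - of_real (energy \<alpha>) * (chermite \<alpha> x * \<psi> x))"
        by (intro Bochner_Integration.integrable_diff integrable_mult_right)
      then show ?thesis by (simp add: algebra_simps)
    qed
    have "(LBINT x. h x * laplacian \<psi> x) = (\<Sum>\<alpha>\<in>I. c \<alpha> * (LBINT x. chermite \<alpha> x * laplacian \<psi> x))"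
      unfolding h_def sum_distrib_right mult.assoc
      by (subst Bochner_Integration.integral_sum) (auto intro!: ih)
    also have "\<dots> = (\<Sum>\<alpha>\<in>I. c \<alpha> * (LBINT x. of_real (((norm x)\<^sup>2 - energy \<alpha>) * hermite \<alpha> x) * \<psi> x))"
      by (simp only: hermite_laplacian[OF \<psi>])
    also have "\<dots> = (LBINT x. (\<Sum>\<alpha>\<in>I. c \<alpha> * (of_real (((norm x)\<^sup>2 - energy \<alpha>) * hermite \<alpha> x) * \<psi> x)))"
      by (subst Bochner_Integration.integral_sum) (use il in \<open>auto simp del: of_real_mult of_real_diff\<close>)
    also have "(\<lambda>x. \<Sum>\<alpha>\<in>I. c \<alpha> * (of_real (((norm x)\<^sup>2 - energy \<alpha>) * hermite \<alpha> x) * \<psi> x)) = (\<lambda>x. l x * \<psi> x)"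
    proof
      fix x
      have "(\<Sum>\<alpha>\<in>I. c \<alpha> * (of_real (((norm x)\<^sup>2 - energy \<alpha>) * hermite \<alpha> x) * \<psi> x))
          = (\<Sum>\<alpha>\<in>I. (of_real ((norm x)\<^sup>2) - of_real \<mu>) * (c \<alpha> * chermite \<alpha> x) * \<psi> x)"
        using I by (intro sum.cong refl) (auto simp: hermite_level_def algebra_simps)
      also have "\<dots> = l x * \<psi> x"
        unfolding l_def h_def left_diff_distrib[symmetric] by (simp add: sum_distrib_left sum_distrib_right)
      finally show "(\<Sum>\<alpha>\<in>I. c \<alpha> * (of_real (((norm x)\<^sup>2 - energy \<alpha>) * hermite \<alpha> x) * \<psi> x)) = l x * \<psi> x" .
    qed
    finally show ?thesis .
  qed
  then have "represents l (\<lambda>\<psi>. \<integral>x. h x * laplacian \<psi> x \<partial>lborel)"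
    using l by (auto simp: represents_def rapidly_decreasing_mult_schwartz_integrable)
  moreover have "l \<in> Lp_space 2" "h \<in> Lp_space 2" "(\<lambda>x. of_real ((norm x)\<^sup>2) * h x) \<in> Lp_space 2"
    using l hr nh by (auto intro: rapidly_decreasing_L2)
  moreover have "(\<lambda>x. of_real \<mu> * h x) \<in> Lp_space 2"
    using L2_scale[OF \<open>h \<in> Lp_space 2\<close>] .
  ultimately have "harmonic_oscillator h (\<lambda>x. of_real \<mu> * h x)"
    unfolding harmonic_oscillator_def by (intro conjI bexI[of _ l]) (auto simp: l_def)
  then show ?thesis by (simp add: eigenspace_def h_def[abs_def])
qed

lemma eigenspace_L2: "h \<in> eigenspace \<mu> \<Longrightarrow> h \<in> Lp_space 2"
  by (simp add: eigenspace_def harmonic_oscillator_def)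

text \<open>A Hermite function is an admissible test function for the distributional Laplacian, so
  the derivatives fall on it and nothing but \<open>L^2\<close> conditions is asked of
  \<open>h\<close>. Comparing both eigenvalues leaves \<open>\<mu> - energy \<alpha>\<close> times
  the coefficient equal to 0.\<close>

lemma eigenspace_hermite_coeff:
  assumes h: "h \<in> eigenspace \<mu>" and e: "energy \<alpha> \<noteq> \<mu>"
  shows "hermite_coeff \<alpha> h = 0"
proof -
  let ?n = "\<lambda>x. of_real ((norm x)\<^sup>2) * h x"
  obtain l where L2: "h \<in> Lp_space 2" "?n \<in> Lp_space 2" "l \<in> Lp_space 2"
    and rep: "represents l (\<lambda>\<psi>. \<integral>x. h x * laplacian \<psi> x \<partial>lborel)"
    and ae: "AE x in lborel. of_real \<mu> * h x = - l x + ?n x"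
    using h unfolding eigenspace_def harmonic_oscillator_def by auto
  note ih = L2_mult_chermite_integrable[OF L2(1), of \<alpha>] and inn = L2_mult_chermite_integrable[OF L2(2), of \<alpha>]
  have [measurable]: "h \<in> borel_measurable borel" "l \<in> borel_measurable borel" using L2 by auto
  have "(LBINT x. l x * chermite \<alpha> x) = (LBINT x. ?n x * chermite \<alpha> x - of_real \<mu> * (h x * chermite \<alpha> x))"
  proof (rule integral_cong_AE)
    show "AE x in lborel. l x * chermite \<alpha> x = ?n x * chermite \<alpha> x - of_real \<mu> * (h x * chermite \<alpha> x)"
      using ae
    proof eventually_elim
      case (elim x)
      then have "l x = ?n x - of_real \<mu> * h x" by (simp add: algebra_simps)
      then show ?case by (simp only: left_diff_distrib mult.assoc)
    qed
  qed measurable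
  also have "\<dots> = (LBINT x. ?n x * chermite \<alpha> x) - of_real \<mu> * (LBINT x. h x * chermite \<alpha> x)"
    using ih inn by (simp only: Bochner_Integration.integral_diff integrable_mult_right integral_mult_right_zero)
  finally have 1: "(LBINT x. l x * chermite \<alpha> x) = \<dots>" .
  have "(LBINT x. l x * chermite \<alpha> x) = (LBINT x. h x * laplacian (chermite \<alpha>) x)"
    by (rule rep[unfolded represents_def, THEN conjunct2, rule_format, OF chermite_schwartz, THEN conjunct2, symmetric])
  also have "\<dots> = (LBINT x. ?n x * chermite \<alpha> x - of_real (energy \<alpha>) * (h x * chermite \<alpha> x))"
    by (simp add: laplacian_hermite algebra_simps)
  also have "\<dots> = (LBINT x. ?n x * chermite \<alpha> x) - of_real (energy \<alpha>) * (LBINT x. h x * chermite \<alpha> x)"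
    using ih inn by (simp only: Bochner_Integration.integral_diff integrable_mult_right integral_mult_right_zero)
  finally have "(of_real \<mu> - of_real (energy \<alpha>)) * (LBINT x. h x * chermite \<alpha> x) = 0"
    using 1 by (simp add: left_diff_distrib)
  then show ?thesis using e by (simp add: hermite_coeff_eq_0_iff flip: of_real_diff)
qed

definition hermite_projection :: "real \<Rightarrow> ('a::euclidean_space \<Rightarrow> complex) \<Rightarrow> 'a \<Rightarrow> complex" where
  "hermite_projection \<mu> f x = (\<Sum>\<alpha>\<in>hermite_level \<mu>. hermite_coeff \<alpha> f * chermite \<alpha> x)"

lemma eigenspace_AE_eq:
  assumes h: "h \<in> eigenspace \<mu>"
  shows "AE x in lborel. h x = hermite_projection \<mu> h x"
proof -
  have p: "hermite_projection \<mu> h \<in> Lp_space 2"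
    unfolding hermite_projection_def[abs_def] by (intro schwartz_L2 hermite_sum_schwartz)
  have "AE x in lborel. h x - hermite_projection \<mu> h x = 0"
  proof (rule L2_AE_eq_0_of_hermite_coeffs)
    show "(\<lambda>x. h x - hermite_projection \<mu> h x) \<in> Lp_space 2"
      by (intro L2_diff p eigenspace_L2[OF h])
    fix \<alpha> :: "'a \<Rightarrow> nat" assume \<alpha>: "\<alpha> \<in> multi_indices"
    have "hermite_coeff \<alpha> (hermite_projection \<mu> h) = (if \<alpha> \<in> hermite_level \<mu> then hermite_coeff \<alpha> h else 0)"
      unfolding hermite_projection_def[abs_def]
      by (rule hermite_coeff_sum) (use \<alpha> finite_hermite_level in \<open>auto simp: hermite_level_def\<close>)
    then show "hermite_coeff \<alpha> (\<lambda>x. h x - hermite_projection \<mu> h x) = 0"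
      using eigenspace_hermite_coeff[OF h, of \<alpha>] \<alpha>
      by (auto simp: hermite_coeff_diff[OF eigenspace_L2[OF h] p] hermite_level_def)
  qed
  then show ?thesis by simp
qed

lemma chermite_in_eigenspace:
  assumes "\<alpha> \<in> multi_indices"
  shows "chermite \<alpha> \<in> eigenspace (energy \<alpha>)"
  using hermite_sum_in_eigenspace[of "{\<alpha>}" "energy \<alpha>" "\<lambda>_. 1"] assms by (simp add: hermite_level_def)

lemma energy_in_eigenvalues:
  fixes \<alpha> :: "'a::euclidean_space \<Rightarrow> nat"
  assumes "\<alpha> \<in> multi_indices"
  shows "energy \<alpha> \<in> eigenvalues TYPE('a)"
  unfolding eigenvalues_def using chermite_in_eigenspace[OF assms] hermite_not_AE_0[of \<alpha>]
  by (intro CollectI exI[of _ "chermite \<alpha>"]) auto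

lemma L2_inner_diff_chermite_eq_0_iff:
  assumes "f \<in> Lp_space 2" "g \<in> Lp_space 2"
  shows "L2_inner (\<lambda>x. f x - g x) (chermite \<alpha>) = 0 \<longleftrightarrow> hermite_coeff \<alpha> g = hermite_coeff \<alpha> f"
proof -
  have "L2_inner (\<lambda>x. f x - g x) (chermite \<alpha>) = 0 \<longleftrightarrow> hermite_coeff \<alpha> (\<lambda>x. f x - g x) = 0"
    by (simp add: L2_inner_def hermite_coeff_eq_0_iff)
  then show ?thesis using assms by (auto simp: hermite_coeff_diff)
qed

text \<open>The finite Hermite sum shows that the choice behind \<open>eigenprojection\<close> is
  possible; orthogonality to the Hermite functions of level \<open>\<mu>\<close> then fixes the
  coefficients of whatever was chosen.\<close>

lemma eigenprojection_AE_eq: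
  assumes f: "f \<in> Lp_space 2"
  shows "eigenprojection \<mu> f \<in> borel_measurable borel"
    and "AE x in lborel. eigenprojection \<mu> f x = hermite_projection \<mu> f x"
proof -
  let ?P = "\<lambda>p. p \<in> eigenspace \<mu> \<and> (\<forall>h\<in>eigenspace \<mu>. L2_inner (\<lambda>x. f x - p x) h = 0)"
  let ?p = "hermite_projection \<mu> f"
  have p: "?p \<in> eigenspace \<mu>"
    unfolding hermite_projection_def[abs_def] by (rule hermite_sum_in_eigenspace) simp
  have pL: "?p \<in> Lp_space 2" by (rule eigenspace_L2[OF p])
  have pc: "hermite_coeff \<alpha> ?p = hermite_coeff \<alpha> f" if "\<alpha> \<in> hermite_level \<mu>" for \<alpha>
  proof -
    have "hermite_coeff \<alpha> ?p = (if \<alpha> \<in> hermite_level \<mu> then hermite_coeff \<alpha> f else 0)"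
      unfolding hermite_projection_def[abs_def]
      by (rule hermite_coeff_sum) (use that finite_hermite_level in \<open>auto simp: hermite_level_def\<close>)
    then show ?thesis using that by simp
  qed
  have "L2_inner (\<lambda>x. f x - ?p x) h = 0" if h: "h \<in> eigenspace \<mu>" for h
  proof -
    have d: "(\<lambda>x. f x - ?p x) \<in> Lp_space 2" by (intro L2_diff f pL)
    have [measurable]: "h \<in> borel_measurable borel" "f \<in> borel_measurable borel" "?p \<in> borel_measurable borel"
        "hermite_projection \<mu> h \<in> borel_measurable borel"
      using f pL eigenspace_L2[OF h] by (auto simp: hermite_projection_def[abs_def])
    have "L2_inner (\<lambda>x. f x - ?p x) h = (LBINT x. (f x - ?p x) * cnj (hermite_projection \<mu> h x))"
      unfolding L2_inner_def
      by (rule integral_cong_AE) (use eigenspace_AE_eq[OF h] in auto)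
    also have "\<dots> = (LBINT x. (\<Sum>\<alpha>\<in>hermite_level \<mu>. cnj (hermite_coeff \<alpha> h) * ((f x - ?p x) * chermite \<alpha> x)))"
      unfolding hermite_projection_def[of \<mu> h] by (simp add: sum_distrib_left mult_ac)
    also have "\<dots> = (\<Sum>\<alpha>\<in>hermite_level \<mu>. cnj (hermite_coeff \<alpha> h) * (LBINT x. (f x - ?p x) * chermite \<alpha> x))"
      by (subst Bochner_Integration.integral_sum)
         (auto intro!: L2_mult_chermite_integrable[OF d])
    also have "\<dots> = 0"
    proof (rule sum.neutral, rule ballI)
      fix \<alpha> :: "'a \<Rightarrow> nat" assume "\<alpha> \<in> hermite_level \<mu>"
      then have "hermite_coeff \<alpha> (\<lambda>x. f x - ?p x) = 0"
        by (simp add: hermite_coeff_diff[OF f pL] pc)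
      then show "cnj (hermite_coeff \<alpha> h) * (LBINT x. (f x - ?p x) * chermite \<alpha> x) = 0"
        by (simp add: hermite_coeff_eq_0_iff)
    qed
    finally show ?thesis .
  qed
  then have "?P ?p" using p by blast
  then have q: "?P (eigenprojection \<mu> f)"
    unfolding eigenprojection_def by (rule someI[where P="?P"])
  have qL: "eigenprojection \<mu> f \<in> Lp_space 2" using q eigenspace_L2 by blast
  then show "eigenprojection \<mu> f \<in> borel_measurable borel" by auto
  have "hermite_coeff \<alpha> (eigenprojection \<mu> f) = hermite_coeff \<alpha> f" if "\<alpha> \<in> hermite_level \<mu>" for \<alpha>
    using q chermite_in_eigenspace[of \<alpha>] that L2_inner_diff_chermite_eq_0_iff[OF f qL]
    by (auto simp: hermite_level_def)
  then have "hermite_projection \<mu> (eigenprojection \<mu> f) = ?p"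
    by (auto simp: hermite_projection_def fun_eq_iff)
  then show "AE x in lborel. eigenprojection \<mu> f x = ?p x"
    using eigenspace_AE_eq[OF conjunct1[OF q]] by (simp only:)
qed

text \<open>If only finitely many Hermite terms survive, the partial sums over eigenvalues are
  eventually constant almost everywhere, and the limit is immediate. Of the alternatives in
  \<open>z\<close>, the first is met by spectral cutoffs, the second by finite Hermite sums
  \<open>f\<close>.\<close>

lemma func_calc_schwartz_eq:
  fixes f :: "'a::euclidean_space \<Rightarrow> complex"
  assumes f: "f \<in> schwartz_space" and I: "finite I" "I \<subseteq> multi_indices"
    and z: "\<And>\<alpha>. \<alpha> \<in> multi_indices \<Longrightarrow> \<alpha> \<notin> I \<Longrightarrow> F (energy \<alpha>) = 0 \<or> hermite_coeff \<alpha> f = 0"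
  shows "func_calc_schwartz F f = (\<lambda>x. \<Sum>\<alpha>\<in>I. (of_real (F (energy \<alpha>)) * hermite_coeff \<alpha> f) * chermite \<alpha> x)"
    (is "_ = ?g")
proof -
  let ?S = "\<lambda>A x. \<Sum>\<mu>\<in>A. of_real (F \<mu>) * eigenprojection \<mu> f x"
  let ?E = "eigenvalues TYPE('a)"
  have fL: "f \<in> Lp_space 2" by (rule schwartz_L2[OF f])
  note [measurable] = eigenprojection_AE_eq(1)[OF fL]
  have g: "?g \<in> schwartz_space" by (rule hermite_sum_schwartz)
  have AE_S: "AE x in lborel. ?S A x = ?g x" if A: "finite A" "energy ` I \<subseteq> A" for A
  proof -
    have "AE x in lborel. \<forall>\<mu>\<in>A. eigenprojection \<mu> f x = hermite_projection \<mu> f x"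
      using A(1) eigenprojection_AE_eq(2)[OF fL] by (intro AE_finite_allI) auto
    then show ?thesis
    proof eventually_elim
      case (elim x)
      let ?t = "\<lambda>\<alpha>. (of_real (F (energy \<alpha>)) * hermite_coeff \<alpha> f) * chermite \<alpha> x"
      have "?S A x = (\<Sum>\<mu>\<in>A. \<Sum>\<alpha>\<in>hermite_level \<mu>. ?t \<alpha>)"
        using elim by (intro sum.cong refl) (auto simp: hermite_projection_def sum_distrib_left hermite_level_def mult_ac intro!: sum.cong)
      also have "\<dots> = (\<Sum>\<alpha>\<in>(\<Union>\<mu>\<in>A. hermite_level \<mu>). ?t \<alpha>)"
        using A(1) by (subst sum.UNION_disjoint) (auto simp: finite_hermite_level, auto simp: hermite_level_def)
      also have "\<dots> = (\<Sum>\<alpha>\<in>I. ?t \<alpha>)"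
      proof (rule sum.mono_neutral_right)
        show "finite (\<Union>\<mu>\<in>A. hermite_level \<mu> :: ('a \<Rightarrow> nat) set)" using A(1) finite_hermite_level by auto
        show "I \<subseteq> (\<Union>\<mu>\<in>A. hermite_level \<mu>)" using A I by (auto simp: hermite_level_def)
        show "\<forall>\<alpha>\<in>(\<Union>\<mu>\<in>A. hermite_level \<mu>) - I. ?t \<alpha> = 0"
          using z by (fastforce simp: hermite_level_def)
      qed
      finally show ?case .
    qed
  qed
  \<comment> \<open>The filter consists of finite sets of eigenvalues, so the energies in
    \<open>I\<close> must be known to be eigenvalues.\<close>
  have ev: "eventually (\<lambda>A. finite A \<and> energy ` I \<subseteq> A) (finite_subsets_at_top ?E)"
    using I energy_in_eigenvalues
    by (auto simp: eventually_finite_subsets_at_top intro!: exI[of _ "energy ` I"])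
  have lim: "((\<lambda>A. Lp_norm 2 (\<lambda>x. k x - ?S A x)) \<longlongrightarrow> Lp_norm 2 (\<lambda>x. k x - ?g x)) (finite_subsets_at_top ?E)"
    if [measurable]: "k \<in> borel_measurable borel" for k
  proof (rule tendsto_eventually, rule eventually_mono[OF ev])
    fix A assume A: "finite A \<and> energy ` I \<subseteq> A"
    show "Lp_norm 2 (\<lambda>x. k x - ?S A x) = Lp_norm 2 (\<lambda>x. k x - ?g x)"
      using AE_S[of A] A by (intro Lp_norm_cong_AE) auto
  qed
  show ?thesis unfolding func_calc_schwartz_def
  proof (rule the_equality)
    have "Lp_norm 2 (\<lambda>x. ?g x - ?g x) = 0" by (subst L2_norm_eq_0_iff) auto
    then have "func_calc F f ?g"
      unfolding func_calc_def using fL schwartz_L2[OF g] lim[of ?g] by auto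
    then show "?g \<in> schwartz_space \<and> func_calc F f ?g" using g by simp
  next
    fix k assume k: "k \<in> schwartz_space \<and> func_calc F f k"
    then have km[measurable]: "k \<in> borel_measurable borel"
      using L2_measurable[OF schwartz_L2] by blast
    have "Lp_norm 2 (\<lambda>x. k x - ?g x) = 0"
      using k lim[OF km] tendsto_unique[of "finite_subsets_at_top ?E"]
      unfolding func_calc_def by (auto simp: finite_subsets_at_top_neq_bot)
    then have "AE x in lborel. k x - ?g x = 0" by (subst (asm) L2_norm_eq_0_iff) auto
    then show "k = ?g"
      using k g by (intro AE_eq_continuous schwartz_continuous) auto
  qed
qed

subsection \<open>Spectral blocks of tempered distributions\<close>

lemma tempered_hermite_sum:
  assumes u: "u \<in> tempered" and I: "finite I"
  shows "u (\<lambda>x. \<Sum>\<alpha>\<in>I. c \<alpha> * chermite \<alpha> x) = (\<Sum>\<alpha>\<in>I. c \<alpha> * u (chermite \<alpha>))"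
proof -
  have lin: "u (\<lambda>x. a * f x + b * g x) = a * u f + b * u g"
    if "f \<in> schwartz_space" "g \<in> schwartz_space" for a b f g
    using u that unfolding tempered_def by blast
  show ?thesis using I
  proof induction
    case empty
    show ?case using lin[OF chermite_schwartz chermite_schwartz, of 0 _ 0] by simp
  next
    case (insert \<alpha> I)
    then show ?case
      using lin[OF chermite_schwartz[of \<alpha>] hermite_sum_schwartz[of c I], of "c \<alpha>" 1] by simp
  qed
qed

text \<open>The functional \<open>F(H) u\<close> is the function with Hermite coefficients \<open>F(energy \<alpha>) u(h\<^sub>\<alpha>) / |h\<^sub>\<alpha>|\<^sup>2\<close>.\<close>
definition dist_hermite_coeff :: "('a::euclidean_space \<Rightarrow> nat) \<Rightarrow> 'a functional \<Rightarrow> complex" where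
  "dist_hermite_coeff \<alpha> u = u (chermite \<alpha>) / of_real (hermite_sqnorm \<alpha>)"

definition hermite_synthesis :: "(real \<Rightarrow> real) \<Rightarrow> ('a::euclidean_space \<Rightarrow> nat) set \<Rightarrow> 'a functional \<Rightarrow> 'a \<Rightarrow> complex" where
  "hermite_synthesis F I u x = (\<Sum>\<alpha>\<in>I. (of_real (F (energy \<alpha>)) * dist_hermite_coeff \<alpha> u) * chermite \<alpha> x)"

lemma hermite_synthesis_rapidly_decreasing: "rapidly_decreasing (hermite_synthesis F I u)"
  unfolding hermite_synthesis_def[abs_def] by (intro schwartz_rapidly_decreasing hermite_sum_schwartz)

text \<open>The division by the squared norm moves from the coefficient of \<open>u\<close> to that
  of \<open>\<psi>\<close>: this is the symmetry of \<open>F(H)\<close> under transposition.\<close>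

lemma hermite_synthesis_integral:
  assumes "\<psi> \<in> schwartz_space"
  shows "(LBINT x. hermite_synthesis F I u x * \<psi> x) = (\<Sum>\<alpha>\<in>I. (of_real (F (energy \<alpha>)) * hermite_coeff \<alpha> \<psi>) * u (chermite \<alpha>))"
proof -
  define c where "c \<alpha> = of_real (F (energy \<alpha>)) * dist_hermite_coeff \<alpha> u" for \<alpha>
  have "integrable lborel (\<lambda>x. c \<alpha> * (chermite \<alpha> x * \<psi> x))" for \<alpha>
    by (intro integrable_mult_right schwartz_mult_integrable chermite_schwartz assms)
  then have "(LBINT x. hermite_synthesis F I u x * \<psi> x) = (\<Sum>\<alpha>\<in>I. c \<alpha> * (LBINT x. chermite \<alpha> x * \<psi> x))"
    unfolding hermite_synthesis_def c_def[symmetric] sum_distrib_right mult.assoc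
    by (subst Bochner_Integration.integral_sum) simp_all
  then show ?thesis
    by (simp add: hermite_coeff_def dist_hermite_coeff_def c_def mult_ac)
qed

lemma hermite_synthesis_represents:
  assumes "\<And>\<psi>. \<psi> \<in> schwartz_space \<Longrightarrow> v \<psi> = (\<Sum>\<alpha>\<in>I. (of_real (F (energy \<alpha>)) * hermite_coeff \<alpha> \<psi>) * u (chermite \<alpha>))"
  shows "represents (hermite_synthesis F I u) v"
  unfolding represents_def
  using assms hermite_synthesis_rapidly_decreasing[of F I u]
  by (auto simp: hermite_synthesis_integral rapidly_decreasing_mult_schwartz_integrable)

definition block_indices :: "(real \<Rightarrow> real) \<Rightarrow> int \<Rightarrow> ('a::euclidean_space \<Rightarrow> nat) set" where
  "block_indices \<phi> j = {\<alpha> \<in> multi_indices. \<phi> (2 powr (- of_int j) * sqrt (energy \<alpha>)) \<noteq> 0}"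

lemma dyadic_partition_support:
  assumes "dyadic_partition \<phi>" "\<phi> x \<noteq> 0"
  shows "x \<le> 2"
  using assms closure_subset[of "{x. \<phi> x \<noteq> 0}"] unfolding dyadic_partition_def by force

lemma block_indices_energy_le:
  assumes "dyadic_partition \<phi>" "\<alpha> \<in> block_indices \<phi> j"
  shows "sqrt (energy \<alpha>) \<le> 2 powr (of_int j + 1)"
proof -
  have "2 powr (- of_int j) * sqrt (energy \<alpha>) \<le> 2"
    using assms by (intro dyadic_partition_support[OF assms(1)]) (auto simp: block_indices_def)
  then have "2 powr of_int j * (2 powr (- of_int j) * sqrt (energy \<alpha>)) \<le> 2 powr of_int j * 2"
    by (intro mult_left_mono) auto
  then show ?thesis
    by (simp add: mult.assoc[symmetric] flip: powr_add) (simp add: powr_add)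
qed

lemma finite_block_indices:
  assumes "dyadic_partition \<phi>"
  shows "finite (block_indices \<phi> j :: ('a::euclidean_space \<Rightarrow> nat) set)"
proof (rule finite_subset[OF _ finite_energy_le[of "(2 powr (of_int j + 1))\<^sup>2"]])
  show "(block_indices \<phi> j :: ('a \<Rightarrow> nat) set) \<subseteq> {\<alpha>. \<alpha> \<in> multi_indices \<and> energy \<alpha> \<le> (2 powr (of_int j + 1))\<^sup>2}"
  proof clarify
    fix \<alpha> :: "'a \<Rightarrow> nat" assume "\<alpha> \<in> block_indices \<phi> j"
    then show "\<alpha> \<in> multi_indices \<and> energy \<alpha> \<le> (2 powr (of_int j + 1))\<^sup>2"
      using block_indices_energy_le[OF assms] sqrt_le_D by (auto simp: block_indices_def)
  qed
qed

text \<open>All energies are at least 1, beyond the reach of the cutoff. Hence the pairing over all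
  integers and the norms over \<open>j >= -1\<close> see the same blocks.\<close>

lemma block_indices_empty:
  assumes "dyadic_partition \<phi>" "j < - 1"
  shows "block_indices \<phi> j = ({} :: ('a::euclidean_space \<Rightarrow> nat) set)"
proof (rule equals0I)
  fix \<alpha> :: "'a \<Rightarrow> nat" assume "\<alpha> \<in> block_indices \<phi> j"
  then have "sqrt (energy \<alpha>) \<le> 2 powr (of_int j + 1)"
    by (rule block_indices_energy_le[OF assms(1)])
  also have "\<dots> < 2 powr 0"
    using assms(2) by (intro powr_less_mono) auto
  finally show False using energy_ge_1[of \<alpha>] by simp
qed

definition dyadic_multiplier :: "(real \<Rightarrow> real) \<Rightarrow> int \<Rightarrow> real \<Rightarrow> real" where
  "dyadic_multiplier \<phi> j \<mu> = \<phi> (2 powr (- of_int j) * sqrt \<mu>)"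

lemma block_schwartz_eq:
  assumes part: "dyadic_partition \<phi>" and \<psi>: "\<psi> \<in> schwartz_space"
  shows "func_calc_schwartz (dyadic_multiplier \<phi> j) \<psi> = (\<lambda>x. \<Sum>\<alpha>\<in>block_indices \<phi> j.
    (of_real (dyadic_multiplier \<phi> j (energy \<alpha>)) * hermite_coeff \<alpha> \<psi>) * chermite \<alpha> x)"
  by (rule func_calc_schwartz_eq[OF \<psi> finite_block_indices[OF part]])
     (auto simp: block_indices_def dyadic_multiplier_def)

lemma block_represents:
  assumes part: "dyadic_partition \<phi>" and u: "u \<in> tempered"
  shows "represents (hermite_synthesis (dyadic_multiplier \<phi> j) (block_indices \<phi> j) u) (block \<phi> j u)"
proof (rule hermite_synthesis_represents)
  fix \<psi> :: "'a \<Rightarrow> complex" assume "\<psi> \<in> schwartz_space"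
  then show "block \<phi> j u \<psi> = (\<Sum>\<alpha>\<in>block_indices \<phi> j. (of_real (dyadic_multiplier \<phi> j (energy \<alpha>)) * hermite_coeff \<alpha> \<psi>) * u (chermite \<alpha>))"
    unfolding block_def func_calc_dist_def
    by (simp only: block_schwartz_eq[OF part, unfolded dyadic_multiplier_def[abs_def]]
        dyadic_multiplier_def tempered_hermite_sum[OF u finite_block_indices[OF part]])
qed

text \<open>The transposed cutoff acts on \<open>\<psi>\<close> first, so the semigroup is evaluated
  on the finite Hermite sum \<open>g\<close> alone.\<close>

lemma block_heat_diff_represents:
  assumes part: "dyadic_partition \<phi>" and u: "u \<in> tempered"
  shows "represents (hermite_synthesis (\<lambda>\<mu>. (exp (- t * \<mu>) - 1) * dyadic_multiplier \<phi> j \<mu>) (block_indices \<phi> j) u)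
    (block \<phi> j (heat_diff t u))"
proof (rule hermite_synthesis_represents)
  fix \<psi> :: "'a \<Rightarrow> complex" assume \<psi>: "\<psi> \<in> schwartz_space"
  let ?I = "block_indices \<phi> j" and ?m = "dyadic_multiplier \<phi> j"
  have fin: "finite ?I" and sub: "?I \<subseteq> multi_indices"
    using finite_block_indices[OF part] by (auto simp: block_indices_def)
  define g where "g x = (\<Sum>\<alpha>\<in>?I. (of_real (?m (energy \<alpha>)) * hermite_coeff \<alpha> \<psi>) * chermite \<alpha> x)" for x
  have g: "func_calc_schwartz ?m \<psi> = g"
    unfolding g_def[abs_def] by (rule block_schwartz_eq[OF part \<psi>])
  have gS: "g \<in> schwartz_space" unfolding g_def[abs_def] by (rule hermite_sum_schwartz)
  have gc: "hermite_coeff \<alpha> g = (if \<alpha> \<in> ?I then of_real (?m (energy \<alpha>)) * hermite_coeff \<alpha> \<psi> else 0)"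
    if "\<alpha> \<in> multi_indices" for \<alpha>
    unfolding g_def[abs_def] by (rule hermite_coeff_sum[OF fin sub that])
  have "func_calc_schwartz (\<lambda>\<mu>. exp (- t * \<mu>)) g
      = (\<lambda>x. \<Sum>\<alpha>\<in>?I. (of_real (exp (- t * energy \<alpha>)) * hermite_coeff \<alpha> g) * chermite \<alpha> x)"
    by (rule func_calc_schwartz_eq[OF gS fin sub]) (simp add: gc)
  then have "block \<phi> j (heat_diff t u) \<psi>
      = (\<Sum>\<alpha>\<in>?I. (of_real (exp (- t * energy \<alpha>)) * hermite_coeff \<alpha> g) * u (chermite \<alpha>)) - u g"
    unfolding block_def func_calc_dist_def heat_diff_def heat_def
    using g by (simp only: tempered_hermite_sum[OF u fin] dyadic_multiplier_def[abs_def])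
  also have "u g = (\<Sum>\<alpha>\<in>?I. (of_real (?m (energy \<alpha>)) * hermite_coeff \<alpha> \<psi>) * u (chermite \<alpha>))"
    unfolding g_def[abs_def] by (rule tempered_hermite_sum[OF u fin])
  also have "(\<Sum>\<alpha>\<in>?I. (of_real (exp (- t * energy \<alpha>)) * hermite_coeff \<alpha> g) * u (chermite \<alpha>))
      - (\<Sum>\<alpha>\<in>?I. (of_real (?m (energy \<alpha>)) * hermite_coeff \<alpha> \<psi>) * u (chermite \<alpha>))
      = (\<Sum>\<alpha>\<in>?I. (of_real ((exp (- t * energy \<alpha>) - 1) * ?m (energy \<alpha>)) * hermite_coeff \<alpha> \<psi>) * u (chermite \<alpha>))"
    unfolding sum_subtractf[symmetric]
    by (intro sum.cong refl) (use sub gc in \<open>auto simp: algebra_simps subset_iff\<close>)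
  finally show "block \<phi> j (heat_diff t u) \<psi> = (\<Sum>\<alpha>\<in>?I. (of_real ((exp (- t * energy \<alpha>) - 1) * ?m (energy \<alpha>)) * hermite_coeff \<alpha> \<psi>) * u (chermite \<alpha>))" .
qed

subsection \<open>The Mehler kernel\<close>

text \<open>Never evaluated: only the ratio of two masses enters, and a dilation supplies
  it.\<close>

definition gaussian_mass :: "'a::euclidean_space itself \<Rightarrow> real \<Rightarrow> real" where
  "gaussian_mass _ k = (LBINT x. exp (- k * (norm (x::'a))\<^sup>2))"

lemma integrable_gaussian:
  "0 < k \<Longrightarrow> integrable lborel (\<lambda>x::'a::euclidean_space. exp (- k * (norm x)\<^sup>2))"
  by (rule rapidly_decreasing_integrable[OF exp_neg_norm_rapidly_decreasing])

lemma gaussian_mass_pos: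
  assumes "0 < k"
  shows "0 < gaussian_mass TYPE('a::euclidean_space) k"
proof -
  have "gaussian_mass TYPE('a) k \<noteq> 0"
    unfolding gaussian_mass_def using integrable_gaussian[OF assms, where 'a='a]
    by (subst integral_nonneg_eq_0_iff_AE) (auto simp: ae_filter_eq_bot_iff trivial_limit_def[symmetric])
  moreover have "0 \<le> gaussian_mass TYPE('a) k" by (simp add: gaussian_mass_def)
  ultimately show ?thesis by simp
qed

lemma gaussian_mass_scale:
  assumes "0 < r"
  shows "gaussian_mass TYPE('a::euclidean_space) k = r ^ DIM('a) * gaussian_mass TYPE('a) (k * r\<^sup>2)"
proof -
  have "gaussian_mass TYPE('a) k
     = (\<integral>x. exp (- k * (norm (x::'a))\<^sup>2) \<partial>density (distr lborel borel (\<lambda>x. 0 + r *\<^sub>R x)) (\<lambda>_. ennreal (\<bar>r\<bar> ^ DIM('a))))"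
    unfolding gaussian_mass_def using lborel_affine[of r "0::'a"] assms by simp
  also have "\<dots> = (LBINT x. r ^ DIM('a) *\<^sub>R exp (- k * (norm (r *\<^sub>R (x::'a)))\<^sup>2))"
    using assms by (subst integral_density; (subst integral_distr)?) auto
  also have "\<dots> = r ^ DIM('a) * gaussian_mass TYPE('a) (k * r\<^sup>2)"
    by (simp add: gaussian_mass_def power_mult_distrib mult.assoc)
  finally show ?thesis .
qed

definition heat_density :: "real \<Rightarrow> 'a::euclidean_space \<Rightarrow> real" where
  "heat_density t z = exp (- (1 / (2 * sinh (2 * t))) * (norm z)\<^sup>2) / gaussian_mass TYPE('a) (1 / (2 * sinh (2 * t)))"

text \<open>
  The Mehler kernel of \<open>exp (- t H)\<close>, factored as a Gaussian probability density in \<open>x - y\<close>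
  between two multipliers that are at most 1.
\<close>
definition mehler :: "real \<Rightarrow> 'a::euclidean_space \<Rightarrow> 'a \<Rightarrow> real" where
  "mehler t x y = exp (- (tanh t / 2) * (norm x)\<^sup>2) * heat_density t (x - y) * exp (- (tanh t / 2) * (norm y)\<^sup>2)"

lemma tanh_eq_cosh_double:
  fixes t :: real
  assumes "0 < t"
  shows "tanh t = (cosh (2 * t) - 1) / sinh (2 * t)"
proof -
  have "cosh (2 * t) - 1 = 2 * (sinh t)\<^sup>2"
    using cosh_square_eq[of t] by (simp add: cosh_double)
  then show ?thesis
    using assms by (simp add: sinh_double tanh_def power2_eq_square)
qed

text \<open>The factored form serves the estimates, this symmetric exponent the computations. They
  agree by the half-angle identity for \<open>tanh\<close>.\<close>

lemma mehler_eq: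
  fixes x y :: "'a::euclidean_space"
  assumes t: "0 < t"
  shows "mehler t x y = exp (- (cosh (2 * t) / (2 * sinh (2 * t))) * ((norm x)\<^sup>2 + (norm y)\<^sup>2) + (x \<bullet> y) / sinh (2 * t))
    / gaussian_mass TYPE('a) (1 / (2 * sinh (2 * t)))"
proof -
  have s: "0 < sinh (2 * t)" using t by simp
  have "- (tanh t / 2) * (norm x)\<^sup>2 + - (1 / (2 * sinh (2 * t))) * (norm (x - y))\<^sup>2 + - (tanh t / 2) * (norm y)\<^sup>2
    = - (cosh (2 * t) / (2 * sinh (2 * t))) * ((norm x)\<^sup>2 + (norm y)\<^sup>2) + (x \<bullet> y) / sinh (2 * t)"
  proof -
    have n: "(norm (x - y))\<^sup>2 = (norm x)\<^sup>2 + (norm y)\<^sup>2 - 2 * (x \<bullet> y)"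
      by (simp add: power2_norm_eq_inner inner_diff_left inner_diff_right inner_commute)
    show ?thesis unfolding n tanh_eq_cosh_double[OF t] using s by (simp add: field_simps)
  qed
  then show ?thesis
    unfolding mehler_def heat_density_def by (simp only: exp_add[symmetric] times_divide_eq_right times_divide_eq_left)
qed

lemma heat_density_nonneg: "0 < t \<Longrightarrow> 0 \<le> heat_density t z"
  unfolding heat_density_def using gaussian_mass_pos[of "1 / (2 * sinh (2 * t))", where 'a='a] by simp

lemma heat_density_integrable:
  assumes "0 < t"
  shows "integrable lborel (heat_density t :: 'a::euclidean_space \<Rightarrow> real)"
    "(LBINT z. heat_density t (z::'a)) = 1"
  using assms gaussian_mass_pos[of "1 / (2 * sinh (2 * t))", where 'a='a] integrable_gaussian[of "1 / (2 * sinh (2 * t))", where 'a='a]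
  unfolding heat_density_def[abs_def] gaussian_mass_def by auto

lemma heat_density_measurable[measurable]: "heat_density t \<in> borel_measurable borel"
  unfolding heat_density_def[abs_def] by measurable

lemma mehler_measurable[measurable]:
  assumes [measurable]: "f \<in> borel_measurable M" "g \<in> borel_measurable M"
  shows "(\<lambda>w. mehler t (f w) (g w)) \<in> borel_measurable M"
  unfolding mehler_def by measurable

lemma mehler_le:
  assumes "0 < t"
  shows "0 \<le> mehler t x y" "mehler t x y \<le> heat_density t (x - y)"
proof -
  have h: "0 \<le> heat_density t (x - y)" by (rule heat_density_nonneg[OF assms])
  then show "0 \<le> mehler t x y" by (simp add: mehler_def)
  have e: "exp (- (tanh t / 2) * (norm z)\<^sup>2) \<le> 1" for z :: 'a using assms by simp
  have "mehler t x y \<le> 1 * heat_density t (x - y) * 1"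
    unfolding mehler_def by (intro mult_mono e order_refl) (use h in auto)
  then show "mehler t x y \<le> heat_density t (x - y)" by simp
qed

lemma mehler_bounded:
  fixes x y :: "'a::euclidean_space"
  assumes "0 < t"
  shows "\<bar>mehler t x y\<bar> \<le> 1 / gaussian_mass TYPE('a) (1 / (2 * sinh (2 * t)))"
proof -
  have "heat_density t (x - y) \<le> 1 / gaussian_mass TYPE('a) (1 / (2 * sinh (2 * t)))"
    unfolding heat_density_def using assms gaussian_mass_pos[of "1 / (2 * sinh (2 * t))", where 'a='a]
    by (intro divide_right_mono) auto
  then show ?thesis using mehler_le[OF assms, of x y] by linarith
qed

lemma mehler_mult_integrable:
  fixes f :: "'a::euclidean_space \<Rightarrow> real"
  assumes "0 < t" "rapidly_decreasing f"
  shows "integrable lborel (\<lambda>y. mehler t x y * f y)"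
  by (rule rapidly_decreasing_integrable[OF rapidly_decreasing_mult_bounded[OF assms(2)]])
     (use mehler_bounded[OF assms(1)] in auto)

lemma mehler_integral_hermite_0:
  fixes x :: "'a::euclidean_space"
  assumes t: "0 < t"
  shows "(LBINT y. mehler t x y * exp (- (norm y)\<^sup>2 / 2)) = exp (- t * DIM('a)) * exp (- (norm x)\<^sup>2 / 2)"
proof -
  let ?s = "sinh (2 * t)" and ?Z = "gaussian_mass TYPE('a)"
  have s: "0 < ?s" using t by simp
  \<comment> \<open>\<open>k\<close> is the coefficient of \<open>|y|^2\<close> in the joint
    exponent, that is \<open>coth (2 t) / 2 + 1 / 2\<close>; \<open>w\<close> is the centre obtained
    by completing the square in \<open>y\<close>.\<close>
  define k where "k = exp (2 * t) / (2 * ?s)"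
  define w where "w = exp (- 2 * t) *\<^sub>R x"
  have c: "cosh (2 * t) = exp (2 * t) - ?s" "exp (- 2 * t) = exp (2 * t) - 2 * ?s"
    by (simp_all add: sinh_def cosh_def exp_minus field_simps)
  have ee: "exp (- 2 * t) * exp (2 * t) = 1" by (simp add: exp_add[symmetric])
  have k0: "0 < k" using s by (simp add: k_def)
  have ex: "- (cosh (2 * t) / (2 * ?s)) * ((norm x)\<^sup>2 + (norm y)\<^sup>2) + (x \<bullet> y) / ?s - (norm y)\<^sup>2 / 2
      = - k * (norm (y - w))\<^sup>2 - (norm x)\<^sup>2 / 2" for y
  proof -
    have n: "(norm (y - w))\<^sup>2 = (norm y)\<^sup>2 - 2 * exp (- 2 * t) * (x \<bullet> y) + exp (- 2 * t) * exp (- 2 * t) * (norm x)\<^sup>2"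
      unfolding power2_norm_eq_inner w_def inner_diff_left inner_diff_right
      by (simp add: inner_commute)
    have "k * (norm (y - w))\<^sup>2 = (exp (2 * t) * (norm y)\<^sup>2 - 2 * (exp (- 2 * t) * exp (2 * t)) * (x \<bullet> y)
        + exp (- 2 * t) * (exp (- 2 * t) * exp (2 * t)) * (norm x)\<^sup>2) / (2 * ?s)"
      unfolding n k_def by (simp add: algebra_simps add_divide_distrib diff_divide_distrib)
    also have "\<dots> = (exp (2 * t) * (norm y)\<^sup>2 - 2 * (x \<bullet> y) + (exp (2 * t) - 2 * ?s) * (norm x)\<^sup>2) / (2 * ?s)"
      unfolding ee c(2)[symmetric] by simp
    finally show ?thesis unfolding c(1) using s by (simp add: field_simps)
  qed
  have e: "exp A / Z * exp (- n / 2) = exp (A - n / 2) / Z" "exp (A - n / 2) / Z = exp A * (exp (- n / 2) / Z)" for A Z n :: real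
  proof -
    have "exp (A - n / 2) = exp A * exp (- n / 2)" by (simp add: exp_add[symmetric])
    then show "exp A / Z * exp (- n / 2) = exp (A - n / 2) / Z" "exp (A - n / 2) / Z = exp A * (exp (- n / 2) / Z)"
      by simp_all
  qed
  have "(LBINT y. mehler t x y * exp (- (norm y)\<^sup>2 / 2))
      = (LBINT y. exp (- k * (norm (y - w))\<^sup>2) * (exp (- (norm x)\<^sup>2 / 2) / ?Z (1 / (2 * ?s))))"
  proof (rule Bochner_Integration.integral_cong[OF refl])
    fix y
    have "mehler t x y * exp (- (norm y)\<^sup>2 / 2)
      = exp (- (cosh (2 * t) / (2 * ?s)) * ((norm x)\<^sup>2 + (norm y)\<^sup>2) + (x \<bullet> y) / ?s - (norm y)\<^sup>2 / 2) / ?Z (1 / (2 * ?s))"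
      unfolding mehler_eq[OF t] by (rule e(1))
    also have "\<dots> = exp (- k * (norm (y - w))\<^sup>2) * (exp (- (norm x)\<^sup>2 / 2) / ?Z (1 / (2 * ?s)))"
      unfolding ex by (rule e(2))
    finally show "mehler t x y * exp (- (norm y)\<^sup>2 / 2) = exp (- k * (norm (y - w))\<^sup>2) * (exp (- (norm x)\<^sup>2 / 2) / ?Z (1 / (2 * ?s)))" .
  qed
  also have "\<dots> = ?Z k * (exp (- (norm x)\<^sup>2 / 2) / ?Z (1 / (2 * ?s)))"
    using lborel_integral_translate[of "\<lambda>y. exp (- k * (norm y)\<^sup>2)" "- w"] by (simp add: gaussian_mass_def)
  \<comment> \<open>Dilation by \<open>exp t\<close> turns one Gaussian rate into the other; this is
    the source of the eigenvalue factor \<open>exp (- t * DIM('a))\<close>.\<close>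
  also have "?Z (1 / (2 * ?s)) = exp t ^ DIM('a) * ?Z k"
  proof -
    have "1 / (2 * ?s) * (exp t)\<^sup>2 = k" by (simp add: k_def exp_double[symmetric] power2_eq_square flip: exp_add)
    then show ?thesis using gaussian_mass_scale[of "exp t" "1 / (2 * ?s)", where 'a='a] by simp
  qed
  also have "?Z k * (exp (- (norm x)\<^sup>2 / 2) / (exp t ^ DIM('a) * ?Z k)) = exp (- t * DIM('a)) * exp (- (norm x)\<^sup>2 / 2)"
    using gaussian_mass_pos[OF k0, where 'a='a]
    by (simp add: exp_minus divide_simps exp_of_nat_mult[symmetric] mult.commute)
  finally show ?thesis .
qed

lemma mehler_has_derivative:
  fixes x y :: "'a::euclidean_space"
  assumes t: "0 < t"
  shows "((\<lambda>y. mehler t x y) has_derivative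
    (\<lambda>v. mehler t x y * ((x \<bullet> v) / sinh (2 * t) - cosh (2 * t) / sinh (2 * t) * (y \<bullet> v)))) (at y)"
proof -
  have *: "((\<lambda>y. exp (- A * (c + y \<bullet> y) + B * (x \<bullet> y)) * Z) has_derivative
      (\<lambda>v. exp (- A * (c + y \<bullet> y) + B * (x \<bullet> y)) * Z * (B * (x \<bullet> v) - 2 * A * (y \<bullet> v)))) (at y)" for A B c Z
    by (auto intro!: derivative_eq_intros simp: fun_eq_iff inner_commute algebra_simps)
  define A B Z where "A = cosh (2 * t) / (2 * sinh (2 * t))" and "B = 1 / sinh (2 * t)"
    and "Z = 1 / gaussian_mass TYPE('a) (1 / (2 * sinh (2 * t)))"
  have m: "mehler t x y = exp (- A * ((norm x)\<^sup>2 + y \<bullet> y) + B * (x \<bullet> y)) * Z" for y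
    unfolding mehler_eq[OF t] A_def B_def Z_def by (simp add: power2_norm_eq_inner)
  have "B * r - 2 * A * q = r / sinh (2 * t) - cosh (2 * t) / sinh (2 * t) * q" for r q
    by (simp add: A_def B_def)
  then show ?thesis unfolding m using *[of A "(norm x)\<^sup>2" B Z] by simp
qed

text \<open>
  Integration by parts in \<open>y\<close> turns the three-term recurrence of the Hermite functions into one
  for their integrals against the kernel.
\<close>
lemma mehler_integral_hermite:
  fixes x :: "'a::euclidean_space"
  assumes t: "0 < t"
  shows "(LBINT y. mehler t x y * hermite \<alpha> y) = exp (- t * energy \<alpha>) * hermite \<alpha> x"
proof (induction "\<Sum>b\<in>(Basis::'a set). \<alpha> b" arbitrary: \<alpha> rule: less_induct)
  case less
  show ?case
  proof (cases "\<forall>b\<in>Basis. \<alpha> b = 0")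
    case True
    have "hermite \<alpha> y = exp (- (norm y)\<^sup>2 / 2)" for y
    proof -
      have "hermite \<alpha> y = (\<Prod>b\<in>Basis. exp (- (y \<bullet> b)\<^sup>2 / 2))"
        unfolding hermite_def using True by (intro prod.cong refl) (simp add: hermite1_def)
      then show ?thesis
        unfolding norm_power2_eq_sum by (simp add: exp_sum[symmetric] sum_negf sum_divide_distrib)
    qed
    moreover have "energy \<alpha> = DIM('a)" using True by (simp add: energy_def)
    ultimately show ?thesis using mehler_integral_hermite_0[OF t, of x] by simp
  next
    case False
    then obtain b where b: "b \<in> Basis" "\<alpha> b \<noteq> 0" by blast
    then obtain n where n: "\<alpha> b = Suc n" by (cases "\<alpha> b") auto
    \<comment> \<open>Only coordinate \<open>b\<close> moves. \<open>T m\<close> is the integral in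
      question and \<open>E m\<close> its expected factor; \<open>T (Suc n)\<close> is
      wanted.\<close>
    define H where "H m = hermite (\<alpha>(b := m))" for m
    define T where "T m = (LBINT y. mehler t x y * H m y)" for m
    define E where "E m = exp (- t * energy (\<alpha>(b := m)))" for m
    let ?s = "sinh (2 * t)" and ?c = "cosh (2 * t) / sinh (2 * t)"
    have s: "0 < ?s" using t by simp
    have sum_upd: "(\<Sum>a\<in>Basis. (\<alpha>(b := m)) a) = m + (\<Sum>a\<in>Basis - {b}. \<alpha> a)" for m
    proof -
      have "(\<Sum>a\<in>Basis - {b}. (\<alpha>(b := m)) a) = (\<Sum>a\<in>Basis - {b}. \<alpha> a)"
        by (intro sum.cong) auto
      then show ?thesis using b by (subst sum.remove[OF finite_Basis b(1)]) simp
    qed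
    have IH: "T m = E m * H m x" if "m \<le> n" for m
      unfolding T_def E_def H_def
    proof (rule less.hyps)
      have "\<alpha>(b := Suc n) = \<alpha>" using n by auto
      then have "(\<Sum>a\<in>Basis. \<alpha> a) = Suc n + (\<Sum>a\<in>Basis - {b}. \<alpha> a)"
        using sum_upd[of "Suc n"] by simp
      then show "(\<Sum>a\<in>Basis. (\<alpha>(b := m)) a) < (\<Sum>a\<in>Basis. \<alpha> a)"
        using that unfolding sum_upd by simp
    qed
    have E_Suc: "E (Suc m) = exp (- 2 * t) * E m" for m
      unfolding E_def exp_add[symmetric] energy_def sum_upd by (simp add: algebra_simps)
    have Hr: "rapidly_decreasing (H m)" for m
      unfolding H_def by (rule hermite_rapidly_decreasing)
    have rec: "(z \<bullet> b) * H m z = H (Suc m) z / 2 + real m * H (m - 1) z" for m z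
      unfolding H_def by (rule mult_hermite[OF b(1)])
    have iT: "integrable lborel (\<lambda>y. mehler t x y * H m y)" for m
      by (rule mehler_mult_integrable[OF t Hr])
    have iyT: "integrable lborel (\<lambda>y. mehler t x y * ((y \<bullet> b) * H m y))" for m
      unfolding rec distrib_left using iT[of "Suc m"] iT[of "m - 1"]
      by (intro Bochner_Integration.integrable_add) (simp_all add: mult.left_commute)
    have yT: "(LBINT y. mehler t x y * ((y \<bullet> b) * H m y)) = T (Suc m) / 2 + real m * T (m - 1)" for m
      unfolding rec distrib_left T_def using iT[of "Suc m"] iT[of "m - 1"]
      by (subst Bochner_Integration.integral_add) (simp_all add: mult.left_commute)
    \<comment> \<open>Integration by parts of \<open>H n\<close> against the kernel: apart from
      \<open>T n\<close> and \<open>T (n - 1)\<close>, both sides involve only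
      \<open>T (Suc n)\<close>.\<close>
    have "(LBINT y. mehler t x y * (real n * H (n - 1) y - H (Suc n) y / 2))
        = - (LBINT y. mehler t x y * ((x \<bullet> b) / ?s - ?c * (y \<bullet> b)) * H n y)"
    proof -
      have d: "(H n has_derivative (\<lambda>v. \<Sum>a\<in>Basis. (v \<bullet> a) * hermite_partial a (\<alpha>(b := n)) y)) (at y)" for y
        unfolding H_def by (rule hermite_has_derivative)
      have p: "(\<Sum>a\<in>Basis. (b \<bullet> a) * hermite_partial a (\<alpha>(b := n)) y) = real n * H (n - 1) y - H (Suc n) y / 2" for y
        by (simp add: sum_inner_Basis_mult[OF b(1)] hermite_partial_def H_def)
      have cH: "continuous_on UNIV (H m)" for m unfolding H_def by (rule continuous_on_hermite)
      have cm: "continuous_on UNIV (\<lambda>y. mehler t x y)"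
        by (intro continuous_at_imp_continuous_on ballI has_derivative_continuous[OF mehler_has_derivative[OF t]])
      have "integrable lborel (\<lambda>y. (x \<bullet> b) / ?s * (mehler t x y * H n y) - ?c * (mehler t x y * ((y \<bullet> b) * H n y)))"
        by (intro Bochner_Integration.integrable_diff integrable_mult_right iT iyT)
      then have i1: "integrable lborel (\<lambda>y. mehler t x y * ((x \<bullet> b) / ?s - ?c * (y \<bullet> b)) * H n y)"
        by (rule back_subst[where P="integrable lborel"]) (simp add: fun_eq_iff algebra_simps)
      have "integrable lborel (\<lambda>y. real n * (mehler t x y * H (n - 1) y) - (mehler t x y * H (Suc n) y) / 2)"
        by (intro Bochner_Integration.integrable_diff integrable_mult_right integrable_divide iT)
      then have i2: "integrable lborel (\<lambda>y. mehler t x y * (real n * H (n - 1) y - H (Suc n) y / 2))"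
        by (rule back_subst[where P="integrable lborel"]) (simp add: fun_eq_iff algebra_simps)
      have "(LBINT y. mehler t x y * (\<Sum>a\<in>Basis. (b \<bullet> a) * hermite_partial a (\<alpha>(b := n)) y))
        = - (LBINT y. mehler t x y * ((x \<bullet> b) / ?s - ?c * (y \<bullet> b)) * H n y)"
        by (rule integral_by_parts_euclidean[OF mehler_has_derivative[OF t] _ d])
           (use t i1 i2 iT in \<open>auto simp: p intro!: continuous_intros cH cm\<close>)
      then show ?thesis unfolding p .
    qed
    also have "(LBINT y. mehler t x y * ((x \<bullet> b) / ?s - ?c * (y \<bullet> b)) * H n y)
        = (LBINT y. (x \<bullet> b) / ?s * (mehler t x y * H n y) - ?c * (mehler t x y * ((y \<bullet> b) * H n y)))"
      by (intro Bochner_Integration.integral_cong refl) (simp add: algebra_simps)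
    also have "\<dots> = (x \<bullet> b) / ?s * T n - ?c * (T (Suc n) / 2 + real n * T (n - 1))"
      by (subst Bochner_Integration.integral_diff[OF integrable_mult_right[OF iT] integrable_mult_right[OF iyT]])
         (simp only: integral_mult_right_zero yT T_def[symmetric])
    also have "(LBINT y. mehler t x y * (real n * H (n - 1) y - H (Suc n) y / 2))
        = (LBINT y. real n * (mehler t x y * H (n - 1) y) - (mehler t x y * H (Suc n) y) / 2)"
      by (intro Bochner_Integration.integral_cong refl) (simp add: algebra_simps)
    also have "\<dots> = real n * T (n - 1) - T (Suc n) / 2"
      by (subst Bochner_Integration.integral_diff[OF integrable_mult_right[OF iT] integrable_divide[OF iT]])
         (simp add: T_def)
    finally have key: "real n * T (n - 1) - T (Suc n) / 2 = - ((x \<bullet> b) / ?s * T n - ?c * (T (Suc n) / 2 + real n * T (n - 1)))" .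
    \<comment> \<open>The factor \<open>real n\<close> takes care of \<open>n = 0\<close>, where
      \<open>n - 1\<close> is not a predecessor.\<close>
    have nT: "real n * T (n - 1) * exp (- 2 * t) = real n * E n * H (n - 1) x"
      using IH[of "n - 1"] E_Suc[of "n - 1"] by (cases n) simp_all
    have "(?s + cosh (2 * t)) * T (Suc n) = 2 * ((?s - cosh (2 * t)) * (real n * T (n - 1)) + (x \<bullet> b) * T n)"
    proof -
      have "?s * (real n * T (n - 1) - T (Suc n) / 2) = - ((x \<bullet> b) * T n - cosh (2 * t) * (T (Suc n) / 2 + real n * T (n - 1)))"
        unfolding key using t by (simp add: right_diff_distrib)
      then show ?thesis by (simp add: algebra_simps)
    qed
    \<comment> \<open>With this factor the two terms in \<open>H (n - 1) x\<close> cancel, and on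
      the left \<open>?s + cosh (2 * t)\<close> is \<open>exp (2 * t)\<close>.\<close>
    also have "?s - cosh (2 * t) = - exp (- 2 * t)"
      using cosh_minus_sinh[of "2 * t"] by simp
    also have "- exp (- 2 * t) * (real n * T (n - 1)) = - (real n * E n * H (n - 1) x)"
      using nT by (simp add: mult.commute)
    also have "(x \<bullet> b) * T n = E n * (H (Suc n) x / 2 + real n * H (n - 1) x)"
      unfolding IH[OF order_refl] rec[symmetric] by simp
    finally have "exp (2 * t) * T (Suc n) = E n * H (Suc n) x"
      unfolding sinh_plus_cosh by (simp add: algebra_simps)
    then have "T (Suc n) = exp (- 2 * t) * (E n * H (Suc n) x)"
      by (simp add: exp_minus field_simps)
    then have "T (Suc n) = E (Suc n) * H (Suc n) x" by (simp add: E_Suc)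
    moreover have "\<alpha>(b := Suc n) = \<alpha>" using n by auto
    ultimately show ?thesis by (simp add: T_def E_def H_def)
  qed
qed

subsection \<open>Lebesgue norms\<close>

lemma enn2real_ge_1: "1 \<le> p \<Longrightarrow> p \<noteq> \<infinity> \<Longrightarrow> 1 \<le> enn2real p"
  by (cases p) auto

lemma ennpowr_mono: "x \<le> y \<Longrightarrow> 0 \<le> r \<Longrightarrow> ennpowr x r \<le> ennpowr y r"
  by (cases x; cases y) (auto simp: ennpowr_def powr_mono2 ennreal_leI top_unique)

lemma ennpowr_mult: "0 \<le> a \<Longrightarrow> ennpowr (ennreal a * x) r = ennreal (a powr r) * ennpowr x r"
  by (cases x; cases "a = 0")
     (auto simp: ennpowr_def ennreal_mult'[symmetric] powr_mult ennreal_mult_eq_top_iff ennreal_mult_top)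

lemma ennpowr_ennpowr_inverse: "0 < r \<Longrightarrow> ennpowr (ennpowr x (1 / r)) r = x"
  by (cases x) (auto simp: ennpowr_def powr_powr)

lemma ennpowr_tendsto_0:
  assumes f: "(f \<longlongrightarrow> 0) F" and r: "0 < r"
  shows "((\<lambda>x. ennpowr (f x) r) \<longlongrightarrow> 0) F"
proof -
  have "((\<lambda>x. enn2real (f x)) \<longlongrightarrow> 0) F"
    using tendsto_enn2real[of f 0 F] f by simp
  then have "((\<lambda>x. enn2real (f x) powr r) \<longlongrightarrow> 0) F"
    using r by (intro tendsto_zero_powrI) auto
  then have "((\<lambda>x. ennreal (enn2real (f x) powr r)) \<longlongrightarrow> 0) F"
    using tendsto_ennrealI by fastforce
  moreover have "eventually (\<lambda>x. f x < top) F"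
    using f by (rule order_tendstoD) simp
  ultimately show ?thesis
    by (elim Lim_transform_eventually) (auto simp: ennpowr_def elim: eventually_mono)
qed

lemma Lp_norm_infinity: "Lp_norm \<infinity> f = esssup lborel (\<lambda>x. ennreal (norm (f x)))"
  by (simp add: Lp_norm_def lebesgue_norm_def)

lemma Lp_norm_infinity_AE: "AE x in lborel. ennreal (norm (f x)) \<le> Lp_norm \<infinity> f"
  unfolding Lp_norm_infinity by (rule esssup_AE)

lemma Lp_norm_le_mult:
  assumes p: "1 \<le> p" and c: "0 \<le> c" and [measurable]: "f \<in> borel_measurable borel" "g \<in> borel_measurable borel"
    and le: "\<And>x. norm (f x) \<le> c * norm (g x)"
  shows "Lp_norm p f \<le> ennreal c * Lp_norm p g"
proof (cases "p = \<infinity>")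
  case True
  have "AE x in lborel. ennreal (norm (f x)) \<le> ennreal c * Lp_norm \<infinity> g"
    using Lp_norm_infinity_AE[of g]
  proof eventually_elim
    case (elim x)
    have "ennreal (norm (f x)) \<le> ennreal c * ennreal (norm (g x))"
      using le c by (simp add: ennreal_mult'[symmetric])
    also have "\<dots> \<le> ennreal c * Lp_norm \<infinity> g" using elim by (rule mult_left_mono) simp
    finally show ?case .
  qed
  then show ?thesis unfolding True Lp_norm_infinity by (intro esssup_I) auto
next
  case False
  define r where "r = enn2real p"
  have r: "1 \<le> r" using enn2real_ge_1[OF p False] by (simp add: r_def)
  have "(\<integral>\<^sup>+x. ennreal (norm (f x) powr r) \<partial>lborel) \<le> (\<integral>\<^sup>+x. ennreal (c powr r) * ennreal (norm (g x) powr r) \<partial>lborel)"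
  proof (rule nn_integral_mono)
    fix x
    have "norm (f x) powr r \<le> (c * norm (g x)) powr r" using r le by (intro powr_mono2) auto
    then show "ennreal (norm (f x) powr r) \<le> ennreal (c powr r) * ennreal (norm (g x) powr r)"
      using c by (simp add: powr_mult ennreal_mult'[symmetric] ennreal_leI)
  qed
  also have "\<dots> = ennreal (c powr r) * (\<integral>\<^sup>+x. ennreal (norm (g x) powr r) \<partial>lborel)"
    by (rule nn_integral_cmult) measurable
  finally have "ennpowr (\<integral>\<^sup>+x. ennreal (norm (f x) powr r) \<partial>lborel) (1 / r)
      \<le> ennpowr (ennreal (c powr r) * (\<integral>\<^sup>+x. ennreal (norm (g x) powr r) \<partial>lborel)) (1 / r)"
    using r by (intro ennpowr_mono) auto
  also have "\<dots> = ennreal c * ennpowr (\<integral>\<^sup>+x. ennreal (norm (g x) powr r) \<partial>lborel) (1 / r)"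
    using r c by (simp add: ennpowr_mult powr_powr)
  finally show ?thesis using False by (simp add: Lp_norm_eq_nn_integral r_def)
qed

text \<open>\<open>|f - g|^r <= 2^r (|f|^r + |g|^r)\<close> gives the factor
  \<open>2 * 2^(1/r)\<close>, at most 4 for every \<open>r >= 1\<close>. Domination in
  \<open>j\<close> asks only for some constant.\<close>

lemma Lp_norm_diff_le:
  assumes p: "1 \<le> p" and [measurable]: "f \<in> borel_measurable borel" "g \<in> borel_measurable borel"
    and le: "Lp_norm p g \<le> Lp_norm p f"
  shows "Lp_norm p (\<lambda>x. f x - g x) \<le> 4 * Lp_norm p f"
proof (cases "p = \<infinity>")
  case True
  have "AE x in lborel. ennreal (norm (f x - g x)) \<le> 4 * Lp_norm \<infinity> f"
    using Lp_norm_infinity_AE[of f] Lp_norm_infinity_AE[of g]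
  proof eventually_elim
    case (elim x)
    have "ennreal (norm (f x - g x)) \<le> ennreal (norm (f x)) + ennreal (norm (g x))"
      by (simp add: norm_triangle_ineq4 ennreal_leI flip: ennreal_plus)
    also have "\<dots> \<le> Lp_norm \<infinity> f + Lp_norm \<infinity> f"
      using elim le True by (intro add_mono) (auto intro: order_trans)
    also have "\<dots> = 2 * Lp_norm \<infinity> f" by (simp add: mult_2)
    also have "\<dots> \<le> 4 * Lp_norm \<infinity> f" by (intro mult_right_mono) auto
    finally show ?case .
  qed
  then show ?thesis unfolding True Lp_norm_infinity by (intro esssup_I) auto
next
  case False
  define r where "r = enn2real p"
  have r: "1 \<le> r" using enn2real_ge_1[OF p False] by (simp add: r_def)
  let ?I = "\<lambda>h. \<integral>\<^sup>+x. ennreal (norm (h x :: complex) powr r) \<partial>lborel"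
  have N: "Lp_norm p h = ennpowr (?I h) (1 / r)" for h :: "'a \<Rightarrow> complex"
    using False by (simp add: Lp_norm_eq_nn_integral r_def)
  have r0: "0 < r" using r by simp
  have I: "?I g \<le> ?I f"
    using ennpowr_mono[OF le[unfolded N] less_imp_le[OF r0]]
    by (simp only: ennpowr_ennpowr_inverse[OF r0])
  have "?I (\<lambda>x. f x - g x) \<le> (\<integral>\<^sup>+x. ennreal (2 powr r) * (ennreal (norm (f x) powr r) + ennreal (norm (g x) powr r)) \<partial>lborel)"
  proof (rule nn_integral_mono)
    fix x
    have "norm (f x - g x) \<le> 2 * max (norm (f x)) (norm (g x))"
      using norm_triangle_ineq4[of "f x" "g x"] by linarith
    then have "norm (f x - g x) powr r \<le> (2 * max (norm (f x)) (norm (g x))) powr r"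
      using r by (intro powr_mono2) auto
    also have "\<dots> \<le> 2 powr r * (norm (f x) powr r + norm (g x) powr r)"
      by (simp add: powr_mult max_def)
    finally show "ennreal (norm (f x - g x) powr r) \<le> ennreal (2 powr r) * (ennreal (norm (f x) powr r) + ennreal (norm (g x) powr r))"
      by (simp add: ennreal_mult'[symmetric] ennreal_leI flip: ennreal_plus)
  qed
  also have "\<dots> = ennreal (2 powr r) * (?I f + ?I g)"
    by (subst nn_integral_cmult; (subst nn_integral_add)?) auto
  also have "\<dots> \<le> ennreal (2 powr r) * (2 * ?I f)"
    using I by (intro mult_left_mono) (auto simp: mult_2)
  also have "\<dots> \<le> ennreal (4 powr r) * ?I f"
  proof -
    have "2 powr r * 2 \<le> 2 powr r * 2 powr r"
      using r powr_mono[of 1 r 2] by (intro mult_left_mono) auto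
    also have "\<dots> = 4 powr r" by (simp add: powr_mult[symmetric])
    finally have "ennreal (2 powr r) * ennreal 2 \<le> ennreal (4 powr r)"
      by (simp add: ennreal_mult'[symmetric] ennreal_leI del: ennreal_numeral)
    then show ?thesis by (simp add: mult.assoc[symmetric] mult_right_mono)
  qed
  finally have "ennpowr (?I (\<lambda>x. f x - g x)) (1 / r) \<le> ennpowr (ennreal (4 powr r) * ?I f) (1 / r)"
    using r by (intro ennpowr_mono) auto
  also have "\<dots> = ennreal 4 * ennpowr (?I f) (1 / r)"
    using r by (simp add: ennpowr_mult powr_powr del: ennreal_numeral)
  finally show ?thesis unfolding N by simp
qed

lemma rapidly_decreasing_norm_powr:
  fixes f :: "'a::euclidean_space \<Rightarrow> complex"
  assumes f: "rapidly_decreasing f" and r: "1 \<le> r"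
  shows "rapidly_decreasing (\<lambda>x. norm (f x) powr r)"
proof -
  obtain C where C: "0 \<le> C" "\<And>x. norm (f x) \<le> C" using rapidly_decreasing_bounded[OF f] by blast
  show ?thesis
  proof (rule rapidly_decreasing_mult_poly_bound[OF f, where C="C powr (r - 1)" and k=0])
    show "(\<lambda>x. norm (f x) powr r) \<in> borel_measurable borel"
      using f by (auto simp: rapidly_decreasing_def)
    fix x
    \<comment> \<open>As \<open>r >= 1\<close>, one factor \<open>norm (f x)\<close> keeps the decay
      and the remaining power is bounded.\<close>
    have "norm (f x) powr r = norm (f x) powr (r - 1) * norm (f x)"
      by (cases "f x = 0") (simp_all add: powr_diff)
    also have "\<dots> \<le> C powr (r - 1) * norm (f x)"
      using C r by (intro mult_right_mono powr_mono2) auto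
    finally show "norm (norm (f x) powr r) \<le> C powr (r - 1) * (1 + norm x) ^ 0 * norm (f x)" by simp
  qed
qed

lemma rapidly_decreasing_Lp_norm:
  fixes f :: "'a::euclidean_space \<Rightarrow> complex"
  assumes f: "rapidly_decreasing f" and r: "1 \<le> r" "p = ennreal r"
  shows "Lp_norm p f = ennreal ((LBINT x. norm (f x) powr r) powr (1 / r))"
proof -
  have "(\<integral>\<^sup>+x. ennreal (norm (f x) powr r) \<partial>lborel) = ennreal (LBINT x. norm (f x) powr r)"
    by (intro nn_integral_eq_integral rapidly_decreasing_integrable rapidly_decreasing_norm_powr f r) auto
  then show ?thesis using r by (simp add: Lp_norm_eq_nn_integral ennpowr_ennreal)
qed

lemma rapidly_decreasing_Lp:
  fixes f :: "'a::euclidean_space \<Rightarrow> complex"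
  assumes f: "rapidly_decreasing f" and p: "1 \<le> p"
  shows "Lp_norm p f < \<infinity>"
proof (cases "p = \<infinity>")
  case True
  obtain C where C: "0 \<le> C" "\<And>x. norm (f x) \<le> C" using rapidly_decreasing_bounded[OF f] by blast
  have "Lp_norm \<infinity> f \<le> ennreal C"
    unfolding Lp_norm_infinity using f C by (intro esssup_I) (auto simp: rapidly_decreasing_def ennreal_leI)
  then show ?thesis using True by (auto simp: le_less_trans)
next
  case False
  then have "1 \<le> enn2real p" "p = ennreal (enn2real p)"
    using enn2real_ge_1[OF p] by (auto simp: ennreal_enn2real_if)
  from rapidly_decreasing_Lp_norm[OF f this] show ?thesis by simp
qed

text \<open>Representing functions agree almost everywhere, so the infimum runs over one value;
  rapid decay puts \<open>U\<close> into \<open>L^p\<close>, so it is not the infimum of the empty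
  set.\<close>

lemma dist_Lp_norm_eq:
  assumes U: "represents U u" "rapidly_decreasing U" and p: "1 \<le> p"
  shows "dist_Lp_norm p u = Lp_norm p U"
proof -
  have "U \<in> Lp_space p"
    using rapidly_decreasing_Lp[OF U(2) p] U(2) by (simp add: Lp_space_def rapidly_decreasing_def)
  then have "dist_Lp_norm p u \<le> Lp_norm p U"
    unfolding dist_Lp_norm_def using U(1) by (intro Inf_lower CollectI exI[of _ U]) simp
  moreover have "Lp_norm p f = Lp_norm p U" if "represents f u" for f
    using that U represents_unique[OF that U(1)]
    by (intro Lp_norm_cong_AE) (auto simp: represents_def)
  then have "Lp_norm p U \<le> dist_Lp_norm p u"
    unfolding dist_Lp_norm_def by (intro Inf_greatest) auto
  ultimately show ?thesis by (rule antisym)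
qed

section \<open>Hoelder's inequality\<close>

lemma Holder_rapidly_decreasing_finite:
  fixes f g :: "'a::euclidean_space \<Rightarrow> complex"
  assumes f: "rapidly_decreasing f" and g: "rapidly_decreasing g"
    and r: "1 < r" "1 < r'" "1 / r + 1 / r' = 1"
  shows "(LBINT x. norm (f x) * norm (g x))
    \<le> (LBINT x. norm (f x) powr r) powr (1 / r) * (LBINT x. norm (g x) powr r') powr (1 / r')"
proof -
  define A where "A = (LBINT x. norm (f x) powr r)"
  define B where "B = (LBINT x. norm (g x) powr r')"
  have fi: "integrable lborel (\<lambda>x. norm (f x) powr r)" and gi: "integrable lborel (\<lambda>x. norm (g x) powr r')"
    using r by (auto intro!: rapidly_decreasing_integrable rapidly_decreasing_norm_powr f g)
  have fgi: "integrable lborel (\<lambda>x. norm (f x) * norm (g x))"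
    using rapidly_decreasing_integrable[OF rapidly_decreasing_mult[OF f g], THEN integrable_norm] by (simp add: norm_mult)
  have A0: "0 \<le> A" and B0: "0 \<le> B" by (simp_all add: A_def B_def)
  show ?thesis
  proof (cases "A = 0 \<or> B = 0")
    \<comment> \<open>Set apart because Young's inequality is applied after division by both
      norms.\<close>
    case True
    then have "AE x in lborel. norm (f x) * norm (g x) = 0"
    proof
      assume "A = 0"
      then have "AE x in lborel. norm (f x) powr r = 0"
        unfolding A_def using fi by (subst (asm) integral_nonneg_eq_0_iff_AE) auto
      then show ?thesis by eventually_elim simp
    next
      assume "B = 0"
      then have "AE x in lborel. norm (g x) powr r' = 0"
        unfolding B_def using gi by (subst (asm) integral_nonneg_eq_0_iff_AE) auto
      then show ?thesis by eventually_elim simp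
    qed
    then have "(LBINT x. norm (f x) * norm (g x)) = 0" by (rule integral_eq_zero_AE)
    then show ?thesis by simp
  next
    case False
    then have A: "0 < A" and B: "0 < B" using A0 B0 by auto
    define a where "a = A powr (1 / r)"
    define b where "b = B powr (1 / r')"
    have ab: "0 < a" "0 < b" "a powr r = A" "b powr r' = B"
      using A B r by (auto simp: a_def b_def powr_powr)
    have "(LBINT x. (norm (f x) / a) * (norm (g x) / b))
        \<le> (LBINT x. norm (f x) powr r / (r * A) + norm (g x) powr r' / (r' * B))"
    proof (rule integral_mono)
      show "integrable lborel (\<lambda>x. (norm (f x) / a) * (norm (g x) / b))"
        using fgi by simp
      show "integrable lborel (\<lambda>x. norm (f x) powr r / (r * A) + norm (g x) powr r' / (r' * B))"
        using fi gi by simp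
      fix x
      show "(norm (f x) / a) * (norm (g x) / b) \<le> norm (f x) powr r / (r * A) + norm (g x) powr r' / (r' * B)"
        using Youngs_inequality[of r r' "norm (f x) / a" "norm (g x) / b"] r ab
        by (simp add: powr_divide mult.commute)
    qed
    also have "\<dots> = A / (r * A) + B / (r' * B)"
      using fi gi by (simp add: A_def B_def)
    also have "\<dots> = 1" using r A B by simp
    finally have "(LBINT x. norm (f x) * norm (g x)) \<le> a * b"
      using ab by (simp add: field_simps)
    then show ?thesis by (simp add: a_def b_def A_def B_def)
  qed
qed

lemma Holder_rapidly_decreasing:
  fixes f g :: "'a::euclidean_space \<Rightarrow> complex"
  assumes f: "rapidly_decreasing f" and g: "rapidly_decreasing g"
    and p: "1 < p" "1 \<le> p'" "1 / p + 1 / p' = 1"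
  shows "ennreal (norm (LBINT x. f x * cnj (g x))) \<le> Lp_norm p f * Lp_norm p' g"
proof -
  have fgi: "integrable lborel (\<lambda>x. norm (f x) * norm (g x))"
    using rapidly_decreasing_integrable[OF rapidly_decreasing_mult[OF f g], THEN integrable_norm] by (simp add: norm_mult)
  have "norm (LBINT x. f x * cnj (g x)) \<le> (LBINT x. norm (f x * cnj (g x)))"
    by (rule integral_norm_bound)
  then have n: "norm (LBINT x. f x * cnj (g x)) \<le> (LBINT x. norm (f x) * norm (g x))"
    by (simp add: norm_mult)
  have fm[measurable]: "f \<in> borel_measurable borel" "g \<in> borel_measurable borel"
    using f g by (auto simp: rapidly_decreasing_def)
  show ?thesis
  proof (cases "p = \<infinity>")
    case True
    \<comment> \<open>In \<open>ennreal\<close> an infinite \<open>p\<close> has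
      \<open>1 / p = 0\<close>, which leaves \<open>1 / p' = 1\<close>.\<close>
    have p': "p' = 1"
    proof (cases p')
      case (real r)
      then have "0 < r" using p(2) by (cases "r = 0") auto
      moreover have "ennreal (1 / r) = ennreal 1"
        using p(3) True real \<open>0 < r\<close> by (simp add: divide_ennreal[symmetric])
      ultimately have "r = 1" by (simp del: ennreal_1)
      then show ?thesis using real by simp
    qed (use p True in auto)
    have "ennreal (LBINT x. norm (f x) * norm (g x)) = (\<integral>\<^sup>+x. ennreal (norm (f x)) * ennreal (norm (g x)) \<partial>lborel)"
      using nn_integral_eq_integral[OF fgi] by (simp add: ennreal_mult)
    also have "\<dots> \<le> (\<integral>\<^sup>+x. Lp_norm \<infinity> f * ennreal (norm (g x)) \<partial>lborel)"
    proof (rule nn_integral_mono_AE)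
      show "AE x in lborel. ennreal (norm (f x)) * ennreal (norm (g x)) \<le> Lp_norm \<infinity> f * ennreal (norm (g x))"
        using Lp_norm_infinity_AE[of f] by eventually_elim (intro mult_right_mono, auto)
    qed
    also have "\<dots> = Lp_norm \<infinity> f * (\<integral>\<^sup>+x. ennreal (norm (g x)) \<partial>lborel)"
      by (rule nn_integral_cmult) measurable
    also have "(\<integral>\<^sup>+x. ennreal (norm (g x)) \<partial>lborel) = Lp_norm p' g"
    proof -
      have "ennpowr z 1 = z" for z by (cases z) (auto simp: ennpowr_def)
      then show ?thesis unfolding p' by (subst Lp_norm_eq_nn_integral) auto
    qed
    finally show ?thesis using n True by (auto intro: order_trans ennreal_leI)
  next
    case False
    then obtain r where r: "p = ennreal r" "1 < r"
      using p(1) by (cases p) (auto simp: ennreal_less_iff simp flip: ennreal_1)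
    have ip: "1 / p = ennreal (1 / r)" using r by (simp add: divide_ennreal[symmetric])
    \<comment> \<open>Here \<open>1 < p\<close> enters: an infinite \<open>p'\<close> would force
      \<open>1 / p = 1\<close>.\<close>
    have "p' \<noteq> \<infinity>"
    proof
      assume "p' = \<infinity>"
      then have "ennreal (1 / r) = ennreal 1" using p(3) ip by simp
      then show False using r by (simp del: ennreal_1)
    qed
    then obtain r' where r': "p' = ennreal r'" "1 \<le> r'"
      using p(2) by (cases p') (auto simp flip: ennreal_1)
    have "1 / p' = ennreal (1 / r')" using r' by (simp add: divide_ennreal[symmetric])
    then have "ennreal (1 / r + 1 / r') = ennreal 1"
      using p(3) ip r r' by (simp add: ennreal_plus)
    then have rr: "1 / r + 1 / r' = 1"
      using r r' by (subst (asm) ennreal_inj) auto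
    have "r' \<noteq> 1" using rr r by auto
    then have "1 < r'" using r' by simp
    note H = Holder_rapidly_decreasing_finite[OF f g r(2) this rr]
    show ?thesis
      unfolding rapidly_decreasing_Lp_norm[OF f less_imp_le[OF r(2)] r(1)] rapidly_decreasing_Lp_norm[OF g r'(2,1)]
      using order_trans[OF n H] by (simp add: ennreal_mult'[symmetric] ennreal_leI)
  qed
qed

subsection \<open>Contractivity of the heat semigroup\<close>

lemma heat_density_translate:
  fixes x :: "'a::euclidean_space"
  assumes t: "0 < t"
  shows "integrable lborel (\<lambda>y. heat_density t (x - y))" "(LBINT y. heat_density t (x - y)) = 1"
    "(\<integral>\<^sup>+z. ennreal (heat_density t (z - x)) \<partial>lborel) = 1"
proof -
  have e: "heat_density t (x - y) = heat_density t (y + (- x))" for y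
    by (simp add: heat_density_def norm_minus_commute)
  show i: "integrable lborel (\<lambda>y. heat_density t (x - y))"
    unfolding e by (intro lborel_integrable_translate heat_density_integrable t)
  show j: "(LBINT y. heat_density t (x - y)) = 1"
    unfolding e lborel_integral_translate by (rule heat_density_integrable(2)[OF t])
  have "(\<integral>\<^sup>+z. ennreal (heat_density t (z - x)) \<partial>lborel) = (\<integral>\<^sup>+z. ennreal (heat_density t (x - z)) \<partial>lborel)"
    by (simp add: e)
  also have "\<dots> = 1"
    by (subst nn_integral_eq_integral[OF i]) (auto simp: heat_density_nonneg[OF t] j)
  finally show "(\<integral>\<^sup>+z. ennreal (heat_density t (z - x)) \<partial>lborel) = 1" .
qed

lemma heat_density_mult_integrable:
  fixes f :: "'a::euclidean_space \<Rightarrow> real"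
  assumes t: "0 < t" and f: "rapidly_decreasing f"
  shows "integrable lborel (\<lambda>y. heat_density t (x - y) * f y)"
proof -
  obtain C where C: "0 \<le> C" "\<And>x. norm (f x) \<le> C" using rapidly_decreasing_bounded[OF f] by blast
  have [measurable]: "f \<in> borel_measurable borel" using f by (simp add: rapidly_decreasing_def)
  show ?thesis
    by (rule integrable_mult_of_le[OF heat_density_translate(1)[OF t, of x], where C=C])
       (use C in \<open>auto simp: abs_mult mult.commute[of C] intro!: mult_left_mono\<close>)
qed

text \<open>The tangent at \<open>s = 1\<close>, read off from Young's inequality with second factor
  1.\<close>

lemma powr_ge_tangent:
  fixes s r :: real
  assumes "0 \<le> s" "1 \<le> r"
  shows "1 + r * (s - 1) \<le> s powr r"
proof (cases "r = 1")
  case False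
  then have r: "1 < r" using assms by simp
  define q where "q = r / (r - 1)"
  have q: "1 < q" "1 / r + 1 / q = 1" using r by (auto simp: q_def field_simps)
  from Youngs_inequality[OF r q assms(1), of 1] have "s \<le> s powr r / r + 1 / q" by simp
  also have "1 / q = 1 - 1 / r" using q by simp
  finally have "r * s \<le> r * (s powr r / r + (1 - 1 / r))"
    using r by (intro mult_left_mono) auto
  then show ?thesis using r by (simp add: distrib_left right_diff_distrib)
qed (use assms in auto)

text \<open>The tangent bound at \<open>norm (f y) / a\<close>, where \<open>a\<close> is the mean
  of \<open>norm (f y)\<close>, is integrated against the probability density; its left side
  integrates to exactly 1.\<close>

lemma heat_density_Jensen:
  fixes f :: "'a::euclidean_space \<Rightarrow> complex"
  assumes t: "0 < t" and f: "rapidly_decreasing f" and r: "1 \<le> r"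
  shows "(LBINT y. heat_density t (x - y) * norm (f y)) powr r \<le> (LBINT y. heat_density t (x - y) * norm (f y) powr r)"
proof -
  define a where "a = (LBINT y. heat_density t (x - y) * norm (f y))"
  have nf: "rapidly_decreasing (\<lambda>y. norm (f y))"
    using f by (auto simp: rapidly_decreasing_def)
  note i = heat_density_translate(1)[OF t, of x] heat_density_mult_integrable[OF t nf, of x]
    heat_density_mult_integrable[OF t rapidly_decreasing_norm_powr[OF f r], of x]
  have a0: "0 \<le> a"
    unfolding a_def by (intro Bochner_Integration.integral_nonneg) (simp add: heat_density_nonneg[OF t])
  show ?thesis
  proof (cases "a = 0")
    case True
    have "0 \<le> (LBINT y. heat_density t (x - y) * norm (f y) powr r)"
      by (intro Bochner_Integration.integral_nonneg) (simp add: heat_density_nonneg[OF t])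
    then show ?thesis unfolding a_def[symmetric] True by simp
  next
    case False
    then have a: "0 < a" using a0 by simp
    have "(LBINT y. heat_density t (x - y) * (1 - r) + (r / a) * (heat_density t (x - y) * norm (f y)))
        \<le> (LBINT y. (heat_density t (x - y) * norm (f y) powr r) / a powr r)"
    proof (rule integral_mono)
      show "integrable lborel (\<lambda>y. heat_density t (x - y) * (1 - r) + (r / a) * (heat_density t (x - y) * norm (f y)))"
        using i by (intro Bochner_Integration.integrable_add integrable_mult_left integrable_mult_right)
      show "integrable lborel (\<lambda>y. (heat_density t (x - y) * norm (f y) powr r) / a powr r)"
        using i by simp
      fix y
      have "heat_density t (x - y) * (1 + r * (norm (f y) / a - 1)) \<le> heat_density t (x - y) * (norm (f y) / a) powr r"
        using powr_ge_tangent[of "norm (f y) / a" r] a r by (intro mult_left_mono heat_density_nonneg[OF t]) auto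
      then show "heat_density t (x - y) * (1 - r) + (r / a) * (heat_density t (x - y) * norm (f y))
          \<le> (heat_density t (x - y) * norm (f y) powr r) / a powr r"
        using a by (simp add: powr_divide algebra_simps)
    qed
    also have "(LBINT y. heat_density t (x - y) * (1 - r) + (r / a) * (heat_density t (x - y) * norm (f y)))
        = (1 - r) + (r / a) * a"
      using i heat_density_translate(2)[OF t, of x]
      by (subst Bochner_Integration.integral_add) (auto simp: a_def)
    finally have "1 \<le> (LBINT y. heat_density t (x - y) * norm (f y) powr r) / a powr r"
      using a by simp
    then show ?thesis unfolding a_def[symmetric] using a by (simp add: pos_le_divide_eq)
  qed
qed

text \<open>Without its two multipliers the kernel only grows, which bounds \<open>g\<close> by
  means of \<open>|f|\<close> over a probability density. For finite \<open>p\<close>, Jensen moves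
  the power inside the mean, and after exchanging the integrals the density integrates to 1 in its
  other variable.\<close>

lemma heat_contraction:
  fixes f :: "'a::euclidean_space \<Rightarrow> complex"
  assumes t: "0 < t" and f: "rapidly_decreasing f" and p: "1 \<le> p"
    and g: "g \<in> borel_measurable borel" "\<And>x. g x = (LBINT y. of_real (mehler t x y) * f y)"
  shows "Lp_norm p g \<le> Lp_norm p f"
proof -
  have fm[measurable]: "f \<in> borel_measurable borel" using f by (simp add: rapidly_decreasing_def)
  note gm[measurable] = g(1)
  have nf: "rapidly_decreasing (\<lambda>y. norm (f y))"
    using f by (auto simp: rapidly_decreasing_def)
  have le: "norm (g x) \<le> (LBINT y. heat_density t (x - y) * norm (f y))" for x
  proof -
    have "norm (g x) \<le> (LBINT y. norm (of_real (mehler t x y) * f y))"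
      unfolding g(2) by (rule integral_norm_bound)
    also have "\<dots> \<le> (LBINT y. heat_density t (x - y) * norm (f y))"
    proof (rule integral_mono)
      show "integrable lborel (\<lambda>y. norm (of_real (mehler t x y) * f y))"
        using mehler_mult_integrable[OF t nf, of x] by (simp add: norm_mult abs_of_nonneg[OF mehler_le(1)[OF t]])
      show "integrable lborel (\<lambda>y. heat_density t (x - y) * norm (f y))"
        by (rule heat_density_mult_integrable[OF t nf])
      show "norm (of_real (mehler t x y) * f y) \<le> heat_density t (x - y) * norm (f y)" for y
        using mehler_le[OF t, of x y] by (auto simp: norm_mult intro!: mult_right_mono)
    qed
    finally show ?thesis .
  qed
  show ?thesis
  proof (cases "p = \<infinity>")
    case True
    define M where "M = enn2real (Lp_norm \<infinity> f)"
    have M: "Lp_norm \<infinity> f = ennreal M"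
      using rapidly_decreasing_Lp[OF f, of \<infinity>] by (simp add: M_def)
    have AE: "AE y in lborel. norm (f y) \<le> M"
      using Lp_norm_infinity_AE[of f] unfolding M by eventually_elim (simp add: M_def ennreal_le_iff)
    have "norm (g x) \<le> M" for x
    proof -
      have "(LBINT y. heat_density t (x - y) * norm (f y)) \<le> (LBINT y. heat_density t (x - y) * M)"
      proof (rule integral_mono_AE)
        show "integrable lborel (\<lambda>y. heat_density t (x - y) * norm (f y))"
          by (rule heat_density_mult_integrable[OF t nf])
        show "integrable lborel (\<lambda>y. heat_density t (x - y) * M)"
          by (intro integrable_mult_left heat_density_translate(1)[OF t])
        show "AE y in lborel. heat_density t (x - y) * norm (f y) \<le> heat_density t (x - y) * M"
          using AE by eventually_elim (intro mult_left_mono heat_density_nonneg[OF t])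
      qed
      also have "\<dots> = M" using heat_density_translate(2)[OF t, of x] by simp
      finally show ?thesis using le[of x] by simp
    qed
    then have "Lp_norm \<infinity> g \<le> ennreal M"
      unfolding Lp_norm_infinity by (intro esssup_I) (auto simp: ennreal_leI)
    then show ?thesis using True M by simp
  next
    case False
    define r where "r = enn2real p"
    have r: "1 \<le> r" using enn2real_ge_1[OF p False] by (simp add: r_def)
    have "(\<integral>\<^sup>+x. ennreal (norm (g x) powr r) \<partial>lborel)
        \<le> (\<integral>\<^sup>+x. (\<integral>\<^sup>+y. ennreal (heat_density t (x - y) * norm (f y) powr r) \<partial>lborel) \<partial>lborel)"
    proof (rule nn_integral_mono)
      fix x
      have "norm (g x) powr r \<le> (LBINT y. heat_density t (x - y) * norm (f y)) powr r"
        using r le by (intro powr_mono2) auto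
      also have "\<dots> \<le> (LBINT y. heat_density t (x - y) * norm (f y) powr r)"
        by (rule heat_density_Jensen[OF t f r])
      finally have "ennreal (norm (g x) powr r) \<le> ennreal (LBINT y. heat_density t (x - y) * norm (f y) powr r)"
        by (rule ennreal_leI)
      also have "\<dots> = (\<integral>\<^sup>+y. ennreal (heat_density t (x - y) * norm (f y) powr r) \<partial>lborel)"
        by (intro nn_integral_eq_integral[symmetric] heat_density_mult_integrable t
            rapidly_decreasing_norm_powr f r) (simp add: heat_density_nonneg[OF t])
      finally show "ennreal (norm (g x) powr r) \<le> (\<integral>\<^sup>+y. ennreal (heat_density t (x - y) * norm (f y) powr r) \<partial>lborel)" .
    qed
    also have "\<dots> = (\<integral>\<^sup>+y. (\<integral>\<^sup>+x. ennreal (heat_density t (x - y) * norm (f y) powr r) \<partial>lborel) \<partial>lborel)"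
      by (rule lborel_pair.Fubini'[symmetric]) measurable
    also have "\<dots> = (\<integral>\<^sup>+y. ennreal (norm (f y) powr r) \<partial>lborel)"
    proof (rule nn_integral_cong)
      fix y
      have "(\<integral>\<^sup>+x. ennreal (heat_density t (x - y) * norm (f y) powr r) \<partial>lborel)
          = (\<integral>\<^sup>+x. ennreal (heat_density t (x - y)) * ennreal (norm (f y) powr r) \<partial>lborel)"
        by (intro nn_integral_cong ennreal_mult heat_density_nonneg[OF t]) auto
      also have "\<dots> = (\<integral>\<^sup>+x. ennreal (heat_density t (x - y)) \<partial>lborel) * ennreal (norm (f y) powr r)"
        by (rule nn_integral_multc) measurable
      finally show "(\<integral>\<^sup>+x. ennreal (heat_density t (x - y) * norm (f y) powr r) \<partial>lborel) = ennreal (norm (f y) powr r)"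
        by (simp add: heat_density_translate(3)[OF t])
    qed
    finally show ?thesis
      unfolding Lp_norm_eq_nn_integral[OF False] r_def[symmetric] using r by (intro ennpowr_mono) auto
  qed
qed

lemma hermite_synthesis_heat:
  assumes t: "0 < t"
  shows "hermite_synthesis (\<lambda>\<mu>. exp (- t * \<mu>) * F \<mu>) I u x
    = (LBINT y. of_real (mehler t x y) * hermite_synthesis F I u y)"
proof -
  define c where "c \<alpha> = of_real (F (energy \<alpha>)) * dist_hermite_coeff \<alpha> u" for \<alpha>
  have i: "integrable lborel (\<lambda>y. complex_of_real (mehler t x y * hermite \<alpha> y))" for \<alpha>
    using mehler_mult_integrable[OF t hermite_rapidly_decreasing, of x \<alpha>] by (rule integrable_of_real)
  have "(LBINT y. of_real (mehler t x y) * hermite_synthesis F I u y)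
      = (LBINT y. (\<Sum>\<alpha>\<in>I. c \<alpha> * complex_of_real (mehler t x y * hermite \<alpha> y)))"
    by (simp add: hermite_synthesis_def c_def sum_distrib_left mult_ac)
  also have "\<dots> = (\<Sum>\<alpha>\<in>I. c \<alpha> * (LBINT y. complex_of_real (mehler t x y * hermite \<alpha> y)))"
    using i by (subst Bochner_Integration.integral_sum) (auto simp del: of_real_mult)
  also have "\<dots> = (\<Sum>\<alpha>\<in>I. c \<alpha> * of_real (exp (- t * energy \<alpha>) * hermite \<alpha> x))"
    by (simp only: integral_complex_of_real mehler_integral_hermite[OF t])
  finally show ?thesis by (simp add: hermite_synthesis_def c_def mult_ac)
qed

lemma hermite_synthesis_measurable[measurable]: "hermite_synthesis F I u \<in> borel_measurable borel"
  using hermite_synthesis_rapidly_decreasing by (rule rapidly_decreasing_measurable)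

lemma heat_diff_Lp_le:
  assumes t: "0 < t" and p: "1 \<le> p"
  shows "Lp_norm p (hermite_synthesis (\<lambda>\<mu>. (exp (- t * \<mu>) - 1) * F \<mu>) I u) \<le> 4 * Lp_norm p (hermite_synthesis F I u)"
proof -
  let ?h = "hermite_synthesis (\<lambda>\<mu>. exp (- t * \<mu>) * F \<mu>) I u" and ?f = "hermite_synthesis F I u"
  have "Lp_norm p ?h \<le> Lp_norm p ?f"
    using hermite_synthesis_heat[OF t]
    by (intro heat_contraction[OF t hermite_synthesis_rapidly_decreasing p hermite_synthesis_measurable])
  then have "Lp_norm p (\<lambda>x. ?f x - ?h x) \<le> 4 * Lp_norm p ?f"
    by (intro Lp_norm_diff_le p hermite_synthesis_measurable)
  moreover have "hermite_synthesis (\<lambda>\<mu>. (exp (- t * \<mu>) - 1) * F \<mu>) I u x = - (?f x - ?h x)" for x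
    unfolding hermite_synthesis_def sum_subtractf[symmetric] sum_negf[symmetric]
    by (intro sum.cong refl) (simp add: algebra_simps)
  ultimately show ?thesis
    by (simp add: Lp_norm_def norm_minus_commute)
qed

text \<open>One Gaussian majorizes all Hermite functions in the sum, so a pointwise bound and a
  single \<open>L^p\<close> norm suffice. The factor \<open>t\<close> comes from
  \<open>|exp (- t e) - 1| <= t e\<close> for energies \<open>e\<close>; \<open>D\<close> depends on
  \<open>I\<close> and \<open>u\<close>.\<close>

lemma heat_diff_Lp_small:
  fixes u :: "'a::euclidean_space functional"
  assumes p: "1 \<le> p" and I: "finite I"
  shows "\<exists>D\<ge>0. \<forall>t>0. Lp_norm p (hermite_synthesis (\<lambda>\<mu>. (exp (- t * \<mu>) - 1) * F \<mu>) I u) \<le> ennreal (t * D)"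
proof -
  let ?e = "\<lambda>x::'a. complex_of_real (exp (- (1/4) * (norm x)\<^sup>2))"
  have e: "rapidly_decreasing ?e"
    by (rule rapidly_decreasing_mult_poly_bound[where C=1 and k=0, OF exp_neg_norm_rapidly_decreasing[of "1/4"]]) simp_all
  define N where "N = enn2real (Lp_norm p ?e)"
  have N: "Lp_norm p ?e = ennreal N" using rapidly_decreasing_Lp[OF e p] by (simp add: N_def)
  obtain C where C: "\<And>\<alpha>. 0 \<le> C \<alpha>" "\<And>\<alpha> x::'a. \<bar>hermite \<alpha> x\<bar> \<le> C \<alpha> * exp (- (norm x)\<^sup>2 / 4)"
    using hermite_le by metis
  define K where "K = (\<Sum>\<alpha>\<in>I. energy \<alpha> * \<bar>F (energy \<alpha>)\<bar> * norm (dist_hermite_coeff \<alpha> u) * C \<alpha>)"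
  have en: "0 \<le> energy \<alpha>" for \<alpha> :: "'a \<Rightarrow> nat" using energy_ge_1[of \<alpha>] by linarith
  have K0: "0 \<le> K" unfolding K_def using C en by (intro sum_nonneg) auto
  have "Lp_norm p (hermite_synthesis (\<lambda>\<mu>. (exp (- t * \<mu>) - 1) * F \<mu>) I u) \<le> ennreal (t * (K * N))" if t: "0 < t" for t
  proof -
    have "norm (hermite_synthesis (\<lambda>\<mu>. (exp (- t * \<mu>) - 1) * F \<mu>) I u x) \<le> (t * K) * norm (?e x)" for x
    proof -
      have "norm (hermite_synthesis (\<lambda>\<mu>. (exp (- t * \<mu>) - 1) * F \<mu>) I u x)
        \<le> (\<Sum>\<alpha>\<in>I. \<bar>exp (- t * energy \<alpha>) - 1\<bar> * \<bar>F (energy \<alpha>)\<bar> * norm (dist_hermite_coeff \<alpha> u) * \<bar>hermite \<alpha> x\<bar>)"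
        unfolding hermite_synthesis_def
        by (rule order_trans[OF norm_sum], rule sum_mono) (simp only: norm_mult norm_of_real abs_mult order_refl)
      also have "\<dots> \<le> (\<Sum>\<alpha>\<in>I. (t * energy \<alpha>) * \<bar>F (energy \<alpha>)\<bar> * norm (dist_hermite_coeff \<alpha> u) * (C \<alpha> * exp (- (norm x)\<^sup>2 / 4)))"
      proof (intro sum_mono mult_mono C order_refl)
        fix \<alpha> :: "'a \<Rightarrow> nat"
        have "1 + - t * energy \<alpha> \<le> exp (- t * energy \<alpha>)" by (rule exp_ge_add_one_self)
        moreover have "exp (- t * energy \<alpha>) \<le> 1" using t en[of \<alpha>] by simp
        ultimately show "\<bar>exp (- t * energy \<alpha>) - 1\<bar> \<le> t * energy \<alpha>" by simp
      qed (use t en C in auto)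
      also have "\<dots> = (t * K) * norm (?e x)"
        by (simp add: K_def sum_distrib_left sum_distrib_right mult_ac)
      finally show ?thesis .
    qed
    then have "Lp_norm p (hermite_synthesis (\<lambda>\<mu>. (exp (- t * \<mu>) - 1) * F \<mu>) I u) \<le> ennreal (t * K) * Lp_norm p ?e"
      using t K0 by (intro Lp_norm_le_mult p hermite_synthesis_measurable rapidly_decreasing_measurable[OF e]) auto
    then show ?thesis using t K0 unfolding N by (simp add: ennreal_mult'[symmetric] mult.assoc)
  qed
  then show ?thesis using K0 by (intro exI[of _ "K * N"]) (auto simp: N_def)
qed

subsection \<open>Convergence in Besov spaces\<close>

definition block_function :: "(real \<Rightarrow> real) \<Rightarrow> int \<Rightarrow> 'a::euclidean_space functional \<Rightarrow> 'a \<Rightarrow> complex" where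
  "block_function \<phi> j u = hermite_synthesis (dyadic_multiplier \<phi> j) (block_indices \<phi> j) u"

definition heat_block_function :: "(real \<Rightarrow> real) \<Rightarrow> int \<Rightarrow> real \<Rightarrow> 'a::euclidean_space functional \<Rightarrow> 'a \<Rightarrow> complex" where
  "heat_block_function \<phi> j t u =
     hermite_synthesis (\<lambda>\<mu>. (exp (- t * \<mu>) - 1) * dyadic_multiplier \<phi> j \<mu>) (block_indices \<phi> j) u"

lemma block_function_rapidly_decreasing: "rapidly_decreasing (block_function \<phi> j u)"
  unfolding block_function_def by (rule hermite_synthesis_rapidly_decreasing)

lemma heat_block_function_rapidly_decreasing: "rapidly_decreasing (heat_block_function \<phi> j t u)"
  unfolding heat_block_function_def by (rule hermite_synthesis_rapidly_decreasing)

lemma block_norm: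
  assumes "dyadic_partition \<phi>" "u \<in> tempered" "1 \<le> p"
  shows "dist_Lp_norm p (block \<phi> j u) = Lp_norm p (block_function \<phi> j u)"
  unfolding block_function_def
  by (rule dist_Lp_norm_eq[OF block_represents[OF assms(1,2)] hermite_synthesis_rapidly_decreasing assms(3)])

lemma block_heat_diff_norm:
  assumes "dyadic_partition \<phi>" "u \<in> tempered" "1 \<le> p"
  shows "dist_Lp_norm p (block \<phi> j (heat_diff t u)) = Lp_norm p (heat_block_function \<phi> j t u)"
  unfolding heat_block_function_def
  by (rule dist_Lp_norm_eq[OF block_heat_diff_represents[OF assms(1,2)] hermite_synthesis_rapidly_decreasing assms(3)])

lemma heat_block_norm_le:
  assumes "0 < t" "1 \<le> p"
  shows "Lp_norm p (heat_block_function \<phi> j t u) \<le> 4 * Lp_norm p (block_function \<phi> j u)"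
  unfolding block_function_def heat_block_function_def by (rule heat_diff_Lp_le[OF assms])

text \<open>Dominated convergence is applied along sequences.\<close>

lemma tendsto_at_right_0_sequentially:
  fixes f :: "real \<Rightarrow> 'b::topological_space"
  assumes "\<And>X. (\<And>n. 0 < X n) \<Longrightarrow> X \<longlonglongrightarrow> 0 \<Longrightarrow> (\<lambda>n. f (X n)) \<longlonglongrightarrow> l"
  shows "(f \<longlongrightarrow> l) (at_right 0)"
  unfolding tendsto_at_iff_sequentially using assms by (auto simp: o_def)

lemma heat_block_norm_tendsto_0:
  assumes part: "dyadic_partition \<phi>" and p: "1 \<le> p" and X: "\<And>n. 0 < X n" "X \<longlonglongrightarrow> 0"
  shows "(\<lambda>n. Lp_norm p (heat_block_function \<phi> j (X n) u)) \<longlonglongrightarrow> 0"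
proof -
  obtain D where D: "0 \<le> D" "\<And>t. 0 < t \<Longrightarrow> Lp_norm p (heat_block_function \<phi> j t u) \<le> ennreal (t * D)"
    unfolding heat_block_function_def
    using heat_diff_Lp_small[OF p finite_block_indices[OF part, of j], where F="dyadic_multiplier \<phi> j" and u=u] by blast
  have lim: "(\<lambda>n. ennreal (X n * D)) \<longlonglongrightarrow> ennreal (0 * D)"
    by (intro tendsto_ennrealI tendsto_intros X)
  show ?thesis
    by (rule tendsto_sandwich[where f="\<lambda>_. 0" and h="\<lambda>n. ennreal (X n * D)"])
       (use lim D X in auto)
qed

lemma heat_diff_besov_tendsto_0:
  fixes f :: "'a::euclidean_space functional"
  assumes part: "dyadic_partition \<phi>" and p: "1 \<le> p" and q: "1 \<le> q" "q < \<infinity>"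
    and f: "f \<in> besov_space \<phi> s p q"
  shows "((\<lambda>t. besov_norm \<phi> s p q (heat_diff t f)) \<longlongrightarrow> 0) (at_right 0)"
proof (rule tendsto_at_right_0_sequentially)
  fix X :: "nat \<Rightarrow> real" assume X: "\<And>n. 0 < X n" "X \<longlonglongrightarrow> 0"
  define r where "r = enn2real q"
  have r: "1 \<le> r" using enn2real_ge_1[OF q(1)] q(2) by (simp add: r_def)
  have fT: "f \<in> tempered" using f by (simp add: besov_space_def)
  define w where "w j = ennreal (2 powr (s * of_int j))" for j :: int
  let ?C = "count_space {-1::int..}"
  let ?a = "\<lambda>j. ennpowr (w j * Lp_norm p (block_function \<phi> j f)) r"
  let ?b = "\<lambda>n j. ennpowr (w j * Lp_norm p (heat_block_function \<phi> j (X n) f)) r"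
  have b_le: "?b n j \<le> ennreal (4 powr r) * ?a j" for n j
  proof -
    have "w j * Lp_norm p (heat_block_function \<phi> j (X n) f) \<le> w j * (4 * Lp_norm p (block_function \<phi> j f))"
      by (intro mult_left_mono heat_block_norm_le X p) simp
    also have "\<dots> = ennreal 4 * (w j * Lp_norm p (block_function \<phi> j f))"
      by (simp add: mult.left_commute)
    finally have "?b n j \<le> ennpowr (ennreal 4 * (w j * Lp_norm p (block_function \<phi> j f))) r"
      using r by (intro ennpowr_mono) auto
    then show ?thesis using ennpowr_mult[of 4] by simp
  qed
  have q_fin: "q \<noteq> \<infinity>" using q(2) by auto
  have "besov_norm \<phi> s p q f < \<infinity>" using f by (simp add: besov_space_def)
  then have fin: "(\<integral>\<^sup>+j. ?a j \<partial>?C) < \<infinity>"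
    using q_fin unfolding besov_norm_def lebesgue_norm_def block_norm[OF part fT p]
    by (simp add: ennpowr_less_top_iff r_def w_def)
  \<comment> \<open>Finite \<open>q\<close> makes the majorant \<open>4 powr r * ?a j\<close>
    summable, which is the membership of \<open>f\<close> in the Besov space.\<close>
  have lim: "(\<lambda>n. \<integral>\<^sup>+j. ?b n j \<partial>?C) \<longlonglongrightarrow> (\<integral>\<^sup>+j. 0 \<partial>?C)"
  proof (rule nn_integral_dominated_convergence)
    show "AE j in ?C. ?b n j \<le> ennreal (4 powr r) * ?a j" for n
      using b_le by simp
    show "(\<integral>\<^sup>+j. ennreal (4 powr r) * ?a j \<partial>?C) < \<infinity>"
      using fin by (simp add: nn_integral_cmult ennreal_mult_less_top)
    have "(\<lambda>n. ?b n j) \<longlonglongrightarrow> 0" for j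
    proof -
      have "(\<lambda>n. w j * Lp_norm p (heat_block_function \<phi> j (X n) f)) \<longlonglongrightarrow> w j * 0"
        by (intro ennreal_tendsto_cmult heat_block_norm_tendsto_0[OF part p X]) (simp add: w_def)
      then show ?thesis using r by (intro ennpowr_tendsto_0) auto
    qed
    then show "AE j in ?C. (\<lambda>n. ?b n j) \<longlonglongrightarrow> 0" by simp
  qed auto
  have "(\<lambda>n. ennpowr (\<integral>\<^sup>+j. ?b n j \<partial>?C) (1 / r)) \<longlonglongrightarrow> 0"
    using lim r by (intro ennpowr_tendsto_0) auto
  moreover have "besov_norm \<phi> s p q (heat_diff (X n) f) = ennpowr (\<integral>\<^sup>+j. ?b n j \<partial>?C) (1 / r)" for n
    using q_fin unfolding besov_norm_def lebesgue_norm_def block_heat_diff_norm[OF part fT p]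
    by (simp add: r_def w_def)
  ultimately show "(\<lambda>n. besov_norm \<phi> s p q (heat_diff (X n) f)) \<longlonglongrightarrow> 0" by simp
qed

section \<open>The dual pairing for infinite \<open>q\<close>\<close>

lemma pairing_integrand_AE_eq:
  fixes f g :: "'a::euclidean_space functional"
  assumes U: "represents U (block \<phi> j f)" and V: "represents V (block \<phi> j g)"
  shows "pairing_integrand \<phi> j f g \<in> borel_measurable borel"
    and "AE x in lborel. pairing_integrand \<phi> j f g x = U x * cnj (V x)"
proof -
  have R: "represents (function_of (block \<phi> j f)) (block \<phi> j f)" "represents (function_of (block \<phi> j g)) (block \<phi> j g)"
    unfolding function_of_def
    by (rule someI[of "\<lambda>h. represents h (block \<phi> j f)", OF U], rule someI[of "\<lambda>h. represents h (block \<phi> j g)", OF V])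
  then have [measurable]: "function_of (block \<phi> j f) \<in> borel_measurable borel" "function_of (block \<phi> j g) \<in> borel_measurable borel"
    by (auto simp: represents_def)
  show "pairing_integrand \<phi> j f g \<in> borel_measurable borel"
    unfolding pairing_integrand_def[abs_def] by measurable
  show "AE x in lborel. pairing_integrand \<phi> j f g x = U x * cnj (V x)"
    using represents_unique[OF R(1) U] represents_unique[OF R(2) V]
    by eventually_elim (simp add: pairing_integrand_def)
qed

lemma heat_diff_besov_pairing:
  fixes f g :: "'a::euclidean_space functional"
  assumes part: "dyadic_partition \<phi>" and p: "1 < p" "1 \<le> p'" "1 / p + 1 / p' = 1"
    and f: "f \<in> besov_space \<phi> s p \<infinity>" and g: "g \<in> besov_space \<phi> (- s) p' 1"
  shows "\<forall>t>0. besov_pairing_defined \<phi> (heat_diff t f) g"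
    and "((\<lambda>t. besov_pairing \<phi> (heat_diff t f) g) \<longlongrightarrow> 0) (at_right 0)"
proof -
  have p1: "1 \<le> p" using p(1) by simp
  have T: "f \<in> tempered" "g \<in> tempered" using f g by (simp_all add: besov_space_def)
  let ?U = "\<lambda>j t. heat_block_function \<phi> j t f" and ?V = "\<lambda>j. block_function \<phi> j g"
  let ?W = "\<lambda>j. block_function \<phi> j f"
  have repU: "represents (?U j t) (block \<phi> j (heat_diff t f))" for j t
    unfolding heat_block_function_def by (rule block_heat_diff_represents[OF part T(1)])
  have repV: "represents (?V j) (block \<phi> j g)" for j
    unfolding block_function_def by (rule block_represents[OF part T(2)])
  define c where "c t j = (LBINT x. ?U j t x * cnj (?V j x))" for t j
  have UV: "integrable lborel (\<lambda>x. ?U j t x * cnj (?V j x))" for j t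
  proof -
    have "rapidly_decreasing (\<lambda>x. cnj (?V j x))"
      by (rule rapidly_decreasing_mult_poly_bound[OF block_function_rapidly_decreasing[of \<phi> j g], where C=1 and k=0])
         (auto simp: block_function_def)
    then show ?thesis
      by (intro rapidly_decreasing_integrable rapidly_decreasing_mult heat_block_function_rapidly_decreasing)
  qed
  have pi: "integrable lborel (pairing_integrand \<phi> j (heat_diff t f) g)"
    "(LBINT x. pairing_integrand \<phi> j (heat_diff t f) g x) = c t j" for j t
  proof -
    note m = pairing_integrand_AE_eq[OF repU[of j t] repV[of j]]
    show "integrable lborel (pairing_integrand \<phi> j (heat_diff t f) g)"
      using integrable_cong_AE[of "pairing_integrand \<phi> j (heat_diff t f) g" lborel "\<lambda>x. ?U j t x * cnj (?V j x)"] m UV[of j t]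
      by auto
    show "(LBINT x. pairing_integrand \<phi> j (heat_diff t f) g x) = c t j"
      unfolding c_def by (rule integral_cong_AE) (use m UV[of j t] in auto)
  qed
  have H: "ennreal (norm (c t j)) \<le> Lp_norm p (?U j t) * Lp_norm p' (?V j)" for t j
    unfolding c_def
    by (intro Holder_rapidly_decreasing heat_block_function_rapidly_decreasing block_function_rapidly_decreasing p)
  \<comment> \<open>Only the empty set is null for the counting measure, so the essential supremum
    bounds every single term.\<close>
  obtain S where S: "S < top" "\<And>j. -1 \<le> j \<Longrightarrow> ennreal (2 powr (s * of_int j)) * Lp_norm p (?W j) \<le> S"
  proof
    let ?n = "\<lambda>j. ennreal (2 powr (s * of_int j)) * Lp_norm p (?W j)"
    have e: "besov_norm \<phi> s p \<infinity> f = esssup (count_space {-1..}) ?n"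
      unfolding besov_norm_def lebesgue_norm_def block_norm[OF part T(1) p1] by simp
    show "besov_norm \<phi> s p \<infinity> f < top" using f by (simp add: besov_space_def)
    show "?n j \<le> besov_norm \<phi> s p \<infinity> f" if "-1 \<le> j" for j
      using esssup_AE[where M="count_space {-1..}" and f="?n"] that unfolding e AE_count_space by simp
  qed
  \<comment> \<open>The majorant of the pairing, free of \<open>t\<close>: \<open>4 * S\<close>
    bounds the weighted blocks coming from \<open>f\<close>, the weights for \<open>s\<close> and
    \<open>- s\<close> cancel, and below \<open>-1\<close> all blocks vanish.\<close>
  define d where "d j = (if -1 \<le> j then 4 * S * (ennreal (2 powr (- s * of_int j)) * Lp_norm p' (?V j)) else 0)" for j :: int
  have c_le: "ennreal (norm (c t j)) \<le> d j" if t: "0 < t" for t j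
  proof (cases "-1 \<le> j")
    case True
    have "ennreal (norm (c t j)) \<le> (4 * Lp_norm p (?W j)) * Lp_norm p' (?V j)"
      by (rule order_trans[OF H]) (intro mult_right_mono heat_block_norm_le t p1, simp)
    also have "\<dots> = 4 * (ennreal (2 powr (s * of_int j)) * Lp_norm p (?W j)) * (ennreal (2 powr (- s * of_int j)) * Lp_norm p' (?V j))"
    proof -
      have "ennreal (2 powr (s * of_int j)) * ennreal (2 powr (- s * of_int j)) = 1"
        by (simp add: ennreal_mult'[symmetric] powr_add[symmetric])
      then have "Lp_norm p (?W j) = (ennreal (2 powr (s * of_int j)) * ennreal (2 powr (- s * of_int j))) * Lp_norm p (?W j)"
        by simp
      then show ?thesis by (simp add: mult_ac)
    qed
    also have "\<dots> \<le> d j"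
      unfolding d_def using True S(2)[OF True] by (simp add: mult_right_mono mult_left_mono)
    finally show ?thesis .
  next
    case False
    then have "block_indices \<phi> j = ({} :: ('a \<Rightarrow> nat) set)"
      by (intro block_indices_empty[OF part]) simp
    then have "c t j = 0" by (simp add: c_def heat_block_function_def hermite_synthesis_def)
    then show ?thesis by simp
  qed
  let ?C = "count_space (UNIV :: int set)"
  have "(\<integral>\<^sup>+j. ennreal (2 powr (- s * of_int j)) * Lp_norm p' (?V j) \<partial>count_space {-1..}) < top"
  proof -
    have "ennpowr z 1 = z" for z by (cases z) (auto simp: ennpowr_def)
    moreover have "besov_norm \<phi> (- s) p' 1 g < \<infinity>" using g by (simp add: besov_space_def)
    ultimately show ?thesis
      unfolding besov_norm_def lebesgue_norm_def block_norm[OF part T(2) p(2)] by simp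
  qed
  moreover have "(\<integral>\<^sup>+j. d j \<partial>?C) = (\<integral>\<^sup>+j. 4 * S * (ennreal (2 powr (- s * of_int j)) * Lp_norm p' (?V j)) \<partial>count_space {-1..})"
    by (subst nn_integral_count_space_indicator) (auto simp: d_def intro!: nn_integral_cong split: split_indicator)
  ultimately have dfin: "(\<integral>\<^sup>+j. d j \<partial>?C) < top"
    using S(1) by (simp add: nn_integral_cmult ennreal_mult_less_top)
  \<comment> \<open>A finite sum has finite terms, so the passage to \<open>enn2real (d j)\<close>
    loses nothing.\<close>
  have dt: "d j < top" for j
  proof (rule ccontr)
    assume "\<not> d j < top"
    then have "(\<integral>\<^sup>+j. d j \<partial>?C) \<ge> top"
      using nn_integral_ge_point[of j UNIV d] by (simp add: not_less top_unique)
    then show False using dfin by (simp add: not_le[symmetric])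
  qed
  have di: "integrable ?C (\<lambda>j. enn2real (d j))"
  proof (rule integrableI_bounded)
    show "(\<integral>\<^sup>+j. ennreal (norm (enn2real (d j))) \<partial>?C) < \<infinity>" using dfin dt by simp
  qed simp
  have c_norm: "norm (c t j) \<le> enn2real (d j)" if "0 < t" for t j
  proof -
    have "ennreal (norm (c t j)) \<le> ennreal (enn2real (d j))" using c_le[OF that] dt by simp
    then show ?thesis by (subst (asm) ennreal_le_iff) auto
  qed
  have ci: "integrable ?C (c t)" if "0 < t" for t
    by (rule Bochner_Integration.integrable_bound[OF di]) (use c_norm[OF that] in auto)
  \<comment> \<open>The pairing is an unordered sum, while dominated convergence speaks of integrals
    over the counting measure; absolute summability identifies the two.\<close>
  then have ca: "Infinite_Set_Sum.abs_summable_on (c t) UNIV" if "0 < t" for t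
    using that by (simp add: abs_summable_on_def)
  have "Infinite_Sum.abs_summable_on (c t) UNIV" if "0 < t" for t
    using ca[OF that] by (simp add: abs_summable_equivalent)
  then show "\<forall>t>0. besov_pairing_defined \<phi> (heat_diff t f) g"
    unfolding besov_pairing_defined_def pi(2) using repU repV pi(1) abs_summable_summable by blast
  have bp: "besov_pairing \<phi> (heat_diff t f) g = (\<integral>j. c t j \<partial>?C)" if "0 < t" for t
    unfolding besov_pairing_def pi(2) infsetsum_infsum[OF ca[OF that], symmetric] infsetsum_def ..
  show "((\<lambda>t. besov_pairing \<phi> (heat_diff t f) g) \<longlongrightarrow> 0) (at_right 0)"
  proof (rule tendsto_at_right_0_sequentially)
    fix X :: "nat \<Rightarrow> real" assume X: "\<And>n. 0 < X n" "X \<longlonglongrightarrow> 0"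
    have "(\<lambda>n. \<integral>j. c (X n) j \<partial>?C) \<longlonglongrightarrow> (\<integral>j. 0 \<partial>?C)"
    proof (rule integral_dominated_convergence[OF _ _ di])
      have "(\<lambda>n. c (X n) j) \<longlonglongrightarrow> 0" for j
      proof -
        \<comment> \<open>The norm of the block of \<open>g\<close> is finite, as a product with a
          null sequence in \<open>ennreal\<close> requires.\<close>
        have lim: "(\<lambda>n. Lp_norm p' (?V j) * Lp_norm p (?U j (X n))) \<longlonglongrightarrow> Lp_norm p' (?V j) * 0"
          using rapidly_decreasing_Lp[OF block_function_rapidly_decreasing p(2)]
          by (intro ennreal_tendsto_cmult heat_block_norm_tendsto_0[OF part p1 X]) simp
        have "(\<lambda>n. ennreal (norm (c (X n) j))) \<longlonglongrightarrow> 0"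
          by (rule tendsto_sandwich[where f="\<lambda>_. 0" and
                h="\<lambda>n. Lp_norm p' (?V j) * Lp_norm p (?U j (X n))"])
               (use H lim in \<open>auto simp: mult.commute\<close>)
        then have "(\<lambda>n. enn2real (ennreal (norm (c (X n) j)))) \<longlonglongrightarrow> 0"
          using tendsto_enn2real[of "\<lambda>n. ennreal (norm (c (X n) j))" 0 sequentially] by simp
        then show ?thesis by (simp add: tendsto_norm_zero_iff)
      qed
      then show "AE j in ?C. (\<lambda>n. c (X n) j) \<longlonglongrightarrow> 0" by simp
      show "AE j in ?C. norm (c (X n) j) \<le> enn2real (d j)" for n
        using c_norm[OF X(1)] by simp
    qed auto
    then show "(\<lambda>n. besov_pairing \<phi> (heat_diff (X n) f) g) \<longlonglongrightarrow> 0"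
      using X by (simp add: bp)
  qed
qed

theorem theorem1p3:
  fixes \<phi>\<^sub>0 :: "real \<Rightarrow> real" and s :: real and p q p' q' :: ennreal
  assumes "dyadic_partition \<phi>\<^sub>0"
    and "1 \<le> p" and "1 \<le> q" and "1 \<le> p'" and "1 \<le> q'"
    and "1 / p + 1 / p' = 1" and "1 / q + 1 / q' = 1"
  shows "(q < \<infinity> \<longrightarrow>
           (\<forall>f :: 'a::euclidean_space functional. f \<in> besov_space \<phi>\<^sub>0 s p q \<longrightarrow>
             ((\<lambda>t. besov_norm \<phi>\<^sub>0 s p q (heat_diff t f)) \<longlongrightarrow> 0) (at_right 0)))
       \<and> (1 < p \<and> q = \<infinity> \<longrightarrow>
           (\<forall>f :: 'a functional. f \<in> besov_space \<phi>\<^sub>0 s p \<infinity> \<longrightarrow>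
             (\<forall>g \<in> besov_space \<phi>\<^sub>0 (- s) p' 1.
               (\<forall>t>0. besov_pairing_defined \<phi>\<^sub>0 (heat_diff t f) g) \<and>
               ((\<lambda>t. besov_pairing \<phi>\<^sub>0 (heat_diff t f) g) \<longlongrightarrow> 0) (at_right 0))))"
  using heat_diff_besov_tendsto_0[OF assms(1-3)] heat_diff_besov_pairing[OF assms(1) _ assms(4,6)] by blast

end
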